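(* Let $n\ge 1$, $\alpha\in\mathbb{R}^n$ with $\alpha_i>-\frac12$ for all $i$, and $m\in\mathbb{N}$. Then for all $s>\frac12(|\alpha|+n)+m$, $$H_\alpha^s\subset\mathcal{C}_e^m(\mathbb{R}^n).$$
   Context: Fix $n\ge1$ and $\alpha=(\alpha_1,\dots,\alpha_n)\in\mathbb{R}^n$ with $\alpha_i>-\frac12$; $|\alpha|=\alpha_1+\dots+\alpha_n$, $\|x\|$ is the Euclidean norm, $\mathbb{N}=\{0,1,2,\dots\}$. $\mathbb{R}^n_+=\{x\in\mathbb{R}^n: x_1>0,\dots,x_n>0\}$, $d\mu_\alpha(x)=\prod_{i=1}^n x_i^{2\alpha_i+1}dx_i$, and $L^p_\alpha(\mathbb{R}^n_+)=L^p(\mathbb{R}^n_+,d\mu_\alpha)$ (complex-valued functions). A function on $\mathbb{R}^n$ is called even if it is even in each variable. $\mathcal{C}^m_e(\mathbb{R}^n)$ is the space of even $\mathcal{C}^m$ functions on $\mathbb{R}^n$. $\mathcal{S}_e(\mathbb{R}^n)$ is the space of even Schwartz functions with its usual Fréchet topology, and $\mathcal{S}'_e(\mathbb{R}^n)$ is its topological dual (even tempered distributions). A function $\psi$ is identified with the element of $\mathcal{S}'_e(\mathbb{R}^n)$ given by $\langle\psi,f\rangle=\int_{\mathbb{R}^n_+}\psi f\,d\mu_\alpha$ whenever this makes sense (in particular for $\psi\in L^p_\alpha(\mathbb{R}^n_+)$ and for bounded measurable $\psi$); the inclusion in the claim is understood through this identification. An even smooth function $h$ all of whose derivatives grow at most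 polynomially acts on $\mathcal{S}'_e(\mathbb{R}^n)$ by $\langle hT,\varphi\rangle=\langle T,h\varphi\rangle$. For $\gamma>-\frac12$, $j_\gamma(t)=\Gamma(\gamma+1)\sum_{k\ge0}\frac{(-1)^k}{k!\,\Gamma(k+\gamma+1)}\left(\frac t2\right)^{2k}$ is the normalized Bessel function. The Fourier-Bessel transform is $\mathcal{F}_\alpha f(\lambda)=\int_{\mathbb{R}^n_+}f(x)\prod_{i=1}^n j_{\alpha_i}(\lambda_ix_i)\,d\mu_\alpha(x)$; it is a topological isomorphism of $\mathcal{S}_e(\mathbb{R}^n)$ with inverse $c_\alpha^2\mathcal{F}_\alpha$, where $c_\alpha=\frac{2^{-|\alpha|}}{\prod_{i=1}^n\Gamma(\alpha_i+1)}$. It is extended to $\mathcal{S}'_e(\mathbb{R}^n)$ by $\langle\mathcal{F}_\alpha(T),\varphi\rangle=\langle T,\mathcal{F}_\alpha(\varphi)\rangle$. For $s\in\mathbb{R}$: $H_\alpha^s=\{T\in\mathcal{S}'_e(\mathbb{R}^n): (1+\|\xi\|^2)^s\mathcal{F}_\alpha(T)\in L^2_\alpha(\mathbb{R}^n_+)\}$ (note the exponent $s$, not $s/2$). *)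

theory Defs
  imports "HOL-Analysis.Analysis"
begin

definition even_fun :: "(real^'n \<Rightarrow> complex) \<Rightarrow> bool" where
  "even_fun f \<longleftrightarrow> (\<forall>i x. f (\<chi> k. if k = i then - x $ k else x $ k) = f x)"

definition partial_deriv :: "'n \<Rightarrow> (real^'n \<Rightarrow> complex) \<Rightarrow> real^'n \<Rightarrow> complex" where
  "partial_deriv i f x = vector_derivative (\<lambda>t. f (x + t *\<^sub>R axis i 1)) (at 0)"

definition iter_partial :: "'n list \<Rightarrow> (real^'n \<Rightarrow> complex) \<Rightarrow> real^'n \<Rightarrow> complex" where
  "iter_partial is f = foldr partial_deriv is f"

primrec cont_diff :: "nat \<Rightarrow> (real^'n \<Rightarrow> complex) \<Rightarrow> bool" where
  "cont_diff 0 f \<longleftrightarrow> continuous_on UNIV f"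
| "cont_diff (Suc m) f \<longleftrightarrow>
     f differentiable_on UNIV \<and> (\<forall>i. cont_diff m (partial_deriv i f))"

definition C_even :: "nat \<Rightarrow> (real^'n \<Rightarrow> complex) set" where
  "C_even m = {f. even_fun f \<and> cont_diff m f}"

definition schwartz_weight :: "nat \<Rightarrow> 'n list \<Rightarrow> (real^'n \<Rightarrow> complex) \<Rightarrow> real^'n \<Rightarrow> real" where
  "schwartz_weight k is f x = (1 + norm x) ^ k * norm (iter_partial is f x)"

definition schwartz_even :: "(real^'n \<Rightarrow> complex) set" where
  "schwartz_even = {f. even_fun f \<and> (\<forall>m. cont_diff m f) \<and>
     (\<forall>k is. bdd_above (range (schwartz_weight k is f)))}"

definition schwartz_seminorm :: "nat \<Rightarrow> 'n list \<Rightarrow> (real^'n \<Rightarrow> complex) \<Rightarrow> real" where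
  "schwartz_seminorm k is f = (SUP x. schwartz_weight k is f x)"

text \<open>The Frechet topology of the even Schwartz space: the open seminorm balls form a subbase.\<close>

definition schwartz_topology :: "(real^'n \<Rightarrow> complex) topology" where
  "schwartz_topology = topology_generated_by
     {{g \<in> schwartz_even. schwartz_seminorm k is (\<lambda>x. g x - f x) < e} | f k is e.
        f \<in> schwartz_even \<and> 0 < e}"

text \<open>Functionals are taken to be \<open>undefined\<close> outside the even Schwartz space, so that equality of
  distributions is equality in HOL.\<close>

definition tempered_even :: "((real^'n \<Rightarrow> complex) \<Rightarrow> complex) set" where
  "tempered_even = {T \<in> extensional schwartz_even.
     (\<forall>f\<in>schwartz_even. \<forall>g\<in>schwartz_even. T (\<lambda>x. f x + g x) = T f + T g) \<and>
     (\<forall>c. \<forall>f\<in>schwartz_even. T (\<lambda>x. c * f x) = c * T f) \<and>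
     continuous_map schwartz_topology euclidean T}"

definition pos_orthant :: "(real^'n) set" where
  "pos_orthant = {x. \<forall>i. 0 < x $ i}"

definition bessel_measure :: "real^'n \<Rightarrow> (real^'n) measure" where
  "bessel_measure \<alpha> = density (restrict_space lborel pos_orthant)
     (\<lambda>x. ennreal (\<Prod>i\<in>UNIV. (x $ i) powr (2 * \<alpha> $ i + 1)))"

definition L2_bessel :: "real^'n \<Rightarrow> (real^'n \<Rightarrow> complex) set" where
  "L2_bessel \<alpha> = {f \<in> borel_measurable (bessel_measure \<alpha>).
     integrable (bessel_measure \<alpha>) (\<lambda>x. (norm (f x))\<^sup>2)}"

text \<open>The distributions that are given by a function in \<open>X\<close>, i.e. the set \<open>X\<close> seen
  inside the space of even tempered distributions (as far as the pairing makes sense).\<close>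

definition distributions_of ::
    "real^'n \<Rightarrow> (real^'n \<Rightarrow> complex) set \<Rightarrow> ((real^'n \<Rightarrow> complex) \<Rightarrow> complex) set" where
  "distributions_of \<alpha> X = {T \<in> tempered_even. \<exists>\<psi>\<in>X. \<forall>\<phi>\<in>schwartz_even.
     integrable (bessel_measure \<alpha>) (\<lambda>x. \<psi> x * \<phi> x) \<and>
     T \<phi> = (LINT x|bessel_measure \<alpha>. \<psi> x * \<phi> x)}"

definition mult_distr :: "(real^'n \<Rightarrow> complex) \<Rightarrow>
    ((real^'n \<Rightarrow> complex) \<Rightarrow> complex) \<Rightarrow> (real^'n \<Rightarrow> complex) \<Rightarrow> complex" where
  "mult_distr h T = (\<lambda>\<phi>\<in>schwartz_even. T (\<lambda>x. h x * \<phi> x))"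

definition bessel_j :: "real \<Rightarrow> real \<Rightarrow> real" where
  "bessel_j \<gamma> t = Gamma (\<gamma> + 1) *
     (\<Sum>k. (-1) ^ k / (fact k * Gamma (real k + \<gamma> + 1)) * (t / 2) ^ (2 * k))"

definition fourier_bessel :: "real^'n \<Rightarrow> (real^'n \<Rightarrow> complex) \<Rightarrow> real^'n \<Rightarrow> complex" where
  "fourier_bessel \<alpha> f \<xi> = (LINT x|bessel_measure \<alpha>.
     f x * complex_of_real (\<Prod>i\<in>UNIV. bessel_j (\<alpha> $ i) (\<xi> $ i * x $ i)))"

definition fourier_bessel_distr :: "real^'n \<Rightarrow>
    ((real^'n \<Rightarrow> complex) \<Rightarrow> complex) \<Rightarrow> (real^'n \<Rightarrow> complex) \<Rightarrow> complex" where
  "fourier_bessel_distr \<alpha> T = (\<lambda>\<phi>\<in>schwartz_even. T (fourier_bessel \<alpha> \<phi>))"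

definition sobolev_bessel :: "real^'n \<Rightarrow> real \<Rightarrow> ((real^'n \<Rightarrow> complex) \<Rightarrow> complex) set" where
  "sobolev_bessel \<alpha> s = {T \<in> tempered_even.
     mult_distr (\<lambda>\<xi>. complex_of_real ((1 + (norm \<xi>)\<^sup>2) powr s)) (fourier_bessel_distr \<alpha> T)
       \<in> distributions_of \<alpha> (L2_bessel \<alpha>)}"

end

(*
  A distribution T in the Sobolev space has (1 + |xi|^2)^s F(T) = psi in L^2, so F(T) is the
  function theta = psi (1 + |xi|^2)^(-s), and by Cauchy-Schwarz (1 + |xi|)^m theta is integrable.
  Hence Psi = F(theta) / C, with C the constant of the inversion formula, is of class C^m, and
  Fubini together with inversion on the even Schwartz space identifies T with Psi.

  The inversion formula F F f = C f uses no kernel asymptotics.  F maps even Schwartz functions to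
  even Schwartz functions and F F commutes with multiplication by x_i^2.  If f vanishes on
  x_i = a_i, then f = (x_i^2 - a_i^2) g with g even and Schwartz, so F F f (a) = 0.  Consequently
  F F f (a) does not change when the variables of f are frozen at a one after the other, at the cost
  of Gaussian factors, and for the Gaussian itself F is known from a differential equation.
*)
theory Submission imports Defs begin

text \<open>Differentiating F under the integral requires kernel derivatives of every order to be
  bounded. For \<alpha>_i > -1/2 this follows from an energy estimate and from recurrences that
  raise the index. The Bessel operator B_i = d_i^2 + ((2 \<alpha>_i + 1) / x_i) d_i has a singular
  coefficient. It is therefore written as x_i d_i + (2 \<alpha>_i + 2) acting on g = d_i f / x_i,
  which is again even and Schwartz; kernels with \<alpha>_i raised by 1 then appear against the
  unchanged measure. Commutation of F F with x_i^2 rests on the dual rules F (x_i^2 f) = - B_i F f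
  and F (B_i h) = - \<xi>_i^2 F h. The delicate point in every division is the decay of all
  derivatives of the quotient. Boundedness of these derivatives comes from an integral formula,
  decay is checked for the quotient alone, and Landau's inequality carries it over to the
  derivatives. C is the square of the integral of the Gaussian, and it enters through C \<noteq> 0.
  The bound on s enters through the integrability of (1 + |\<xi>|^2)^(-a) for a > |\<alpha>| + n,
  used with a = 2 s - m.\<close>

abbreviation admissible :: "real^'n \<Rightarrow> bool" where
  "admissible \<alpha> \<equiv> \<forall>i. \<alpha> $ i > - 1 / 2"

subsection \<open>Partial derivatives\<close>

abbreviation coord :: "'n \<Rightarrow> real^'n \<Rightarrow> complex" where
  "coord i x \<equiv> complex_of_real (x $ i)"

text \<open>\<open>partial_deriv\<close> is a derivative along a line. This bridge allows partial
  derivatives to be read off from total ones, and nearly all formulas for them below are obtained in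
  this way.\<close>

lemma partial_deriv_has_derivative:
  assumes "(f has_derivative f') (at x)"
  shows "partial_deriv i f x = f' (axis i 1)"
proof -
  have 1: "((\<lambda>t::real. x + t *\<^sub>R axis i 1) has_derivative (\<lambda>t. t *\<^sub>R axis i 1)) (at 0)"
    by (auto intro!: derivative_eq_intros)
  have 2: "(f has_derivative f') (at (x + 0 *\<^sub>R axis i 1))" using assms by simp
  have "((\<lambda>t. f (x + t *\<^sub>R axis i 1)) has_vector_derivative f' (axis i 1)) (at 0)"
    unfolding has_vector_derivative_def
    using has_derivative_compose[OF 1 2] linear_scale[OF has_derivative_linear[OF assms]] by simp
  thus ?thesis unfolding partial_deriv_def by (rule vector_derivative_at)
qed

lemma has_derivative_partials:
  fixes f :: "real^'n \<Rightarrow> complex"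
  assumes "f differentiable (at x)"
  shows "(f has_derivative (\<lambda>h. \<Sum>i\<in>UNIV. (h $ i) *\<^sub>R partial_deriv i f x)) (at x)"
proof -
  obtain f' where f': "(f has_derivative f') (at x)" using assms differentiable_def by blast
  have "f' h = (\<Sum>i\<in>UNIV. (h $ i) *\<^sub>R partial_deriv i f x)" for h
  proof -
    have lin: "linear f'" by (rule has_derivative_linear[OF f'])
    have "f' h = f' (\<Sum>i\<in>UNIV. (h $ i) *\<^sub>R axis i 1)"
      using basis_expansion[of h] by (simp add: scalar_mult_eq_scaleR)
    also have "\<dots> = (\<Sum>i\<in>UNIV. (h $ i) *\<^sub>R f' (axis i 1))"
      by (simp add: linear_sum[OF lin] linear_scale[OF lin])
    finally show ?thesis by (simp add: partial_deriv_has_derivative[OF f'])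
  qed
  hence "f' = (\<lambda>h. \<Sum>i\<in>UNIV. (h $ i) *\<^sub>R partial_deriv i f x)" by blast
  thus ?thesis using f' by simp
qed

lemma differentiable_on_UNIV_at: "f differentiable_on UNIV \<Longrightarrow> f differentiable (at x)"
  by (simp add: differentiable_on_def)

text \<open>The formula holds along the whole line and not only at its base point; the set S serves
  the mean value estimates on closed intervals.\<close>

lemma has_vector_derivative_along_axis:
  fixes f :: "real^'n \<Rightarrow> complex"
  assumes "f differentiable_on UNIV"
  shows "((\<lambda>t. f (x + t *\<^sub>R axis i 1)) has_vector_derivative
    partial_deriv i f (x + t *\<^sub>R axis i 1)) (at t within S)"
proof -
  have "f differentiable (at (x + t *\<^sub>R axis i 1))"
    using assms by (rule differentiable_on_UNIV_at)
  then obtain f' where f': "(f has_derivative f') (at (x + t *\<^sub>R axis i 1))"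
    using differentiable_def by blast
  have 1: "((\<lambda>t::real. x + t *\<^sub>R axis i 1) has_derivative (\<lambda>t. t *\<^sub>R axis i 1)) (at t within S)"
    by (auto intro!: derivative_eq_intros)
  show ?thesis
    unfolding has_vector_derivative_def partial_deriv_has_derivative[OF f']
    using has_derivative_compose[OF 1 f'] linear_scale[OF has_derivative_linear[OF f']] by simp
qed

lemma partial_deriv_add:
  assumes "f differentiable_on UNIV" "g differentiable_on UNIV"
  shows "partial_deriv i (\<lambda>x. f x + g x) = (\<lambda>x. partial_deriv i f x + partial_deriv i g x)"
proof
  let ?D = "partial_deriv i"
  fix x
  obtain f' g' where f': "(f has_derivative f') (at x)" and g': "(g has_derivative g') (at x)"
    using assms differentiable_on_UNIV_at differentiable_def by metis
  show "?D (\<lambda>x. f x + g x) x = ?D f x + ?D g x"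
    by (simp add: partial_deriv_has_derivative[OF f'] partial_deriv_has_derivative[OF g']
        partial_deriv_has_derivative[OF has_derivative_add[OF f' g']])
qed

lemma partial_deriv_mult:
  assumes "f differentiable_on UNIV" "g differentiable_on UNIV"
  shows "partial_deriv i (\<lambda>x. f x * g x)
    = (\<lambda>x. f x * partial_deriv i g x + partial_deriv i f x * g x)"
proof
  let ?D = "partial_deriv i"
  fix x
  obtain f' g' where f': "(f has_derivative f') (at x)" and g': "(g has_derivative g') (at x)"
    using assms differentiable_on_UNIV_at differentiable_def by metis
  show "?D (\<lambda>x. f x * g x) x = f x * ?D g x + ?D f x * g x"
    by (simp add: partial_deriv_has_derivative[OF f'] partial_deriv_has_derivative[OF g']
        partial_deriv_has_derivative[OF has_derivative_mult[OF f' g']])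
qed

lemma partial_deriv_const [simp]: "partial_deriv i (\<lambda>x. c) = (\<lambda>x. 0)"
  by (simp add: partial_deriv_def fun_eq_iff)

lemma has_derivative_component:
  "((\<lambda>x. coord i x) has_derivative (\<lambda>h. coord i h)) (at x within S)"
  by (intro bounded_linear_imp_has_derivative bounded_linear_compose[OF bounded_linear_of_real]
      bounded_linear_vec_nth)

lemma differentiable_component: "(\<lambda>x. coord i x) differentiable_on S"
  using has_derivative_component differentiable_def differentiable_on_def by blast

lemma partial_deriv_component:
  "partial_deriv k (\<lambda>x. coord i x) = (\<lambda>x. if k = i then 1 else 0)"
  by (auto simp: fun_eq_iff partial_deriv_has_derivative[OF has_derivative_component] axis_def)

subsection \<open>Differentiability with a growth condition on all derivatives\<close>

text \<open>The condition P is kept abstract so that one Leibniz induction serves bounded,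
  polynomially bounded and rapidly decreasing functions. The recursion follows that of
  \<open>cont_diff\<close>.\<close>

primrec ctrl_diff ::
    "((real^'n \<Rightarrow> complex) \<Rightarrow> bool) \<Rightarrow> nat \<Rightarrow> (real^'n \<Rightarrow> complex) \<Rightarrow> bool" where
  "ctrl_diff P 0 f \<longleftrightarrow> continuous_on UNIV f \<and> P f"
| "ctrl_diff P (Suc m) f \<longleftrightarrow>
     f differentiable_on UNIV \<and> P f \<and> (\<forall>i. ctrl_diff P m (partial_deriv i f))"

definition ctrl_smooth :: "((real^'n \<Rightarrow> complex) \<Rightarrow> bool) \<Rightarrow> (real^'n \<Rightarrow> complex) \<Rightarrow> bool" where
  "ctrl_smooth P f \<longleftrightarrow> (\<forall>m. ctrl_diff P m f)"

lemma ctrl_smoothI: "(\<And>m. ctrl_diff P m f) \<Longrightarrow> ctrl_smooth P f"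
  by (simp add: ctrl_smooth_def)

lemma ctrl_smoothD:
  assumes "ctrl_smooth P f"
  shows "ctrl_diff P m f" "P f" "f differentiable_on UNIV" "continuous_on UNIV f"
    "ctrl_smooth P (partial_deriv i f)"
proof -
  have *: "ctrl_diff P m f" for m using assms by (simp add: ctrl_smooth_def)
  show "ctrl_diff P m f" by (rule *)
  show "P f" "f differentiable_on UNIV" using *[of 1] by auto
  show "continuous_on UNIV f" using *[of 0] by auto
  show "ctrl_smooth P (partial_deriv i f)" unfolding ctrl_smooth_def using *[of "Suc _"] by auto
qed

lemma ctrl_diff_imp: "ctrl_diff P m f \<Longrightarrow> P f"
  by (cases m) auto

lemma ctrl_diff_Suc_imp: "ctrl_diff P (Suc m) f \<Longrightarrow> ctrl_diff P m f"
  by (induction m arbitrary: f) (auto simp: differentiable_imp_continuous_on)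

lemma ctrl_diff_mono: "ctrl_diff P m f \<Longrightarrow> (\<And>f. P f \<Longrightarrow> Q f) \<Longrightarrow> ctrl_diff Q m f"
  by (induction m arbitrary: f) auto

lemma ctrl_smooth_mono: "ctrl_smooth P f \<Longrightarrow> (\<And>f. P f \<Longrightarrow> Q f) \<Longrightarrow> ctrl_smooth Q f"
  unfolding ctrl_smooth_def using ctrl_diff_mono by blast

lemma ctrl_diff_cont_diff: "ctrl_diff P m f \<Longrightarrow> cont_diff m f"
  by (induction m arbitrary: f) auto

lemma iter_partial_Nil [simp]: "iter_partial [] f = f"
  by (simp add: iter_partial_def)

lemma iter_partial_snoc [simp]: "iter_partial (is @ [i]) f = iter_partial is (partial_deriv i f)"
  by (simp add: iter_partial_def)

text \<open>The recursion strips off the derivative that is taken first, which in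
  \<open>iter_partial\<close> is the last entry of the list because of \<open>foldr\<close>; hence
  lists are split at their right end. The equivalence links the recursive classes to the seminorms
  of \<open>schwartz_even\<close>.\<close>

lemma ctrl_diff_iff:
  "ctrl_diff P m f \<longleftrightarrow> cont_diff m f \<and> (\<forall>is. length is \<le> m \<longrightarrow> P (iter_partial is f))"
proof (induction m arbitrary: f)
  case 0
  show ?case by auto
next
  case (Suc m)
  have "(\<forall>is. length is \<le> Suc m \<longrightarrow> P (iter_partial is f)) \<longleftrightarrow>
    P f \<and> (\<forall>i is. length is \<le> m \<longrightarrow> P (iter_partial is (partial_deriv i f)))" (is "?L \<longleftrightarrow> ?R")
  proof
    assume L: ?L
    have "P (iter_partial is (partial_deriv i f))" if "length is \<le> m" for i "is"
      using L[rule_format, of "is @ [i]"] that by simp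
    moreover have "P f" using L[rule_format, of "[]"] by simp
    ultimately show ?R by blast
  next
    assume R: ?R
    show ?L
    proof (intro allI impI)
      fix js :: "'a list" assume "length js \<le> Suc m"
      thus "P (iter_partial js f)" using R by (cases js rule: rev_cases) auto
    qed
  qed
  thus ?case using Suc.IH by auto
qed

lemma ctrl_diff_add:
  assumes "\<And>f g. P f \<Longrightarrow> P g \<Longrightarrow> P (\<lambda>x. f x + g x)"
  shows "ctrl_diff P m f \<Longrightarrow> ctrl_diff P m g \<Longrightarrow> ctrl_diff P m (\<lambda>x. f x + g x)"
proof (induction m arbitrary: f g)
  case 0
  thus ?case using assms by (auto intro: continuous_intros)
next
  case (Suc m)
  thus ?case using assms by (auto simp: partial_deriv_add)
qed

text \<open>A derivative of the product is a sum of products, so closure under addition is asked of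
  R. Three predicates are kept apart because a slow factor times a rapid one, or factors decaying in
  complementary variables, belong to different classes from their product.\<close>

lemma ctrl_diff_mult:
  assumes "\<And>f g. R f \<Longrightarrow> R g \<Longrightarrow> R (\<lambda>x. f x + g x)"
    and "\<And>f g. P f \<Longrightarrow> Q g \<Longrightarrow> R (\<lambda>x. f x * g x)"
  shows "ctrl_diff P m f \<Longrightarrow> ctrl_diff Q m g \<Longrightarrow> ctrl_diff R m (\<lambda>x. f x * g x)"
proof (induction m arbitrary: f g)
  case 0
  thus ?case using assms by (auto intro: continuous_intros)
next
  case (Suc m)
  have "ctrl_diff R m (partial_deriv i (\<lambda>x. f x * g x))" for i
    using Suc.prems ctrl_diff_Suc_imp[OF Suc.prems(1)] ctrl_diff_Suc_imp[OF Suc.prems(2)]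
    by (auto simp: partial_deriv_mult intro!: ctrl_diff_add assms(1) Suc.IH)
  thus ?case using Suc.prems assms by auto
qed

lemma ctrl_diff_const: "P (\<lambda>x. c) \<Longrightarrow> P (\<lambda>x. 0) \<Longrightarrow> ctrl_diff P m (\<lambda>x. c)"
  by (induction m arbitrary: c) auto

section \<open>Growth classes: bounded, polynomially bounded, rapidly decreasing\<close>

definition bounded_fun :: "(real^'n \<Rightarrow> complex) \<Rightarrow> bool" where
  "bounded_fun f \<longleftrightarrow> (\<exists>C. \<forall>x. norm (f x) \<le> C)"

text \<open>The gauge q is a parameter because growth and decay are measured by the full norm, but
  also, for partial Gaussians and for functions with frozen variables, by the norm of a coordinate
  projection.\<close>

definition slow :: "(real^'n \<Rightarrow> real) \<Rightarrow> (real^'n \<Rightarrow> complex) \<Rightarrow> bool" where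
  "slow q f \<longleftrightarrow> (\<exists>k C. \<forall>x. norm (f x) \<le> C * (1 + q x) ^ k)"

definition rapid :: "(real^'n \<Rightarrow> real) \<Rightarrow> (real^'n \<Rightarrow> complex) \<Rightarrow> bool" where
  "rapid q f \<longleftrightarrow> (\<forall>k. \<exists>C. \<forall>x. (1 + q x) ^ k * norm (f x) \<le> C)"

text \<open>All weights against one fixed derivative amount to \<open>rapid norm\<close> of that
  derivative, and \<open>ctrl_diff_iff\<close> collects the derivatives. Later arguments use
  Schwartz functions in this form.\<close>

lemma schwartz_even_iff: "f \<in> schwartz_even \<longleftrightarrow> even_fun f \<and> ctrl_smooth (rapid norm) f"
proof -
  have "(\<forall>k. bdd_above (range (schwartz_weight k is f))) \<longleftrightarrow> rapid norm (iter_partial is f)" for "is"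
    unfolding rapid_def bdd_above_def schwartz_weight_def by auto
  hence "(\<forall>k is. bdd_above (range (schwartz_weight k is f))) \<longleftrightarrow> (\<forall>is. rapid norm (iter_partial is f))"
    by metis
  thus ?thesis unfolding schwartz_even_def ctrl_smooth_def ctrl_diff_iff by auto
qed

lemma bounded_fun_add: "bounded_fun f \<Longrightarrow> bounded_fun g \<Longrightarrow> bounded_fun (\<lambda>x. f x + g x)"
  unfolding bounded_fun_def by (meson add_mono norm_triangle_le)

lemma bounded_fun_mult: 
  assumes "bounded_fun f" "bounded_fun g" shows "bounded_fun (\<lambda>x. f x * g x)"
proof -
  obtain C D where "\<And>x. norm (f x) \<le> C" "\<And>x. norm (g x) \<le> D"
    using assms unfolding bounded_fun_def by blast
  hence "norm (f x * g x) \<le> C * D" for x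
    unfolding norm_mult by (meson mult_mono norm_ge_zero order_trans)
  thus ?thesis unfolding bounded_fun_def by blast
qed

lemma bounded_fun_imp_slow: "bounded_fun f \<Longrightarrow> slow q f"
  unfolding bounded_fun_def slow_def by (metis mult.right_neutral power_0)

lemma slow_add:
  assumes q: "\<And>x. 0 \<le> q x" and "slow q f" "slow q g" shows "slow q (\<lambda>x. f x + g x)"
proof -
  obtain k C l D where f: "\<And>x. norm (f x) \<le> C * (1 + q x) ^ k"
    and g: "\<And>x. norm (g x) \<le> D * (1 + q x) ^ l"
    using assms unfolding slow_def by metis
  have "norm (f x + g x) \<le> (\<bar>C\<bar> + \<bar>D\<bar>) * (1 + q x) ^ (k + l)" for x
  proof -
    have "(1 + q x) ^ k \<le> (1 + q x) ^ (k + l)" "(1 + q x) ^ l \<le> (1 + q x) ^ (k + l)"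
      using q[of x] by (auto intro!: power_increasing)
    hence "C * (1 + q x) ^ k \<le> \<bar>C\<bar> * (1 + q x) ^ (k + l)" "D * (1 + q x) ^ l \<le> \<bar>D\<bar> * (1 + q x) ^ (k + l)"
      using q[of x] by (auto intro!: mult_mono)
    thus ?thesis using f[of x] g[of x] norm_triangle_ineq[of "f x" "g x"] by (simp add: distrib_right)
  qed
  thus ?thesis unfolding slow_def by blast
qed

lemma slow_mult:
  assumes q: "\<And>x. 0 \<le> q x" and "slow q f" "slow q g" shows "slow q (\<lambda>x. f x * g x)"
proof -
  obtain k C l D where f: "\<And>x. norm (f x) \<le> C * (1 + q x) ^ k"
    and g: "\<And>x. norm (g x) \<le> D * (1 + q x) ^ l"
    using assms unfolding slow_def by metis
  have "norm (f x * g x) \<le> (C * D) * (1 + q x) ^ (k + l)" for x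
    using mult_mono[OF f[of x] g[of x]] order_trans[OF norm_ge_zero f[of x]]
    by (simp add: norm_mult power_add mult_ac)
  thus ?thesis unfolding slow_def by blast
qed

lemma rapid_add: "rapid q f \<Longrightarrow> rapid q g \<Longrightarrow> rapid q (\<lambda>x. f x + g x)" if q: "\<And>x. 0 \<le> q x"
  unfolding rapid_def
proof
  fix k assume f: "\<forall>k. \<exists>C. \<forall>x. (1 + q x) ^ k * norm (f x) \<le> C"
    and g: "\<forall>k. \<exists>C. \<forall>x. (1 + q x) ^ k * norm (g x) \<le> C"
  obtain C D where C: "\<And>x. (1 + q x) ^ k * norm (f x) \<le> C" and D: "\<And>x. (1 + q x) ^ k * norm (g x) \<le> D"
    using f g by metis
  have "(1 + q x) ^ k * norm (f x + g x) \<le> C + D" for x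
  proof -
    have "(1 + q x) ^ k * norm (f x + g x) \<le> (1 + q x) ^ k * (norm (f x) + norm (g x))"
      using q[of x] by (intro mult_left_mono norm_triangle_ineq) auto
    thus ?thesis using C[of x] D[of x] by (simp add: distrib_left)
  qed
  thus "\<exists>C. \<forall>x. (1 + q x) ^ k * norm (f x + g x) \<le> C" by blast
qed

lemma rapid_mult_slow: 
  assumes q: "\<And>x. 0 \<le> q x" and f: "slow q f" and g: "rapid q g"
  shows "rapid q (\<lambda>x. f x * g x)"
  unfolding rapid_def
proof
  fix k
  obtain l C where C: "\<And>x. norm (f x) \<le> C * (1 + q x) ^ l" using f unfolding slow_def by blast
  obtain D where D: "\<And>x. (1 + q x) ^ (k + l) * norm (g x) \<le> D" using g unfolding rapid_def by blast
  have "(1 + q x) ^ k * norm (f x * g x) \<le> \<bar>C\<bar> * D" for x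
  proof -
    have "norm (f x) \<le> \<bar>C\<bar> * (1 + q x) ^ l"
      using C[of x] q[of x] by (meson abs_ge_self mult_right_mono order_trans zero_le_power add_nonneg_nonneg zero_le_one)
    hence "(1 + q x) ^ k * norm (f x * g x) \<le> (1 + q x) ^ k * ((\<bar>C\<bar> * (1 + q x) ^ l) * norm (g x))"
      using q[of x] unfolding norm_mult by (intro mult_left_mono mult_right_mono) auto
    also have "\<dots> = \<bar>C\<bar> * ((1 + q x) ^ (k + l) * norm (g x))" by (simp add: power_add)
    also have "\<dots> \<le> \<bar>C\<bar> * D" by (intro mult_left_mono D) auto
    finally show ?thesis .
  qed
  thus "\<exists>C. \<forall>x. (1 + q x) ^ k * norm (f x * g x) \<le> C" by blast
qed

text \<open>A decay bound for one weight passes to another weight that is at most twice as large. It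
  serves scaled points, small translates and points on short segments.\<close>

lemma weight_power_mult_le:
  fixes a b c C :: real
  assumes "a \<le> 2 * b" "0 \<le> a" "0 \<le> c" "b ^ k * c \<le> C"
  shows "a ^ k * c \<le> 2 ^ k * C"
proof -
  have "a ^ k * c \<le> (2 * b) ^ k * c" using assms by (intro mult_right_mono power_mono) auto
  also have "\<dots> = 2 ^ k * (b ^ k * c)" by (simp only: power_mult_distrib mult.assoc)
  also have "\<dots> \<le> 2 ^ k * C" using assms by (intro mult_left_mono) auto
  finally show ?thesis .
qed

lemma rapid_imp_bounded: "rapid q f \<Longrightarrow> bounded_fun f"
  unfolding rapid_def bounded_fun_def by (metis mult_1 power_0)

lemma ctrl_smooth_const: "ctrl_smooth bounded_fun (\<lambda>x. c)"
  by (intro ctrl_smoothI ctrl_diff_const) (auto simp: bounded_fun_def)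

lemma ctrl_diff_slow_const: "ctrl_diff (slow q) m (\<lambda>x. c)"
  by (intro ctrl_diff_mono[OF ctrl_smoothD(1)[OF ctrl_smooth_const]] bounded_fun_imp_slow)

lemma ctrl_smooth_rapid_add:
  assumes "\<And>x. 0 \<le> q x" "ctrl_smooth (rapid q) f" "ctrl_smooth (rapid q) g"
  shows "ctrl_smooth (rapid q) (\<lambda>x. f x + g x)"
  using assms ctrl_diff_add[of "rapid q"] rapid_add[of q] unfolding ctrl_smooth_def by blast

lemma ctrl_smooth_slow_mult_rapid:
  assumes "\<And>x. 0 \<le> q x" "ctrl_smooth (slow q) f" "ctrl_smooth (rapid q) g"
  shows "ctrl_smooth (rapid q) (\<lambda>x. f x * g x)"
  using assms ctrl_diff_mult[of "rapid q" "slow q" "rapid q"] rapid_add[of q] rapid_mult_slow[of q]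
  unfolding ctrl_smooth_def by blast

lemma ctrl_smooth_rapid_cmult:
  assumes "\<And>x. 0 \<le> q x" "ctrl_smooth (rapid q) f"
  shows "ctrl_smooth (rapid q) (\<lambda>x. c * f x)"
  using assms by (intro ctrl_smooth_slow_mult_rapid ctrl_smooth_mono[OF ctrl_smooth_const] bounded_fun_imp_slow)

definition proj :: "'n set \<Rightarrow> real^'n \<Rightarrow> real^'n" where
  "proj S x = (\<chi> i. if i \<in> S then x $ i else 0)"

lemma proj_UNIV [simp]: "proj UNIV x = x"
  by (simp add: proj_def vec_eq_iff)

lemma ctrl_smooth_component:
  assumes "i \<in> S"
  shows "ctrl_smooth (slow (\<lambda>x. norm (proj S x))) (\<lambda>x. coord i x)"
proof (rule ctrl_smoothI)
  let ?f = "\<lambda>x::real^'a. coord i x"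
  have "norm (?f x) \<le> 1 * (1 + norm (proj S x)) ^ 1" for x
    using component_le_norm_cart[of "proj S x" i] assms by (simp add: proj_def)
  hence "slow (\<lambda>x. norm (proj S x)) ?f" unfolding slow_def by blast
  thus "ctrl_diff (slow (\<lambda>x. norm (proj S x))) m ?f" for m
    using differentiable_imp_continuous_on[OF differentiable_component]
    by (cases m) (simp_all add: differentiable_component partial_deriv_component ctrl_diff_slow_const del: continuous_on_of_real_o_iff)
qed

lemma ctrl_smooth_component_norm: "ctrl_smooth (slow norm) (\<lambda>x. coord i x)"
  using ctrl_smooth_component[of i UNIV] by simp

subsection \<open>The normalized Bessel function\<close>

text \<open>Coefficients with respect to z = t^2; the factor 4^k comes from (t / 2)^(2 k). In z the
  function is an ordinary power series and can be differentiated termwise.\<close>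

definition bessel_coeff :: "real \<Rightarrow> nat \<Rightarrow> real" where
  "bessel_coeff \<gamma> k = Gamma (\<gamma> + 1) * ((-1) ^ k / (fact k * Gamma (real k + \<gamma> + 1))) / 4 ^ k"

lemma Gamma_shift: "\<gamma> > -1/2 \<Longrightarrow> Gamma (real k + \<gamma> + 2) = (real k + \<gamma> + 1) * Gamma (real k + \<gamma> + 1)"
proof -
  assume "\<gamma> > -1/2"
  hence "real k + \<gamma> + 1 \<notin> \<int>\<^sub>\<le>\<^sub>0" using nonpos_Ints_nonpos[of "real k + \<gamma> + 1"] by force
  from Gamma_plus1[OF this] show ?thesis by (simp add: add_ac)
qed

lemma Gamma_shift_pos: "\<gamma> > -1/2 \<Longrightarrow> Gamma (real k + \<gamma> + 1) > 0"
  by (intro Gamma_real_pos) auto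

lemma bessel_coeff_Suc:
  assumes "\<gamma> > -1/2"
  shows "bessel_coeff \<gamma> (Suc k) = - bessel_coeff \<gamma> k / (4 * (real k + 1) * (real k + \<gamma> + 1))"
proof -
  have "Gamma (real (Suc k) + \<gamma> + 1) = (real k + \<gamma> + 1) * Gamma (real k + \<gamma> + 1)"
    using Gamma_shift[OF assms, of k] by (simp add: add_ac)
  thus ?thesis by (simp add: bessel_coeff_def field_simps)
qed

text \<open>The functional equation of Gamma is applied at \<gamma> + 1 and at k + \<gamma> + 1.
  This relation between neighbouring indices feeds both the derivative formula and the
  recurrence.\<close>

lemma bessel_coeff_shift:
  assumes "\<gamma> > -1/2"
  shows "(real k + \<gamma> + 1) * bessel_coeff (\<gamma> + 1) k = (\<gamma> + 1) * bessel_coeff \<gamma> k"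
proof -
  have 1: "Gamma (\<gamma> + 1 + 1) = (\<gamma> + 1) * Gamma (\<gamma> + 1)"
    using Gamma_shift[OF assms, of 0] by (simp add: add_ac)
  have 2: "Gamma (real k + (\<gamma> + 1) + 1) = (real k + \<gamma> + 1) * Gamma (real k + \<gamma> + 1)"
    using Gamma_shift[OF assms, of k] by (simp add: add_ac)
  have alg: "p * (c * A * (u / (f * (p * G))) / q) = c * (A * (u / (f * G)) / q)"
    if "p \<noteq> 0" for p c A u f G q :: real
    using that by simp
  show ?thesis unfolding bessel_coeff_def 1 2 using assms by (intro alg) auto
qed

text \<open>Ratio test: since k + \<gamma> + 1 > 1/2, beyond N \<ge> |z| the quotient of consecutive
  terms is at most k / (2 (k + 1)) \<le> 1/2.\<close>

lemma summable_bessel: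
  assumes "\<gamma> > -1/2"
  shows "summable (\<lambda>k. bessel_coeff \<gamma> k * z ^ k)"
proof -
  obtain N :: nat where N: "\<bar>z\<bar> \<le> real N" using real_arch_simple by blast
  show ?thesis
  proof (rule summable_ratio_test[of "1/2" "Suc N"])
    fix k assume k: "k \<ge> Suc N"
    have a: "4 * (real k + 1) * (real k + \<gamma> + 1) \<ge> 4 * (real k + 1) * (1/2)"
      using assms by (intro mult_left_mono) auto
    have "norm (bessel_coeff \<gamma> (Suc k) * z ^ Suc k)
      = norm (bessel_coeff \<gamma> k * z ^ k) * (\<bar>z\<bar> / (4 * (real k + 1) * (real k + \<gamma> + 1)))"
      using assms by (simp add: bessel_coeff_Suc abs_mult abs_divide power_abs)
    also have "\<dots> \<le> norm (bessel_coeff \<gamma> k * z ^ k) * (1/2)"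
    proof (rule mult_left_mono)
      have "\<bar>z\<bar> / (4 * (real k + 1) * (real k + \<gamma> + 1)) \<le> real k / (4 * (real k + 1) * (1/2))"
        using N k a by (intro frac_le) auto
      also have "\<dots> \<le> 1/2" by (simp add: field_simps)
      finally show "\<bar>z\<bar> / (4 * (real k + 1) * (real k + \<gamma> + 1)) \<le> 1/2" .
    qed auto
    finally show "norm (bessel_coeff \<gamma> (Suc k) * z ^ Suc k) \<le> 1/2 * norm (bessel_coeff \<gamma> k * z ^ k)"
      by simp
  qed simp
qed

definition bessel_series :: "real \<Rightarrow> real \<Rightarrow> real" where
  "bessel_series \<gamma> z = (\<Sum>k. bessel_coeff \<gamma> k * z ^ k)"

lemma bessel_j_series:
  assumes "\<gamma> > -1/2"
  shows "bessel_j \<gamma> t = bessel_series \<gamma> (t\<^sup>2)"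
proof -
  have g: "Gamma (\<gamma> + 1) > 0" using assms by (intro Gamma_real_pos) auto
  have eq: "(-1) ^ k / (fact k * Gamma (real k + \<gamma> + 1)) * (t / 2) ^ (2 * k)
    = bessel_coeff \<gamma> k * (t\<^sup>2) ^ k / Gamma (\<gamma> + 1)" for k
    using g by (simp add: bessel_coeff_def power_divide power_mult)
  show ?thesis unfolding bessel_j_def bessel_series_def eq
    using g by (simp add: suminf_divide[OF summable_bessel[OF assms]])
qed

lemma diffs_bessel_coeff:
  assumes "\<gamma> > -1/2"
  shows "diffs (bessel_coeff \<gamma>) k = - bessel_coeff (\<gamma> + 1) k / (4 * (\<gamma> + 1))"
proof -
  have nz: "real k + \<gamma> + 1 \<noteq> 0" "\<gamma> + 1 \<noteq> 0" using assms by auto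
  have "diffs (bessel_coeff \<gamma>) k = - bessel_coeff \<gamma> k / (4 * (real k + \<gamma> + 1))"
    using assms nz by (simp add: diffs_def bessel_coeff_Suc divide_simps) (simp add: algebra_simps)
  moreover have "- b / (4 * p) = - b' / (4 * d)" if "p * b' = d * b" "p \<noteq> 0" "d \<noteq> 0" for p d b b' :: real
    using that by (simp add: field_simps)
  ultimately show ?thesis using bessel_coeff_shift[OF assms, of k] nz by metis
qed

lemma bessel_series_sums:
  "\<gamma> > -1/2 \<Longrightarrow> (\<lambda>k. bessel_coeff \<gamma> k * z ^ k) sums bessel_series \<gamma> z"
  unfolding bessel_series_def by (intro summable_sums summable_bessel)

lemma bessel_series_deriv:
  assumes "\<gamma> > -1/2"
  shows "(bessel_series \<gamma> has_real_derivative - bessel_series (\<gamma> + 1) z / (4 * (\<gamma> + 1))) (at z)"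
proof -
  have "(bessel_series \<gamma> has_real_derivative (\<Sum>k. diffs (bessel_coeff \<gamma>) k * z ^ k)) (at z)"
    unfolding bessel_series_def by (rule termdiffs_strong_converges_everywhere)
      (use summable_bessel assms in auto)
  also have "(\<lambda>k. diffs (bessel_coeff \<gamma>) k * z ^ k) sums (- bessel_series (\<gamma> + 1) z / (4 * (\<gamma> + 1)))"
    using sums_divide[OF sums_minus[OF bessel_series_sums[of "\<gamma> + 1" z]], of "4 * (\<gamma> + 1)"] assms
    by (simp add: diffs_bessel_coeff)
  hence "(\<Sum>k. diffs (bessel_coeff \<gamma>) k * z ^ k) = - bessel_series (\<gamma> + 1) z / (4 * (\<gamma> + 1))"
    by (rule sums_unique[symmetric])
  finally show ?thesis .
qed

text \<open>If B is the series of index \<gamma> + 1, the left side is B + z B' / (\<gamma> + 1).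
  Coefficientwise, the series of index \<gamma> exceeds B by k / (\<gamma> + 1) times the
  coefficient of B, which is what z B' / (\<gamma> + 1) contributes.\<close>

lemma bessel_series_rec:
  assumes "\<gamma> > -1/2"
  shows "bessel_series (\<gamma> + 1) z - z * bessel_series (\<gamma> + 2) z / (4 * (\<gamma> + 1) * (\<gamma> + 2))
    = bessel_series \<gamma> z"
proof -
  let ?a = "bessel_coeff (\<gamma> + 1)"
  let ?d = "- 1 / (4 * (\<gamma> + 1) * (\<gamma> + 2))"
  have nz: "\<gamma> + 1 \<noteq> 0" and g1: "\<gamma> + 1 > -1/2" and g2: "\<gamma> + 2 > -1/2" using assms by auto
  have b: "bessel_coeff \<gamma> k - ?a k = real k * ?a k / (\<gamma> + 1)" for k
    using bessel_coeff_shift[OF assms, of k] nz by (simp add: field_simps)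
  have bS: "bessel_coeff \<gamma> (Suc k) - ?a (Suc k) = ?d * bessel_coeff (\<gamma> + 2) k" for k
  proof -
    have "real (Suc k) * ?a (Suc k) = - bessel_coeff (\<gamma> + 2) k / (4 * (\<gamma> + 2))"
      using diffs_bessel_coeff[OF g1, of k] by (simp add: diffs_def add.assoc)
    thus ?thesis unfolding b by (simp add: mult.commute mult.left_commute del: distrib_left_numeral)
  qed
  have "(\<lambda>k. (?d * z) * (bessel_coeff (\<gamma> + 2) k * z ^ k)) sums ((?d * z) * bessel_series (\<gamma> + 2) z)"
    by (intro sums_mult bessel_series_sums g2)
  hence "(\<lambda>k. (bessel_coeff \<gamma> (Suc k) - ?a (Suc k)) * z ^ Suc k) sums ((?d * z) * bessel_series (\<gamma> + 2) z)"
    unfolding bS power_Suc by (simp only: mult_ac)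
  \<comment> \<open>The difference of the two series has no constant term, so the shifted sum is the
    whole sum.\<close>
  from sums_Suc[OF this]
  have "(\<lambda>k. (bessel_coeff \<gamma> k - ?a k) * z ^ k) sums ((?d * z) * bessel_series (\<gamma> + 2) z)"
    using b[of 0] by simp
  moreover have "(\<lambda>k. (bessel_coeff \<gamma> k - ?a k) * z ^ k) sums (bessel_series \<gamma> z - bessel_series (\<gamma> + 1) z)"
    unfolding left_diff_distrib by (intro sums_diff bessel_series_sums assms g1)
  ultimately have "(?d * z) * bessel_series (\<gamma> + 2) z = bessel_series \<gamma> z - bessel_series (\<gamma> + 1) z"
    by (rule sums_unique2)
  thus ?thesis by simp
qed

lemma bessel_j_zero:
  assumes "\<gamma> > -1/2"
  shows "bessel_j \<gamma> 0 = 1"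
proof -
  have "bessel_j \<gamma> 0 = bessel_series \<gamma> 0" using bessel_j_series[OF assms, of 0] by simp
  also have "\<dots> = bessel_coeff \<gamma> 0" unfolding bessel_series_def by (metis powser_zero)
  also have "\<dots> = 1" using Gamma_shift_pos[OF assms, of 0] by (simp add: bessel_coeff_def)
  finally show ?thesis .
qed

lemma bessel_j_even: "bessel_j \<gamma> (- t) = bessel_j \<gamma> t"
  unfolding bessel_j_def by (simp add: power_mult power_divide)

lemma bessel_j_deriv:
  assumes "\<gamma> > -1/2"
  shows "(bessel_j \<gamma> has_real_derivative - t / (2 * \<gamma> + 2) * bessel_j (\<gamma> + 1) t) (at t)"
proof -
  have 1: "bessel_j \<gamma> = (\<lambda>t. bessel_series \<gamma> (t\<^sup>2))" using bessel_j_series[OF assms] by blast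
  have 2: "bessel_j (\<gamma> + 1) t = bessel_series (\<gamma> + 1) (t\<^sup>2)" using assms by (intro bessel_j_series) auto
  have "((\<lambda>t. bessel_series \<gamma> (t\<^sup>2)) has_real_derivative
     - bessel_series (\<gamma> + 1) (t\<^sup>2) / (4 * (\<gamma> + 1)) * (2 * t)) (at t)"
    by (rule DERIV_chain2[OF bessel_series_deriv[OF assms]]) (auto intro!: derivative_eq_intros)
  moreover have "- bessel_series (\<gamma> + 1) (t\<^sup>2) / (4 * (\<gamma> + 1)) * (2 * t)
    = - t / (2 * \<gamma> + 2) * bessel_series (\<gamma> + 1) (t\<^sup>2)"
    using assms by (simp add: divide_simps)
  ultimately show ?thesis unfolding 1 2 by simp
qed

text \<open>This is \<open>bessel_series_rec\<close> at z = t^2. The factor after the first t is the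
  derivative of \<open>bessel_j (\<gamma> + 1)\<close>, so the identity lowers the index, whereas
  \<open>bessel_j_deriv\<close> raises it.\<close>

lemma bessel_j_rec:
  assumes "\<gamma> > -1/2"
  shows "t * (- t / (2 * (\<gamma> + 1) + 2) * bessel_j (\<gamma> + 2) t) + (2 * \<gamma> + 2) * bessel_j (\<gamma> + 1) t
    = (2 * \<gamma> + 2) * bessel_j \<gamma> t"
proof -
  have nz: "\<gamma> + 1 > 0" "\<gamma> + 2 > 0" using assms by auto
  have b: "bessel_j \<gamma> t = bessel_series \<gamma> (t\<^sup>2)" "bessel_j (\<gamma> + 1) t = bessel_series (\<gamma> + 1) (t\<^sup>2)"
     "bessel_j (\<gamma> + 2) t = bessel_series (\<gamma> + 2) (t\<^sup>2)" using assms by (auto intro!: bessel_j_series)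
  have "(2 * \<gamma> + 2) * bessel_series \<gamma> (t\<^sup>2) = (2 * \<gamma> + 2) * bessel_series (\<gamma> + 1) (t\<^sup>2)
    - t\<^sup>2 * bessel_series (\<gamma> + 2) (t\<^sup>2) * ((2 * \<gamma> + 2) / (4 * (\<gamma> + 1) * (\<gamma> + 2)))"
    unfolding bessel_series_rec[OF assms, of "t\<^sup>2", symmetric] by (simp add: algebra_simps)
  also have "(2 * \<gamma> + 2) / (4 * (\<gamma> + 1) * (\<gamma> + 2)) = 1 / (2 * (\<gamma> + 1) + 2)"
    using nz by (simp add: divide_simps) (simp add: algebra_simps)
  finally show ?thesis unfolding b by (simp add: power2_eq_square)
qed

text \<open>The derivative of order \<open>k\<close>; the recursion is Bessel's equation with
  \<open>j' / t\<close> expressed through index \<open>\<gamma> + 1\<close>, so it has no singularity at \<open>0\<close>.\<close>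

fun bessel_jd :: "nat \<Rightarrow> real \<Rightarrow> real \<Rightarrow> real" where
  "bessel_jd 0 \<gamma> t = bessel_j \<gamma> t"
| "bessel_jd (Suc 0) \<gamma> t = - t / (2 * \<gamma> + 2) * bessel_j (\<gamma> + 1) t"
| "bessel_jd (Suc (Suc k)) \<gamma> t
     = - bessel_jd k \<gamma> t + (2 * \<gamma> + 1) / (2 * \<gamma> + 2) * bessel_jd k (\<gamma> + 1) t"

text \<open>Induction by steps of two, for all indices at once: from order 2 on, the definition is a
  linear combination of order k - 2 at \<gamma> and at \<gamma> + 1. Bessel's equation enters in the
  case of order 1, through \<open>bessel_j_rec\<close>.\<close>

lemma bessel_jd_deriv:
  "\<gamma> > -1/2 \<Longrightarrow> (bessel_jd k \<gamma> has_real_derivative bessel_jd (Suc k) \<gamma> t) (at t)"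
proof (induction k arbitrary: \<gamma> t rule: less_induct)
  case (less k)
  consider "k = 0" | "k = Suc 0" | l where "k = Suc (Suc l)" by (metis not0_implies_Suc)
  thus ?case
  proof cases
    case 1
    have "bessel_jd 0 \<gamma> = bessel_j \<gamma>" by auto
    thus ?thesis using 1 bessel_j_deriv[OF less.prems] by simp
  next
    case 2
    have g1: "\<gamma> + 1 > -1/2" and nz: "2 * \<gamma> + 2 > 0" using less.prems by auto
    have "(bessel_j (\<gamma> + 1) has_real_derivative
        - t / (2 * (\<gamma> + 1) + 2) * bessel_j (\<gamma> + 2) t) (at t)" (is "(_ has_real_derivative ?d) _")
      using bessel_j_deriv[OF g1] by (simp add: add_ac)
    from DERIV_mult[OF DERIV_cmult[OF DERIV_ident, of "- 1 / (2 * \<gamma> + 2)"] this]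
    have "((\<lambda>t. - 1 / (2 * \<gamma> + 2) * t * bessel_j (\<gamma> + 1) t) has_real_derivative
        - 1 / (2 * \<gamma> + 2) * bessel_j (\<gamma> + 1) t + - 1 / (2 * \<gamma> + 2) * (t * ?d)) (at t)"
      by (simp add: algebra_simps)
    moreover have "t * ?d = (2 * \<gamma> + 2) * bessel_j \<gamma> t - (2 * \<gamma> + 2) * bessel_j (\<gamma> + 1) t"
      using bessel_j_rec[OF less.prems, of t] by linarith
    moreover have "- 1 / (2 * \<gamma> + 2) * bessel_j (\<gamma> + 1) t
       + - 1 / (2 * \<gamma> + 2) * ((2 * \<gamma> + 2) * bessel_j \<gamma> t - (2 * \<gamma> + 2) * bessel_j (\<gamma> + 1) t)
       = bessel_jd (Suc (Suc 0)) \<gamma> t"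
    proof -
      have "- 1 / w * b + - 1 / w * (w * a - w * b) = - a + (w - 1) / w * b"
        if "w \<noteq> 0" for a b w :: real using that by (simp add: field_simps)
      from this[of "2 * \<gamma> + 2"] show ?thesis using nz by simp
    qed
    moreover have "(\<lambda>t. - 1 / (2 * \<gamma> + 2) * t * bessel_j (\<gamma> + 1) t) = bessel_jd (Suc 0) \<gamma>"
      by (simp add: fun_eq_iff)
    ultimately show ?thesis unfolding 2 by metis
  next
    case 3
    have eq: "bessel_jd k \<gamma> = (\<lambda>t. - bessel_jd l \<gamma> t + (2 * \<gamma> + 1) / (2 * \<gamma> + 2) * bessel_jd l (\<gamma> + 1) t)"
      using 3 by (simp add: fun_eq_iff)
    have "(bessel_jd l \<gamma> has_real_derivative bessel_jd (Suc l) \<gamma> t) (at t)"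
      "(bessel_jd l (\<gamma> + 1) has_real_derivative bessel_jd (Suc l) (\<gamma> + 1) t) (at t)"
      using less 3 by auto
    thus ?thesis unfolding eq unfolding 3 bessel_jd.simps(3)
      by (intro DERIV_add DERIV_minus DERIV_cmult)
  qed
qed

text \<open>The energy \<open>j\<^sup>2 + j'\<^sup>2\<close> is nonincreasing on the positive half-line because
  \<open>2 \<gamma> + 1 \<ge> 0\<close>.\<close>

lemma bessel_energy:
  assumes "\<gamma> > -1/2"
  shows "(bessel_jd 0 \<gamma> t)\<^sup>2 + (bessel_jd (Suc 0) \<gamma> t)\<^sup>2 \<le> 1"
proof -
  let ?E = "\<lambda>t. (bessel_jd 0 \<gamma> t)\<^sup>2 + (bessel_jd (Suc 0) \<gamma> t)\<^sup>2"
  have nz: "2 * \<gamma> + 2 > 0" "2 * \<gamma> + 1 > 0" using assms by auto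
  have main: "?E t \<le> 1" if "0 \<le> t" for t
  proof -
    have "?E t \<le> ?E 0"
    proof (rule DERIV_nonpos_imp_nonincreasing[OF that])
      fix x :: real assume x: "0 \<le> x" "x \<le> t"
      \<comment> \<open>The derivative of the energy is 2 j' (j + j''). Here j' is - x / (2 \<gamma>
        + 2) times, and j + j'' is (2 \<gamma> + 1) / (2 \<gamma> + 2) times, the function of index
        \<gamma> + 1, which produces a square.\<close>
      let ?y = "- (2 * x * (2 * \<gamma> + 1) * (bessel_j (\<gamma> + 1) x)\<^sup>2 / (2 * \<gamma> + 2)\<^sup>2)"
      have "(?E has_real_derivative 2 * bessel_jd 0 \<gamma> x * bessel_jd (Suc 0) \<gamma> x
         + 2 * bessel_jd (Suc 0) \<gamma> x * bessel_jd (Suc (Suc 0)) \<gamma> x) (at x)"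
        by (auto intro!: derivative_eq_intros bessel_jd_deriv[OF assms] simp del: bessel_jd.simps)
      moreover have "2 * bessel_jd 0 \<gamma> x * bessel_jd (Suc 0) \<gamma> x
         + 2 * bessel_jd (Suc 0) \<gamma> x * bessel_jd (Suc (Suc 0)) \<gamma> x = ?y"
        by (simp add: power2_eq_square algebra_simps)
      moreover have "?y \<le> 0" using x nz by simp
      ultimately show "\<exists>y. (?E has_real_derivative y) (at x) \<and> y \<le> 0" by metis
    qed
    also have "?E 0 = 1" using bessel_j_zero[OF assms] by simp
    finally show ?thesis .
  qed
  have "?E (- t) = ?E t" by (simp add: bessel_j_even)
  thus ?thesis using main[of t] main[of "- t"] by (cases "t \<ge> 0") auto
qed

text \<open>Orders 0 and 1 are bounded by 1 through the energy. The recursion adds two bounds with a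
  coefficient of modulus at most 1, so two further orders cost at most a factor 2. The bound is
  uniform in \<gamma> and t.\<close>

lemma bessel_jd_bound: "\<gamma> > -1/2 \<Longrightarrow> \<bar>bessel_jd k \<gamma> t\<bar> \<le> 2 ^ k"
proof (induction k arbitrary: \<gamma> rule: less_induct)
  case (less k)
  consider "k = 0" | "k = Suc 0" | l where "k = Suc (Suc l)" by (metis not0_implies_Suc)
  thus ?case
  proof cases
    case 1
    have "(bessel_jd 0 \<gamma> t)\<^sup>2 \<le> 1" 
      using bessel_energy[OF less.prems, of t] zero_le_power2[of "bessel_jd (Suc 0) \<gamma> t"] by linarith
    thus ?thesis using 1 abs_square_le_1[of "bessel_jd 0 \<gamma> t"] by simp
  next
    case 2
    have "(bessel_jd (Suc 0) \<gamma> t)\<^sup>2 \<le> 1" 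
      using bessel_energy[OF less.prems, of t] zero_le_power2[of "bessel_jd 0 \<gamma> t"] by linarith
    hence "\<bar>bessel_jd (Suc 0) \<gamma> t\<bar> \<le> 1" using abs_square_le_1 by blast
    thus ?thesis unfolding 2 by (simp del: bessel_jd.simps)
  next
    case 3
    have "\<bar>bessel_jd l \<gamma> t\<bar> \<le> 2 ^ l" "\<bar>bessel_jd l (\<gamma> + 1) t\<bar> \<le> 2 ^ l" using less 3 by auto
    moreover have "\<bar>(2 * \<gamma> + 1) / (2 * \<gamma> + 2) * bessel_jd l (\<gamma> + 1) t\<bar> \<le> 1 * \<bar>bessel_jd l (\<gamma> + 1) t\<bar>"
      unfolding abs_mult using less.prems by (intro mult_right_mono) (auto simp: field_simps)
    ultimately have "\<bar>bessel_jd k \<gamma> t\<bar> \<le> 2 ^ l + 2 ^ l" unfolding 3 bessel_jd.simps(3) by linarith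
    also have "\<dots> \<le> 2 ^ k" by (simp add: 3)
    finally show ?thesis .
  qed
qed

subsection \<open>The measure of the Fourier-Bessel transform\<close>

abbreviation bessel_weight :: "real^'n \<Rightarrow> real^'n \<Rightarrow> real" where
  "bessel_weight \<alpha> x \<equiv> (\<Prod>i\<in>UNIV. (x $ i) powr (2 * \<alpha> $ i + 1))"

lemma pos_orthant_sets [measurable]: "pos_orthant \<in> sets borel"
proof -
  have "open (\<Inter>i\<in>UNIV. {x :: real^'a. 0 < x $ i})"
    by (intro open_INT ballI open_Collect_less continuous_intros) auto
  moreover have "pos_orthant = (\<Inter>i\<in>UNIV. {x :: real^'a. 0 < x $ i})" by (auto simp: pos_orthant_def)
  ultimately show ?thesis by (simp add: borel_open)
qed

lemma borel_measurable_component [measurable]: "(\<lambda>x :: real^'n. x $ i) \<in> borel_measurable borel"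
  by (intro borel_measurable_continuous_onI continuous_intros)

lemma bessel_weight_measurable [measurable]: "bessel_weight \<alpha> \<in> borel_measurable borel"
  by measurable

lemma space_bessel_measure: "space (bessel_measure \<alpha>) = pos_orthant"
  by (simp add: bessel_measure_def space_restrict_space)

lemma measurable_bessel_measure:
  "f \<in> borel_measurable borel \<Longrightarrow> f \<in> borel_measurable (bessel_measure \<alpha>)"
  unfolding bessel_measure_def by (simp add: measurable_restrict_space1)

lemma nn_integral_bessel_measure:
  assumes [measurable]: "f \<in> borel_measurable borel"
  shows "nn_integral (bessel_measure \<alpha>) f
    = (\<integral>\<^sup>+x. ennreal (bessel_weight \<alpha> x) * f x * indicator pos_orthant x \<partial>lborel)"
  unfolding bessel_measure_def
  by (subst nn_integral_density) (auto simp: nn_integral_restrict_space intro!: measurable_restrict_space1)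

lemma integral_bessel_measure:
  fixes f :: "real^'n \<Rightarrow> complex"
  assumes [measurable]: "f \<in> borel_measurable borel"
  shows "(LINT x|bessel_measure \<alpha>. f x)
    = (LINT x|lborel. (indicator pos_orthant x * bessel_weight \<alpha> x) *\<^sub>R f x)"
  unfolding bessel_measure_def
  by (subst integral_density)
    (auto simp: integral_restrict_space prod_nonneg intro!: measurable_restrict_space1)

lemma sigma_finite_bessel_measure: "sigma_finite_measure (bessel_measure \<alpha>)"
proof -
  interpret sigma_finite_measure "restrict_space lborel (pos_orthant :: (real^'a) set)"
    by (intro sigma_finite_measure_restrict_space) (auto simp: sigma_finite_lborel)
  show ?thesis unfolding bessel_measure_def
    by (subst sigma_finite_iff_density_finite) (auto intro!: measurable_restrict_space1)
qed

text \<open>On the cube of side \<open>2\<^sup>k\<close> the weight is at most its value at the far corner; summing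
  over dyadic cubes gives the sharp range of exponents.\<close>

lemma emeasure_bessel_cube_le:
  fixes \<alpha> :: "real^'n"
  assumes \<alpha>: "admissible \<alpha>"
  shows "emeasure (bessel_measure \<alpha>) {x \<in> pos_orthant. \<forall>i. x $ i \<le> 2 ^ k}
    \<le> ennreal ((4 powr ((\<Sum>i\<in>UNIV. \<alpha> $ i) + real CARD('n))) ^ k)"
proof -
  let ?M = "bessel_measure \<alpha>"
  let ?Q = "{x :: real^'n. x \<in> pos_orthant \<and> (\<forall>i. x $ i \<le> 2 ^ k)}"
  let ?c = "(\<chi> i. 2 ^ k) :: real^'n"
  have Qb: "?Q = pos_orthant \<inter> cbox 0 ?c"
    by (auto simp: pos_orthant_def mem_box_cart less_imp_le)
  have [measurable]: "?Q \<in> sets borel" unfolding Qb by measurable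
  have "emeasure ?M ?Q = (\<integral>\<^sup>+x. indicator ?Q x \<partial>?M)"
  proof (rule nn_integral_indicator[symmetric])
    show "?Q \<in> sets ?M"
      unfolding bessel_measure_def by (auto simp: sets_restrict_space_iff)
  qed
  also have "\<dots> = (\<integral>\<^sup>+x. ennreal (bessel_weight \<alpha> x) * indicator ?Q x * indicator pos_orthant x \<partial>lborel)"
    by (rule nn_integral_bessel_measure) measurable
  also have "\<dots> \<le> (\<integral>\<^sup>+x. ennreal (\<Prod>i\<in>UNIV. (2 ^ k) powr (2 * \<alpha> $ i + 1)) * indicator (cbox 0 ?c) x \<partial>lborel)"
  proof (rule nn_integral_mono)
    fix x :: "real^'n"
    show "ennreal (bessel_weight \<alpha> x) * indicator ?Q x * indicator pos_orthant x
       \<le> ennreal (\<Prod>i\<in>UNIV. (2 ^ k) powr (2 * \<alpha> $ i + 1)) * indicator (cbox 0 ?c) x"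
    proof (cases "x \<in> ?Q")
      case True
      have "bessel_weight \<alpha> x \<le> (\<Prod>i\<in>UNIV. (2 ^ k) powr (2 * \<alpha> $ i + 1))"
      proof (rule prod_mono, intro conjI)
        fix i
        have "-1/2 < \<alpha> $ i" using \<alpha> by blast
        thus "x $ i powr (2 * \<alpha> $ i + 1) \<le> (2 ^ k) powr (2 * \<alpha> $ i + 1)"
          using True by (intro powr_mono2) (auto simp: pos_orthant_def less_imp_le)
      qed auto
      thus ?thesis using True Qb by (auto intro!: ennreal_leI)
    qed auto
  qed
  also have "\<dots> = ennreal (\<Prod>i\<in>UNIV. (2 ^ k) powr (2 * \<alpha> $ i + 1)) * emeasure lborel (cbox 0 ?c)"
    by (simp add: nn_integral_cmult)
  also have "emeasure lborel (cbox 0 ?c) = ennreal (\<Prod>i\<in>(UNIV::'n set). 2 ^ k)"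
  proof -
    have c: "?c \<bullet> b = 2 ^ k" if "b \<in> Basis" for b
      using that by (auto simp: Basis_vec_def inner_axis)
    have "emeasure lborel (cbox 0 ?c) = ennreal (\<Prod>b\<in>(Basis :: (real^'n) set). 2 ^ k)"
      unfolding emeasure_lborel_cbox_eq using c by (auto intro!: prod.cong simp: inner_diff_left)
    thus ?thesis by simp
  qed
  also have "ennreal (\<Prod>i\<in>UNIV. (2 ^ k) powr (2 * \<alpha> $ i + 1)) * ennreal (\<Prod>i\<in>(UNIV::'n set). 2 ^ k)
    = ennreal (\<Prod>i\<in>UNIV. (2 ^ k) powr (2 * \<alpha> $ i + 1) * 2 ^ k)"
    unfolding prod.distrib by (rule ennreal_mult'[symmetric]) (rule prod_nonneg, simp)
  \<comment> \<open>Side length times corner weight is (2^k)^(2 \<alpha>_i + 2) in each variable.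
    Passing to base 4 halves the exponents, and their sum is then |\<alpha>| + n.\<close>
  also have "(\<Prod>i\<in>UNIV. (2 ^ k :: real) powr (2 * \<alpha> $ i + 1) * 2 ^ k) = (\<Prod>i\<in>UNIV. (4 ^ k) powr (\<alpha> $ i + 1))"
  proof (rule prod.cong[OF refl])
    fix i
    have "(2 ^ k :: real) powr (2 * \<alpha> $ i + 1) * 2 ^ k = (2 ^ k) powr (2 * \<alpha> $ i + 1) * (2 ^ k) powr 1"
      by simp
    also have "\<dots> = (2 ^ k) powr (2 * (\<alpha> $ i + 1))" unfolding powr_add[symmetric] by (simp add: algebra_simps)
    also have "\<dots> = ((2 ^ k) powr 2) powr (\<alpha> $ i + 1)" by (simp only: powr_powr)
    also have "(2 ^ k :: real) powr 2 = 4 ^ k" by (simp add: power_mult_distrib[symmetric] power2_eq_square)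
    finally show "(2 ^ k :: real) powr (2 * \<alpha> $ i + 1) * 2 ^ k = (4 ^ k) powr (\<alpha> $ i + 1)" .
  qed
  also have "\<dots> = (4 ^ k) powr ((\<Sum>i\<in>UNIV. \<alpha> $ i) + real CARD('n))"
    by (subst powr_sum[symmetric]) (auto simp: sum.distrib)
  also have "\<dots> = (4 powr ((\<Sum>i\<in>UNIV. \<alpha> $ i) + real CARD('n))) ^ k"
    by (simp add: powr_realpow[symmetric] powr_powr mult.commute)
  finally show ?thesis by simp
qed

text \<open>Each point is charged to the first dyadic cube that contains it. If this is cube k \<ge>
  1, then 1 + |x|^2 \<ge> 4^(k - 1), while the cube has measure at most 4^(k (|\<alpha>| + n)); the
  resulting series is geometric with ratio 4^(|\<alpha>| + n - a) < 1.\<close>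

lemma integrable_bessel_power:
  fixes \<alpha> :: "real^'n"
  assumes \<alpha>: "admissible \<alpha>" and a: "a > (\<Sum>i\<in>UNIV. \<alpha> $ i) + real CARD('n)"
  shows "integrable (bessel_measure \<alpha>) (\<lambda>x. (1 + (norm x)\<^sup>2) powr (- a))"
proof (rule integrableI_nonneg)
  let ?M = "bessel_measure \<alpha>"
  let ?A = "(\<Sum>i\<in>UNIV. \<alpha> $ i) + real CARD('n)"
  have A0: "0 < ?A"
  proof -
    have "0 < (\<Sum>i\<in>UNIV. \<alpha> $ i + 1)"
    proof (rule sum_pos)
      fix i have "-1/2 < \<alpha> $ i" using \<alpha> by blast
      thus "0 < \<alpha> $ i + 1" by simp
    qed auto
    thus ?thesis by (simp add: sum.distrib)
  qed
  let ?Q = "\<lambda>k. {x :: real^'n. x \<in> pos_orthant \<and> (\<forall>i. x $ i \<le> 2 ^ k)}"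
  \<comment> \<open>The factor 4^a pays for the lower bound 4^(k - 1) in place of 4^k and also
    covers k = 0.\<close>
  let ?c = "\<lambda>k. 4 powr a * (4 powr (-a)) ^ k"
  have Q: "?Q k \<in> sets ?M" for k
  proof -
    have "?Q k = pos_orthant \<inter> cbox 0 (\<chi> i. 2 ^ k)"
      by (auto simp: pos_orthant_def mem_box_cart less_imp_le)
    thus ?thesis unfolding bessel_measure_def by (auto simp: sets_restrict_space_iff)
  qed
  show "(\<lambda>x. (1 + (norm x)\<^sup>2) powr (- a)) \<in> borel_measurable ?M"
    by (intro measurable_bessel_measure) measurable
  show "AE x in ?M. 0 \<le> (1 + (norm x)\<^sup>2) powr (- a)" by simp
  have "(\<integral>\<^sup>+x. ennreal ((1 + (norm x)\<^sup>2) powr (- a)) \<partial>?M)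
    \<le> (\<integral>\<^sup>+x. (\<Sum>k. ennreal (?c k) * indicator (?Q k) x) \<partial>?M)"
  proof (rule nn_integral_mono)
    fix x assume "x \<in> space ?M"
    hence x: "x \<in> pos_orthant" by (simp add: space_bessel_measure)
    obtain k0 where k0: "norm x \<le> 2 ^ k0"
      using real_arch_pow[of 2 "norm x"] by (auto intro: less_imp_le)
    have "x \<in> ?Q k0" using x k0 component_le_norm_cart[of x] by (auto intro: order_trans abs_le_D1)
    define k where "k = (LEAST k. x \<in> ?Q k)"
    have k: "x \<in> ?Q k" unfolding k_def by (rule LeastI) fact
    have "(1 + (norm x)\<^sup>2) powr (- a) \<le> ?c k"
    proof (cases k)
      case 0
      have "(1 + (norm x)\<^sup>2) powr (- a) \<le> 1 powr (- a)"
        using A0 a by (intro powr_mono2') auto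
      also have "\<dots> \<le> 4 powr a" using A0 a by (simp add: ge_one_powr_ge_zero)
      finally show ?thesis using 0 by simp
    next
      case (Suc l)
      hence "x \<notin> ?Q l" unfolding k_def by (intro not_less_Least) simp
      then obtain i where "x $ i > 2 ^ l" using x by (auto simp: not_le)
      hence "2 ^ l \<le> norm x" using component_le_norm_cart[of x i] by linarith
      hence "(2 ^ l)\<^sup>2 \<le> (norm x)\<^sup>2" by (intro power_mono) auto
      moreover have "(2 ^ l :: real)\<^sup>2 = 4 ^ l" by (simp add: power2_eq_square power_mult_distrib[symmetric])
      ultimately have "4 ^ l \<le> 1 + (norm x)\<^sup>2" by simp
      hence "(1 + (norm x)\<^sup>2) powr (- a) \<le> (4 ^ l) powr (- a)"
        using A0 a by (intro powr_mono2') auto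
      also have "\<dots> = (4 powr (- a)) ^ l" by (simp add: powr_realpow[symmetric] powr_powr mult.commute)
      also have "\<dots> = ?c k" unfolding Suc by (simp add: powr_minus)
      finally show ?thesis .
    qed
    hence "ennreal ((1 + (norm x)\<^sup>2) powr (- a)) \<le> (\<lambda>k. ennreal (?c k) * indicator (?Q k) x) k"
      using k by (auto intro!: ennreal_leI)
    also have "\<dots> \<le> (\<Sum>k. ennreal (?c k) * indicator (?Q k) x)"
    proof -
      have "F k \<le> suminf F" for F :: "nat \<Rightarrow> ennreal" using sum_le_suminf[of F "{k}"] by simp
      thus ?thesis .
    qed
    finally show "ennreal ((1 + (norm x)\<^sup>2) powr (- a)) \<le> (\<Sum>k. ennreal (?c k) * indicator (?Q k) x)" .
  qed
  also have "\<dots> = (\<Sum>k. \<integral>\<^sup>+x. ennreal (?c k) * indicator (?Q k) x \<partial>?M)"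
    using Q by (intro nn_integral_suminf) auto
  also have "\<dots> \<le> (\<Sum>k. ennreal (4 powr a * (4 powr (?A - a)) ^ k))"
  proof (rule suminf_le)
    fix k
    have "(\<integral>\<^sup>+x. ennreal (?c k) * indicator (?Q k) x \<partial>?M)
      = ennreal (?c k) * emeasure ?M (?Q k)"
      using Q by (simp add: nn_integral_cmult_indicator)
    also have "\<dots> \<le> ennreal (?c k) * ennreal ((4 powr ?A) ^ k)"
      using emeasure_bessel_cube_le[OF \<alpha>, of k] by (intro mult_left_mono) auto
    also have "\<dots> = ennreal (4 powr a * (4 powr (-a) * 4 powr ?A) ^ k)"
      by (simp add: ennreal_mult'[symmetric] power_mult_distrib mult.assoc)
    also have "4 powr (-a) * 4 powr ?A = 4 powr (?A - a)" unfolding powr_add[symmetric] by simp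
    finally show "(\<integral>\<^sup>+x. ennreal (?c k) * indicator (?Q k) x \<partial>?M)
      \<le> ennreal (4 powr a * (4 powr (?A - a)) ^ k)" .
  qed auto
  also have "\<dots> < \<infinity>"
  proof -
    have "4 powr (?A - a) < 4 powr 0" using a by (intro powr_less_mono) auto
    hence "summable (\<lambda>k. 4 powr a * (4 powr (?A - a)) ^ k)"
      by (intro summable_mult summable_geometric) auto
    hence "(\<Sum>k. ennreal (4 powr a * (4 powr (?A - a)) ^ k)) \<noteq> top"
      by (rule ennreal_suminf_neq_top) simp
    thus ?thesis unfolding infinity_ennreal_def by (rule less_top[THEN iffD1])
  qed
  finally show "(\<integral>\<^sup>+x. ennreal ((1 + (norm x)\<^sup>2) powr (- a)) \<partial>?M) < \<infinity>" .
qed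

lemma integrable_bessel_inverse_power:
  fixes \<alpha> :: "real^'n"
  assumes \<alpha>: "admissible \<alpha>"
  obtains N where "integrable (bessel_measure \<alpha>) (\<lambda>x. 1 / (1 + norm x) ^ N)"
proof -
  let ?M = "bessel_measure \<alpha>"
  obtain N :: nat where N: "(\<Sum>i\<in>UNIV. \<alpha> $ i) + real CARD('n) < real N" using reals_Archimedean2 by blast
  have "integrable ?M (\<lambda>x. 1 / (1 + norm x) ^ (2 * N))"
  proof (rule Bochner_Integration.integrable_bound[OF integrable_bessel_power[OF \<alpha> N]])
    show "(\<lambda>x. 1 / (1 + norm x) ^ (2 * N)) \<in> borel_measurable ?M"
      by (intro measurable_bessel_measure) measurable
    have "1 / (1 + norm x) ^ (2 * N) \<le> (1 + (norm x)\<^sup>2) powr - real N" for x :: "real^'n"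
    proof -
      have p: "0 < 1 + (norm x)\<^sup>2" by (simp add: add_pos_nonneg)
      have "1 + (norm x)\<^sup>2 \<le> (1 + norm x)\<^sup>2" by (simp add: power2_sum)
      hence "(1 + (norm x)\<^sup>2) ^ N \<le> ((1 + norm x)\<^sup>2) ^ N" using p by (intro power_mono) auto
      hence "1 / ((1 + norm x)\<^sup>2) ^ N \<le> 1 / (1 + (norm x)\<^sup>2) ^ N" using p
        by (intro divide_left_mono mult_pos_pos zero_less_power) (auto intro: add_pos_nonneg)
      thus ?thesis using p by (simp add: powr_minus powr_realpow power_mult divide_inverse)
    qed
    thus "AE x in ?M. norm (1 / (1 + norm x) ^ (2 * N)) \<le> norm ((1 + (norm x)\<^sup>2) powr - real N)"
      by auto
  qed
  thus ?thesis by (rule that)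
qed

lemma integrable_bessel_rapid:
  fixes \<alpha> :: "real^'n"
  assumes \<alpha>: "admissible \<alpha>" and f: "f \<in> borel_measurable borel" and r: "rapid norm f"
  shows "integrable (bessel_measure \<alpha>) f"
proof -
  let ?M = "bessel_measure \<alpha>"
  obtain N where N: "integrable ?M (\<lambda>x. 1 / (1 + norm x) ^ N)"
    using integrable_bessel_inverse_power[OF \<alpha>] .
  obtain C where C: "\<And>x. (1 + norm x) ^ N * norm (f x) \<le> C" using r unfolding rapid_def by blast
  show ?thesis
  proof (rule Bochner_Integration.integrable_bound[OF integrable_mult_right[OF N, of C]])
    show "f \<in> borel_measurable ?M" using f by (rule measurable_bessel_measure)
    have "norm (f x) \<le> norm (C * (1 / (1 + norm x) ^ N))" for x
    proof -
      have "norm (f x) \<le> C / (1 + norm x) ^ N"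
        using C[of x] by (subst pos_le_divide_eq) (auto simp: mult.commute intro!: zero_less_power add_pos_nonneg)
      also have "\<dots> \<le> norm (C * (1 / (1 + norm x) ^ N))"
        using abs_ge_self[of "C * (1 / (1 + norm x) ^ N)"] by simp
      finally show ?thesis .
    qed
    thus "AE x in ?M. norm (f x) \<le> norm (C * (1 / (1 + norm x) ^ N))" by blast
  qed
qed

text \<open>The substitution multiplies the single coordinate x_i by c and preserves the orthant.
  Lebesgue measure contributes a factor c and the weight a factor c^(2 \<alpha>_i + 1).\<close>

lemma integral_bessel_scale:
  fixes \<alpha> :: "real^'n" and u :: "real^'n \<Rightarrow> complex"
  assumes c: "c > 0" and u[measurable]: "u \<in> borel_measurable borel"
  shows "(LINT x|bessel_measure \<alpha>. u (x + ((c - 1) * x $ i) *\<^sub>R axis i 1))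
    = (c powr (- (2 * \<alpha> $ i + 2))) *\<^sub>R (LINT x|bessel_measure \<alpha>. u x)"
proof -
  let ?M = "bessel_measure \<alpha>"
  let ?T = "\<lambda>x::real^'n. x + ((c - 1) * x $ i) *\<^sub>R axis i 1"
  let ?d = "\<lambda>j::real^'n. if j = axis i 1 then c else 1"
  let ?w = "\<lambda>x. indicator pos_orthant x * bessel_weight \<alpha> x"
  have [measurable]: "?T \<in> borel_measurable borel" by measurable
  have T: "0 + (\<Sum>j\<in>Basis. (?d j * (x \<bullet> j)) *\<^sub>R j) = ?T x" for x
  proof -
    have "(\<Sum>j\<in>Basis. (?d j * (x \<bullet> j)) *\<^sub>R j)
      = (\<Sum>j\<in>Basis. (x \<bullet> j) *\<^sub>R j + (if j = axis i 1 then ((c - 1) * (x \<bullet> j)) *\<^sub>R j else 0))"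
      by (intro sum.cong) (auto simp: algebra_simps)
    also have "\<dots> = x + ((c - 1) * (x \<bullet> axis i 1)) *\<^sub>R axis i 1"
      by (simp add: sum.distrib euclidean_representation axis_in_Basis_iff)
    finally show ?thesis by (simp add: inner_axis)
  qed
  have prod: "(\<Prod>j\<in>Basis. \<bar>?d j\<bar>) = c"
  proof -
    have "(\<Prod>j\<in>Basis. \<bar>?d j\<bar>) = (\<Prod>j\<in>Basis. if j = (axis i 1 :: real^'n) then c else 1)"
      by (rule prod.cong) (use c in auto)
    thus ?thesis by (simp add: axis_in_Basis_iff)
  qed
  have L: "lborel = density (distr lborel borel ?T) (\<lambda>_. ennreal c)"
    using lborel_affine_euclidean[of ?d 0] c unfolding T prod by auto
  have comp: "?T x $ k = (if k = i then c * x $ k else x $ k)" for x k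
    by (auto simp: axis_def algebra_simps)
  have w: "?w (?T x) = c powr (2 * \<alpha> $ i + 1) * ?w x" for x
  proof (cases "x \<in> pos_orthant")
    case True
    hence "?T x \<in> pos_orthant" using c by (simp only: pos_orthant_def mem_Collect_eq comp) auto
    moreover have "bessel_weight \<alpha> (?T x)
      = (\<Prod>k\<in>UNIV. (if k = i then c powr (2 * \<alpha> $ k + 1) else 1) * (x $ k) powr (2 * \<alpha> $ k + 1))"
      unfolding comp using True c by (intro prod.cong) (auto simp: powr_mult pos_orthant_def less_imp_le)
    ultimately show ?thesis using True by (simp add: prod.distrib)
  next
    case False
    then obtain k where "x $ k \<le> 0" by (auto simp: pos_orthant_def not_less)
    hence "?T x $ k \<le> 0" unfolding comp using c by (auto simp: mult_le_0_iff)
    hence "?T x \<notin> pos_orthant" unfolding pos_orthant_def mem_Collect_eq using not_less by blast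
    thus ?thesis using False by simp
  qed
  have "(LINT x|?M. u x) = (LINT x|lborel. ?w x *\<^sub>R u x)"
    by (rule integral_bessel_measure) fact
  also have "\<dots> = (LINT x|density (distr lborel borel ?T) (\<lambda>_. ennreal c). ?w x *\<^sub>R u x)"
    using L by simp
  also have "\<dots> = (LINT x|distr lborel borel ?T. c *\<^sub>R (?w x *\<^sub>R u x))"
    using c by (intro integral_density) auto
  also have "\<dots> = (LINT x|lborel. c *\<^sub>R (?w (?T x) *\<^sub>R u (?T x)))"
    by (intro integral_distr) auto
  also have "\<dots> = (LINT x|lborel. (c * c powr (2 * \<alpha> $ i + 1)) *\<^sub>R (?w x *\<^sub>R u (?T x)))"
    unfolding w by (simp add: mult_ac)
  also have "\<dots> = (c * c powr (2 * \<alpha> $ i + 1)) *\<^sub>R (LINT x|lborel. ?w x *\<^sub>R u (?T x))"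
    by (rule integral_scaleR_right) 
  also have "(LINT x|lborel. ?w x *\<^sub>R u (?T x)) = (LINT x|?M. u (?T x))"
    by (rule integral_bessel_measure[symmetric]) measurable
  finally have eq: "(LINT x|?M. u x)
    = (c * c powr (2 * \<alpha> $ i + 1)) *\<^sub>R (LINT x|?M. u (?T x))" .
  have "c powr (2 * \<alpha> $ i + 2) = c powr (1 + (2 * \<alpha> $ i + 1))" by (simp add: add_ac)
  also have "\<dots> = c powr 1 * c powr (2 * \<alpha> $ i + 1)" by (rule powr_add)
  finally have "c * c powr (2 * \<alpha> $ i + 1) = c powr (2 * \<alpha> $ i + 2)" using c by simp
  moreover have "c powr (- (2 * \<alpha> $ i + 2)) * c powr (2 * \<alpha> $ i + 2) = 1"
    unfolding powr_add[symmetric] using c by simp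
  ultimately show ?thesis unfolding eq scaleR_scaleR by simp
qed

subsection \<open>Differentiation under the integral sign\<close>

lemma continuous_on_integral_dominated:
  fixes f :: "'a \<Rightarrow> 'b::real_normed_vector \<Rightarrow> complex"
  assumes f: "\<And>y. (\<lambda>t. f t y) \<in> borel_measurable M"
    and cont: "\<And>t. t \<in> space M \<Longrightarrow> continuous_on UNIV (f t)"
    and bound: "\<And>t y. t \<in> space M \<Longrightarrow> norm (f t y) \<le> g t" and g: "integrable M g"
  shows "continuous_on UNIV (\<lambda>y. LINT t|M. f t y)"
  unfolding continuous_on_sequentially comp_def
proof safe
  fix X and a :: 'b assume X: "X \<longlonglongrightarrow> a"
  show "(\<lambda>n. LINT t|M. f t (X n)) \<longlonglongrightarrow> (LINT t|M. f t a)"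
  proof (rule integral_dominated_convergence[where w = g])
    show "AE t in M. (\<lambda>n. f t (X n)) \<longlonglongrightarrow> f t a"
      using continuous_on_tendsto_compose[OF cont X] by (intro AE_I2) auto
  qed (use f g bound in \<open>auto intro: AE_I2\<close>)
qed

text \<open>Dominated convergence for the remainder quotient along sequences. The form with total
  derivatives on an open convex set serves a real scaling parameter as well as vector
  variables.\<close>

lemma has_derivative_integral:
  fixes f :: "'a \<Rightarrow> 'b::real_normed_vector \<Rightarrow> complex"
  assumes S: "open S" "convex S" and x: "x \<in> S"
    and f: "\<And>y. y \<in> S \<Longrightarrow> integrable M (\<lambda>t. f t y)"
    and der: "\<And>t y. t \<in> space M \<Longrightarrow> y \<in> S \<Longrightarrow> (f t has_derivative f' t y) (at y)"
    and bound: "\<And>t y h. t \<in> space M \<Longrightarrow> y \<in> S \<Longrightarrow> norm (f' t y h) \<le> g t * norm h"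
    and g: "integrable M g"
    and meas: "\<And>h. (\<lambda>t. f' t x h) \<in> borel_measurable M"
  shows "((\<lambda>y. LINT t|M. f t y) has_derivative (\<lambda>h. LINT t|M. f' t x h)) (at x)"
proof -
  have int: "integrable M (\<lambda>t. f' t x h)" for h
  proof (rule Bochner_Integration.integrable_bound[OF integrable_mult_left[OF g, of "norm h"] meas])
    show "AE t in M. norm (f' t x h) \<le> norm (g t * norm h)"
      using bound[OF _ x] by (intro AE_I2) (auto intro: order_trans[OF _ abs_ge_self])
  qed
  have lin: "linear (f' t x)" if "t \<in> space M" for t
    using der[OF that x] by (rule has_derivative_linear)
  show ?thesis
    unfolding has_derivative_iff_norm
  proof
    show "bounded_linear (\<lambda>h. LINT t|M. f' t x h)"
    proof (rule bounded_linear_intro[where K = "LINT t|M. g t"])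
      fix h k
      have "(LINT t|M. f' t x (h + k)) = (LINT t|M. f' t x h + f' t x k)"
        by (intro Bochner_Integration.integral_cong) (auto simp: linear_add[OF lin])
      thus "(LINT t|M. f' t x (h + k)) = (LINT t|M. f' t x h) + (LINT t|M. f' t x k)"
        by (simp add: int)
    next
      fix c h
      have "(LINT t|M. f' t x (c *\<^sub>R h)) = (LINT t|M. c *\<^sub>R f' t x h)"
        by (intro Bochner_Integration.integral_cong) (auto simp: linear_scale[OF lin])
      thus "(LINT t|M. f' t x (c *\<^sub>R h)) = c *\<^sub>R (LINT t|M. f' t x h)"
        by simp
    next
      fix h
      have "norm (LINT t|M. f' t x h) \<le> (LINT t|M. g t * norm h)"
        by (rule order_trans[OF integral_norm_bound integral_mono]) (use int g bound[OF _ x] in auto)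
      thus "norm (LINT t|M. f' t x h) \<le> norm h * (LINT t|M. g t)" by (simp add: mult.commute)
    qed
    show "((\<lambda>y. norm ((LINT t|M. f t y) - (LINT t|M. f t x) - (LINT t|M. f' t x (y - x))) / norm (y - x))
      \<longlongrightarrow> 0) (at x)"
      unfolding tendsto_at_iff_sequentially comp_def
    proof safe
      fix X assume X0: "\<forall>i. X i \<in> UNIV - {x}" and X: "X \<longlonglongrightarrow> x"
      have "eventually (\<lambda>i. X i \<in> S) sequentially" using X S(1) x by (rule topological_tendstoD)
      then obtain N where N: "\<And>i. N \<le> i \<Longrightarrow> X i \<in> S" unfolding eventually_sequentially by blast
      define Y where "Y i = X (i + N)" for i
      have YS: "Y i \<in> S" and Yx: "Y i \<noteq> x" for i using N X0 by (auto simp: Y_def)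
      have Y: "Y \<longlonglongrightarrow> x" unfolding Y_def using X by (rule LIMSEQ_ignore_initial_segment)
      define q where "q i t = (1 / norm (Y i - x)) *\<^sub>R (f t (Y i) - f t x - f' t x (Y i - x))" for i t
      have "(\<lambda>i. LINT t|M. q i t) \<longlonglongrightarrow> (LINT t|M. 0)"
      \<comment> \<open>One g bounds the increment, by the mean value inequality on the convex set
        S; the other bounds the linear term.\<close>
      proof (rule integral_dominated_convergence[where w = "\<lambda>t. 2 * g t"])
        show "(\<lambda>t. 0) \<in> borel_measurable M" by simp
        show "q i \<in> borel_measurable M" for i
          unfolding q_def using f[OF YS] f[OF x] meas
          by (intro borel_measurable_scaleR borel_measurable_diff borel_measurable_const) auto
        show "integrable M (\<lambda>t. 2 * g t)" using g by simp
        show "AE t in M. (\<lambda>i. q i t) \<longlonglongrightarrow> 0"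
        proof (rule AE_I2)
          fix t assume t: "t \<in> space M"
          have "((\<lambda>y. norm (f t y - f t x - f' t x (y - x)) / norm (y - x)) \<longlongrightarrow> 0) (at x)"
            using der[OF t x] unfolding has_derivative_iff_norm by blast
          hence "(\<lambda>i. norm (f t (Y i) - f t x - f' t x (Y i - x)) / norm (Y i - x)) \<longlonglongrightarrow> 0"
            unfolding tendsto_at_iff_sequentially comp_def using Y Yx by auto
          hence "(\<lambda>i. norm (q i t)) \<longlonglongrightarrow> 0" unfolding q_def by simp
          thus "(\<lambda>i. q i t) \<longlonglongrightarrow> 0" by (rule tendsto_norm_zero_cancel)
        qed
        show "AE t in M. norm (q i t) \<le> 2 * g t" for i
        proof (rule AE_I2)
          fix t assume t: "t \<in> space M"
          have n: "norm (Y i - x) > 0" using Yx by simp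
          have "norm (f t (Y i) - f t x) \<le> g t * norm (Y i - x)"
          proof (rule differentiable_bound[OF S(2)])
            show "(f t has_derivative f' t y) (at y within S)" if "y \<in> S" for y
              using der[OF t that] by (rule has_derivative_at_withinI)
            show "onorm (f' t y) \<le> g t" if "y \<in> S" for y
            proof (rule onorm_bound)
              have "0 \<le> g t * norm (Y i - x)" using bound[OF t x] norm_ge_zero order_trans by blast
              thus "0 \<le> g t" using n by (simp add: zero_le_mult_iff)
            qed (rule bound[OF t that])
          qed (use YS x in auto)
          moreover have "norm (f' t x (Y i - x)) \<le> g t * norm (Y i - x)" by (rule bound[OF t x])
          ultimately have "norm (f t (Y i) - f t x - f' t x (Y i - x)) \<le> 2 * g t * norm (Y i - x)"
            using norm_triangle_ineq4[of "f t (Y i) - f t x" "f' t x (Y i - x)"] by linarith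
          thus "norm (q i t) \<le> 2 * g t" unfolding q_def using n by (simp add: divide_simps)
        qed
      qed
      hence "(\<lambda>i. norm (LINT t|M. q i t)) \<longlonglongrightarrow> 0" using tendsto_norm_zero by fastforce
      moreover have "norm (LINT t|M. q i t)
         = norm ((LINT t|M. f t (Y i)) - (LINT t|M. f t x) - (LINT t|M. f' t x (Y i - x))) / norm (Y i - x)" for i
        unfolding q_def by (simp add: f[OF YS] f[OF x] int)
      ultimately have "(\<lambda>i. norm ((LINT t|M. f t (Y i)) - (LINT t|M. f t x)
         - (LINT t|M. f' t x (Y i - x))) / norm (Y i - x)) \<longlonglongrightarrow> 0" by simp
      thus "(\<lambda>i. norm ((LINT t|M. f t (X i)) - (LINT t|M. f t x)
         - (LINT t|M. f' t x (X i - x))) / norm (X i - x)) \<longlonglongrightarrow> 0"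
        unfolding Y_def by (rule LIMSEQ_offset)
    qed
  qed
qed

text \<open>Integration by parts, as the derivative at \<open>c = 1\<close> of the scaling identity for
  the \<open>i\<close>-th coordinate.\<close>

lemma integral_bessel_euler:
  fixes \<alpha> :: "real^'n" and u :: "real^'n \<Rightarrow> complex"
  assumes \<alpha>: "admissible \<alpha>"
    and u: "u differentiable_on UNIV" "rapid norm u"
    and du: "continuous_on UNIV (partial_deriv i u)" "rapid norm (partial_deriv i u)"
  shows "(LINT x|bessel_measure \<alpha>. coord i x * partial_deriv i u x)
    = - complex_of_real (2 * \<alpha> $ i + 2) * (LINT x|bessel_measure \<alpha>. u x)"
proof -
  let ?D = "partial_deriv i"
  let ?M = "bessel_measure \<alpha>"
  let ?T = "\<lambda>t x. x + (t * x $ i) *\<^sub>R (axis i 1 :: real^'n)"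
  \<comment> \<open>For |t| < 1/2 the displacement has norm at most |x| / 2, so weights at x and at
    the scaled point are comparable, and the scaling factor 1 + t is positive.\<close>
  let ?S = "{-1/2<..<1/2::real}"
  have T: "continuous_on UNIV (?T t)" for t by (intro continuous_intros)
  have cu: "continuous_on UNIV u" using u(1) by (rule differentiable_imp_continuous_on)
  have cuT: "continuous_on UNIV (\<lambda>x. u (?T t x))" for t
    by (rule continuous_on_compose2[OF cu T]) auto
  have cduT: "continuous_on UNIV (\<lambda>x. ?D u (?T t x))" for t
    by (rule continuous_on_compose2[OF du(1) T]) auto
  have T1: "1 + norm x \<le> 2 * (1 + norm (?T t x))" if "t \<in> ?S" for t and x :: "real^'n"
  proof -
    have "norm x \<le> norm (?T t x) + norm ((t * x $ i) *\<^sub>R (axis i 1 :: real^'n))"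
      using norm_triangle_ineq4[of "?T t x" "(t * x $ i) *\<^sub>R axis i 1"] by simp
    also have "norm ((t * x $ i) *\<^sub>R (axis i 1 :: real^'n)) = \<bar>t\<bar> * \<bar>x $ i\<bar>" by (simp add: abs_mult norm_axis_1)
    also have "\<dots> \<le> 1/2 * norm x"
      using that component_le_norm_cart[of x i] by (intro mult_mono) auto
    finally show ?thesis by simp
  qed
  have rT: "rapid norm (\<lambda>x. v (?T t x))" if v: "rapid norm v" and t: "t \<in> ?S" for v t
    unfolding rapid_def
  proof
    fix k
    obtain C where C: "\<And>x. (1 + norm x) ^ k * norm (v x) \<le> C" using v unfolding rapid_def by blast
    have "(1 + norm x) ^ k * norm (v (?T t x)) \<le> 2 ^ k * C" for x
      by (rule weight_power_mult_le[OF T1[OF t] _ norm_ge_zero C]) simp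
    thus "\<exists>C. \<forall>x. (1 + norm x) ^ k * norm (v (?T t x)) \<le> C" by blast
  qed
  obtain N where N: "integrable ?M (\<lambda>x. 1 / (1 + norm x) ^ N)"
    using integrable_bessel_inverse_power[OF \<alpha>] .
  \<comment> \<open>The power beyond N absorbs the factor |x_i| that differentiation in t
    produces.\<close>
  obtain C where C: "\<And>x. (1 + norm x) ^ Suc N * norm (?D u x) \<le> C"
    using du(2) unfolding rapid_def by blast
  let ?g = "\<lambda>x::real^'n. (2 ^ Suc N * C) * (1 / (1 + norm x) ^ N)"
  have g: "\<bar>x $ i\<bar> * norm (?D u (?T t x)) \<le> ?g x" if t: "t \<in> ?S" for x t
  proof -
    have "(1 + norm x) ^ Suc N * norm (?D u (?T t x)) \<le> 2 ^ Suc N * C"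
      by (rule weight_power_mult_le[OF T1[OF t] _ norm_ge_zero C]) simp
    hence *: "(1 + norm x) ^ N * ((1 + norm x) * norm (?D u (?T t x))) \<le> 2 ^ Suc N * C"
      by (simp add: mult_ac)
    have "\<bar>x $ i\<bar> * norm (?D u (?T t x)) \<le> (1 + norm x) * norm (?D u (?T t x))"
      using component_le_norm_cart[of x i] by (intro mult_right_mono) auto
    also have "\<dots> \<le> (2 ^ Suc N * C) / (1 + norm x) ^ N"
      using * by (subst pos_le_divide_eq) (auto simp: mult_ac intro!: zero_less_power add_pos_nonneg)
    finally show ?thesis by simp
  qed
  have D: "((\<lambda>t. LINT x|?M. u (?T t x)) has_derivative
     (\<lambda>h. LINT x|?M. h *\<^sub>R ((x $ i) *\<^sub>R ?D u (?T 0 x)))) (at 0)"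
  proof (rule has_derivative_integral[where S = ?S and g = ?g])
    show "0 \<in> ?S" by simp
    show "integrable ?M (\<lambda>x. u (?T t x))" if "t \<in> ?S" for t
      using rT[OF u(2) that] cuT[of t] by (intro integrable_bessel_rapid[OF \<alpha>] borel_measurable_continuous_onI)
    show "((\<lambda>t. u (?T t x)) has_derivative (\<lambda>h. h *\<^sub>R ((x $ i) *\<^sub>R ?D u (?T t x)))) (at t)"
      for x t
    proof -
      have 1: "((\<lambda>t. t * x $ i) has_vector_derivative (x $ i)) (at t)"
        by (auto intro!: derivative_eq_intros simp: has_real_derivative_iff_has_vector_derivative[symmetric])
      have 2: "((\<lambda>r. u (x + r *\<^sub>R axis i 1)) has_vector_derivative ?D u (?T t x)) (at (t * x $ i))"
        using has_vector_derivative_along_axis[OF u(1)] .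
      from vector_diff_chain_at[OF 1 2] show ?thesis
        unfolding has_vector_derivative_def comp_def .
    qed
    show "norm (h *\<^sub>R ((x $ i) *\<^sub>R ?D u (?T t x))) \<le> ?g x * norm h" if "t \<in> ?S" for x t h
      using mult_right_mono[OF g[OF that], of "norm h" x] by (simp add: mult_ac abs_mult)
    show "integrable ?M ?g" using N by (rule integrable_mult_right)
    show "(\<lambda>x. h *\<^sub>R ((x $ i) *\<^sub>R ?D u (?T 0 x))) \<in> borel_measurable ?M" for h
      using du(1) by (intro measurable_bessel_measure borel_measurable_continuous_onI continuous_intros) auto
  qed (auto simp: convex_real_interval)
  let ?I = "LINT x|?M. u x"
  have eq: "(LINT x|?M. u (?T t x)) = ((1 + t) powr (- (2 * \<alpha> $ i + 2))) *\<^sub>R ?I" if "t \<in> ?S" for t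
    using integral_bessel_scale[of "1 + t" u \<alpha> i] that cu by (simp add: borel_measurable_continuous_onI)
  have "((\<lambda>t. ((1 + t) powr (- (2 * \<alpha> $ i + 2))) *\<^sub>R ?I) has_vector_derivative
     (- (2 * \<alpha> $ i + 2)) *\<^sub>R ?I) (at 0)"
    by (rule has_vector_derivative_eq_rhs[OF has_vector_derivative_scaleR[OF _ has_vector_derivative_const]])
      (auto intro!: derivative_eq_intros)
  hence "((\<lambda>t. LINT x|?M. u (?T t x)) has_vector_derivative (- (2 * \<alpha> $ i + 2)) *\<^sub>R ?I) (at 0)"
    by (rule has_vector_derivative_transform_within_open[of _ _ _ ?S]) (use eq in auto)
  from has_derivative_unique[OF D this[unfolded has_vector_derivative_def]]
  have "(LINT x|?M. 1 *\<^sub>R ((x $ i) *\<^sub>R ?D u (?T 0 x))) = 1 *\<^sub>R ((- (2 * \<alpha> $ i + 2)) *\<^sub>R ?I)"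
    by meson
  thus ?thesis by (simp add: scaleR_conv_of_real)
qed

subsection \<open>Rapidly decreasing functions\<close>

lemma norm_diff_le_vector_derivative:
  fixes \<phi> :: "real \<Rightarrow> complex"
  assumes r: "0 \<le> r" and d: "\<And>t. 0 \<le> t \<Longrightarrow> t \<le> r \<Longrightarrow> (\<phi> has_vector_derivative \<phi>' t) (at t within {0..r})"
    and b: "\<And>t. 0 \<le> t \<Longrightarrow> t \<le> r \<Longrightarrow> norm (\<phi>' t) \<le> B"
  shows "norm (\<phi> r - \<phi> 0) \<le> B * r"
proof -
  have "norm (\<phi> r - \<phi> 0) \<le> B * norm (r - 0)"
  proof (rule differentiable_bound[of "{0..r}" \<phi> "\<lambda>t h. h *\<^sub>R \<phi>' t"])
    show "(\<phi> has_derivative (\<lambda>h. h *\<^sub>R \<phi>' t)) (at t within {0..r})" if "t \<in> {0..r}" for t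
      using d[of t] that unfolding has_vector_derivative_def by simp
    show "onorm (\<lambda>h. h *\<^sub>R \<phi>' t) \<le> B" if "t \<in> {0..r}" for t
      using b[of t] that by (intro onorm_le) (auto simp: mult.commute[of B] intro!: mult_left_mono)
  qed (use r in auto)
  thus ?thesis using r by simp
qed

text \<open>Landau's inequality, from a Taylor expansion with step \<open>(1 + norm x)\<close> to the power
  \<open>- k\<close>.\<close>

lemma rapid_partial_deriv:
  assumes f: "f differentiable_on UNIV" "rapid norm f"
    and df: "partial_deriv i f differentiable_on UNIV"
    and ddf: "bounded_fun (partial_deriv i (partial_deriv i f))"
  shows "rapid norm (partial_deriv i f)"
  unfolding rapid_def
proof
  let ?D = "partial_deriv i"
  fix k
  let ?e = "axis i 1 :: real^'a"
  obtain M where M: "\<And>x. norm (?D (?D f) x) \<le> M"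
    using ddf unfolding bounded_fun_def by blast
  obtain C where C: "\<And>x. (1 + norm x) ^ (2 * k) * norm (f x) \<le> C"
    using f(2) unfolding rapid_def by blast
  have "(1 + norm x) ^ k * norm (?D f x) \<le> 2 ^ (2 * k) * C + C + M" for x
  proof -
    define L where "L = (1 + norm x) ^ k"
    define r where "r = 1 / L"
    have L: "1 \<le> L" unfolding L_def by simp
    have r: "0 < r" "r \<le> 1" unfolding r_def using L by auto
    have 1: "norm (?D f (x + t *\<^sub>R ?e) - ?D f x) \<le> M * r" if "0 \<le> t" "t \<le> r" for t
    proof -
      have "norm (?D f (x + t *\<^sub>R ?e) - ?D f (x + 0 *\<^sub>R ?e)) \<le> M * t"
        by (rule norm_diff_le_vector_derivative[OF that(1) has_vector_derivative_along_axis[OF df] M])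
      also have "\<dots> \<le> M * r" using that order_trans[OF norm_ge_zero M[of x]] by (intro mult_left_mono) auto
      finally show ?thesis by simp
    qed
    have "norm ((f (x + r *\<^sub>R ?e) - r *\<^sub>R ?D f x) - (f (x + 0 *\<^sub>R ?e) - 0 *\<^sub>R ?D f x))
        \<le> (M * r) * r"
      by (rule norm_diff_le_vector_derivative[of r _ "\<lambda>t. ?D f (x + t *\<^sub>R ?e) - ?D f x"])
        (use r 1 in \<open>auto intro!: derivative_eq_intros has_vector_derivative_along_axis[OF f(1)]
          simp: has_real_derivative_iff_has_vector_derivative[symmetric]\<close>)
    hence "norm (f (x + r *\<^sub>R ?e) - f x - r *\<^sub>R ?D f x) \<le> M * r * r"
      by (simp add: algebra_simps)
    moreover have "norm (r *\<^sub>R ?D f x) \<le> norm (f (x + r *\<^sub>R ?e) - f x - r *\<^sub>R ?D f x)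
       + norm (f (x + r *\<^sub>R ?e)) + norm (f x)"
      using norm_triangle_ineq4[of "f (x + r *\<^sub>R ?e) - f x" "f (x + r *\<^sub>R ?e) - f x - r *\<^sub>R ?D f x"]
        norm_triangle_ineq4[of "f (x + r *\<^sub>R ?e)" "f x"] by simp
    ultimately have "r * norm (?D f x) \<le> M * r * r + (norm (f (x + r *\<^sub>R ?e)) + norm (f x))"
      using r by simp
    \<comment> \<open>With r = 1 / L, multiplication by L^2 turns r into L and the Taylor remainder
      M r^2 into M; the two values of f are controlled by the decay of order 2 k.\<close>
    hence "(L * L) * (r * norm (?D f x)) \<le> (L * L) * (M * r * r + (norm (f (x + r *\<^sub>R ?e)) + norm (f x)))"
      using L by (intro mult_left_mono) auto
    moreover have "(L * L) * (r * norm (?D f x)) = L * norm (?D f x)"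
      "(L * L) * (M * r * r) = M" unfolding r_def using L by auto
    ultimately have "L * norm (?D f x) \<le> M + (L * L) * norm (f (x + r *\<^sub>R ?e)) + (L * L) * norm (f x)"
      by (simp only: distrib_left add.assoc)
    moreover have LL: "L * L = (1 + norm x) ^ (2 * k)" unfolding L_def by (simp add: power_add[symmetric] mult_2)
    moreover have "(1 + norm x) ^ (2 * k) * norm (f (x + r *\<^sub>R ?e)) \<le> 2 ^ (2 * k) * C"
    proof -
      have "norm x \<le> norm (x + r *\<^sub>R ?e) + norm (r *\<^sub>R ?e)"
        using norm_triangle_ineq4[of "x + r *\<^sub>R ?e" "r *\<^sub>R ?e"] by simp
      hence "1 + norm x \<le> 2 * (1 + norm (x + r *\<^sub>R ?e))" 
        using r norm_ge_zero[of "x + r *\<^sub>R ?e"] by (simp add: norm_axis_1 del: norm_ge_zero)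
      thus ?thesis by (rule weight_power_mult_le[OF _ _ norm_ge_zero C]) simp
    qed
    ultimately show ?thesis using C[of x] unfolding L_def[symmetric] by simp
  qed
  thus "\<exists>C. \<forall>x. (1 + norm x) ^ k * norm (?D f x) \<le> C" by blast
qed

text \<open>Decay has to be verified for the function alone: Landau's inequality, iterated,
  transmits it to derivatives that are merely known to be bounded. This covers both the quotients
  below and the transforms.\<close>

lemma ctrl_smooth_rapidI:
  assumes "ctrl_smooth bounded_fun f" "rapid norm f"
  shows "ctrl_smooth (rapid norm) f"
proof (rule ctrl_smoothI)
  show "ctrl_diff (rapid norm) m f" for m
    using assms
  proof (induction m arbitrary: f)
    case 0
    thus ?case using ctrl_smoothD(4) by auto
  next
    case (Suc m)
    have "rapid norm (partial_deriv i f)" for i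
      by (rule rapid_partial_deriv)
        (use Suc.prems ctrl_smoothD[OF Suc.prems(1)] ctrl_smoothD[OF ctrl_smoothD(5)[OF Suc.prems(1)]]
          ctrl_smoothD(2)[OF ctrl_smoothD(5)[OF ctrl_smoothD(5)[OF Suc.prems(1)]]] in auto)
    thus ?case using Suc ctrl_smoothD(3,5)[OF Suc.prems(1)] by auto
  qed
qed

section \<open>Gaussians in some of the variables, and powers of 1 + |x|^2\<close>

definition gauss :: "'n set \<Rightarrow> real^'n \<Rightarrow> complex" where
  "gauss S x = complex_of_real (exp (- (\<Sum>i\<in>S. (x $ i)\<^sup>2) / 2))"

lemma norm_proj_squared: "(norm (proj S x))\<^sup>2 = (\<Sum>i\<in>S. (x $ i)\<^sup>2)"
proof -
  have "(norm (proj S x))\<^sup>2 = (\<Sum>i\<in>UNIV. if i \<in> S then (x $ i)\<^sup>2 else 0)"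
    unfolding power2_norm_eq_inner inner_vec_def proj_def by (auto intro!: sum.cong simp: power2_eq_square)
  also have "\<dots> = (\<Sum>i\<in>S. (x $ i)\<^sup>2)" by (simp add: sum.If_cases)
  finally show ?thesis .
qed

lemma gauss_has_derivative:
  "(gauss S has_derivative (\<lambda>h. gauss S x * complex_of_real (- (\<Sum>i\<in>S. x $ i * h $ i)))) (at x)"
proof -
  have "((\<lambda>x. exp (- (\<Sum>i\<in>S. (x $ i)\<^sup>2) / 2)) has_derivative
     (\<lambda>h. exp (- (\<Sum>i\<in>S. (x $ i)\<^sup>2) / 2) * (- (\<Sum>i\<in>S. x $ i * h $ i)))) (at x)"
  proof -
    have "((\<lambda>x. (x $ i)\<^sup>2) has_derivative (\<lambda>h. 2 * (x $ i * h $ i))) (at x)" for i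
      by (auto intro!: derivative_eq_intros bounded_linear.has_derivative[OF bounded_linear_vec_nth])
    hence "((\<lambda>x. \<Sum>i\<in>S. (x $ i)\<^sup>2) has_derivative (\<lambda>h. \<Sum>i\<in>S. 2 * (x $ i * h $ i))) (at x)"
      by (intro has_derivative_sum)
    from has_derivative_mult_right[OF this, of "- 1 / 2"]
    have "((\<lambda>x. - (\<Sum>i\<in>S. (x $ i)\<^sup>2) / 2) has_derivative (\<lambda>h. - (\<Sum>i\<in>S. x $ i * h $ i))) (at x)"
      by (simp add: sum_distrib_left[symmetric])
    from has_derivative_exp[OF this] show ?thesis by (simp add: mult.commute)
  qed
  from bounded_linear.has_derivative[OF bounded_linear_of_real this]
  show ?thesis unfolding gauss_def[abs_def] by (simp add: o_def)
qed

lemma gauss_differentiable: "gauss S differentiable_on UNIV"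
  unfolding differentiable_on_def differentiable_def using gauss_has_derivative by blast

lemma partial_deriv_gauss:
  "partial_deriv k (gauss S) = (\<lambda>x. (if k \<in> S then - coord k x else 0) * gauss S x)"
proof
  fix x :: "real^'a"
  have "(\<Sum>i\<in>S. x $ i * axis k 1 $ i) = (\<Sum>i\<in>S. if i = k then x $ i else 0)"
    by (intro sum.cong) (auto simp: axis_def)
  thus "partial_deriv k (gauss S) x = (if k \<in> S then - coord k x else 0) * gauss S x"
    unfolding partial_deriv_has_derivative[OF gauss_has_derivative] by (simp add: sum.delta)
qed

lemma power_le_fact_mult_exp: "0 \<le> x \<Longrightarrow> x ^ k \<le> fact k * exp (x::real)"
proof -
  assume x: "0 \<le> x"
  have "(\<Sum>n\<in>{k}. x ^ n /\<^sub>R fact n) \<le> (\<Sum>n. x ^ n /\<^sub>R fact n)"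
    using x by (intro sum_le_suminf summable_exp_generic) auto
  thus ?thesis by (simp add: exp_def field_simps)
qed

lemma ctrl_smooth_gauss: "ctrl_smooth (rapid (\<lambda>x. norm (proj S x))) (gauss S)"
proof (rule ctrl_smoothI)
  let ?q = "\<lambda>x. norm (proj S x)"
  have r: "rapid ?q (gauss S)"
    unfolding rapid_def
  proof
    fix k
    have "(1 + ?q x) ^ k * norm (gauss S x) \<le> fact k * exp (3/2)" for x
    proof -
      \<comment> \<open>From (q - 1)^2 \<ge> 0. The quadratic part then cancels against the Gaussian
        and leaves the constant exp (3/2).\<close>
      have "1 + ?q x \<le> 3/2 + (?q x)\<^sup>2 / 2"
        using zero_le_power2[of "?q x - 1"] by (simp add: power2_diff)
      hence "(1 + ?q x) ^ k \<le> fact k * exp (3/2 + (?q x)\<^sup>2 / 2)"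
        using power_le_fact_mult_exp[of "1 + ?q x" k] by (auto intro: order_trans)
      hence "(1 + ?q x) ^ k * exp (- (?q x)\<^sup>2 / 2) \<le> fact k * exp (3/2 + (?q x)\<^sup>2 / 2) * exp (- (?q x)\<^sup>2 / 2)"
        by (intro mult_right_mono) auto
      also have "\<dots> = fact k * exp (3/2)" unfolding mult.assoc exp_add[symmetric] by simp
      finally show ?thesis unfolding gauss_def norm_proj_squared by simp
    qed
    thus "\<exists>C. \<forall>x. (1 + ?q x) ^ k * norm (gauss S x) \<le> C" by blast
  qed
  show "ctrl_diff (rapid ?q) m (gauss S)" for m
  proof (induction m)
    case 0
    show ?case using r gauss_differentiable differentiable_imp_continuous_on by auto
  next
    case (Suc m)
    have "ctrl_diff (rapid ?q) m (partial_deriv k (gauss S))" for k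
      unfolding partial_deriv_gauss
    proof (rule ctrl_diff_mult[OF _ _ _ Suc])
      have "ctrl_diff (slow ?q) m (\<lambda>x. (-1) * coord k x)" if "k \<in> S"
        by (rule ctrl_diff_mult[OF _ _ ctrl_diff_slow_const ctrl_smoothD(1)[OF ctrl_smooth_component[OF that]]])
          (auto intro: slow_add slow_mult)
      thus "ctrl_diff (slow ?q) m (\<lambda>x. if k \<in> S then - coord k x else 0)"
        by (cases "k \<in> S") (simp_all add: ctrl_diff_slow_const)
    qed (auto intro: rapid_add rapid_mult_slow)
    thus ?case using r gauss_differentiable by auto
  qed
qed

lemma gauss_ctrl_smooth: "ctrl_smooth (rapid norm) (gauss UNIV)"
  using ctrl_smooth_gauss[of UNIV] by simp

lemma gauss_schwartz: "gauss UNIV \<in> schwartz_even"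
proof -
  have "even_fun (gauss UNIV)"
    unfolding even_fun_def gauss_def by (auto intro!: sum.cong arg_cong[where f = "\<lambda>x. exp (- x / 2)"])
  thus ?thesis using gauss_ctrl_smooth by (auto simp: schwartz_even_iff)
qed

text \<open>Differentiation replaces the exponent s by s - 1 and brings out 2 s x_i, so the
  induction runs over all real exponents simultaneously. Negative exponents are needed to undo the
  Sobolev weight.\<close>

lemma ctrl_smooth_norm_powr:
  "ctrl_smooth (slow norm) (\<lambda>x :: real^'n. complex_of_real ((1 + (norm x)\<^sup>2) powr s))"
proof (rule ctrl_smoothI)
  let ?W = "\<lambda>s (x :: real^'n). complex_of_real ((1 + (norm x)\<^sup>2) powr s)"
  have pos: "0 < 1 + (norm x)\<^sup>2" for x :: "real^'n" by (simp add: add_pos_nonneg)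
  have sl: "slow norm (?W s)" for s
  proof -
    obtain N :: nat where N: "s \<le> real N" using real_arch_simple by blast
    have "norm (?W s x) \<le> 1 * (1 + norm x) ^ (2 * N)" for x :: "real^'n"
    proof -
      have "(1 + (norm x)\<^sup>2) powr s \<le> (1 + (norm x)\<^sup>2) powr real N"
        using N by (intro powr_mono) auto
      also have "\<dots> = (1 + (norm x)\<^sup>2) ^ N" by (rule powr_realpow[OF pos])
      also have "\<dots> \<le> ((1 + norm x)\<^sup>2) ^ N" by (intro power_mono) (auto simp: power2_sum)
      finally show ?thesis by (simp add: power_mult)
    qed
    thus ?thesis unfolding slow_def by blast
  qed
  have d: "(?W s has_derivative (\<lambda>h. complex_of_real (s * (1 + (norm x)\<^sup>2) powr (s - 1) * (2 * (x \<bullet> h))))) (at x)"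
    for s and x :: "real^'n"
  proof -
    have 1: "((\<lambda>x. 1 + (norm x)\<^sup>2) has_derivative (\<lambda>h. 2 * (x \<bullet> h))) (at x)"
      unfolding power2_norm_eq_inner by (auto intro!: derivative_eq_intros simp: inner_commute)
    have 2: "((\<lambda>z. z powr s) has_derivative (*) (s * (1 + (norm x)\<^sup>2) powr (s - 1))) (at (1 + (norm x)\<^sup>2))"
      using has_real_derivative_powr[OF pos[of x], of s] by (simp add: has_field_derivative_def)
    from bounded_linear.has_derivative[OF bounded_linear_of_real has_derivative_compose[OF 1 2]]
    show ?thesis .
  qed
  have diff: "?W s differentiable_on UNIV" for s
    unfolding differentiable_on_def differentiable_def using d by blast
  have p: "partial_deriv i (?W s) = (\<lambda>x. (complex_of_real (2 * s) * coord i x) * ?W (s - 1) x)" for s i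
    by (auto simp: fun_eq_iff partial_deriv_has_derivative[OF d] inner_axis)
  show "ctrl_diff (slow norm) m (?W s)" for m
  proof (induction m arbitrary: s)
    case 0
    show ?case using sl diff[THEN differentiable_imp_continuous_on] by simp
  next
    case (Suc m)
    have "ctrl_diff (slow norm) m (partial_deriv i (?W s))" for i
      unfolding p by (intro ctrl_diff_mult[of "slow norm" "slow norm" "slow norm"] Suc ctrl_diff_slow_const
          ctrl_smoothD(1)[OF ctrl_smooth_component_norm] slow_add slow_mult) auto
    thus ?case using sl diff by simp
  qed
qed

subsection \<open>Division by a coordinate\<close>

text \<open>The point at parameter t has i-th coordinate a + t (x_i - a), so the segment runs from
  the hyperplane x_i = a to x. The exponent p counts derivatives in direction i, each of which
  contributes a factor t.\<close>

definition slice_average :: "'n \<Rightarrow> real \<Rightarrow> nat \<Rightarrow> (real^'n \<Rightarrow> complex) \<Rightarrow> real^'n \<Rightarrow> complex" where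
  "slice_average i a p v x = (LINT t|restrict_space lborel {0..1}.
     complex_of_real (t ^ p) * v (x + ((t - 1) * (x $ i - a)) *\<^sub>R axis i 1))"

lemma space_unit_interval: "space (restrict_space lborel {0..1::real}) = {0..1}"
  by (simp add: space_restrict_space)

lemma integrable_unit_interval_const: "integrable (restrict_space lborel {0..1::real}) (\<lambda>t. C::real)"
  by (simp add: integrable_restrict_space)

lemma measurable_unit_interval:
  "continuous_on UNIV f \<Longrightarrow> f \<in> borel_measurable (restrict_space lborel {0..1::real})"
  for f :: "real \<Rightarrow> complex"
  by (intro measurable_restrict_space1) (simp add: borel_measurable_continuous_onI)

lemma slice_continuous:
  fixes v :: "real^'n \<Rightarrow> complex"
  assumes "continuous_on UNIV v"
  shows "continuous_on UNIV (\<lambda>t. complex_of_real (t ^ p) * v (x + ((t - 1) * (x $ i - a)) *\<^sub>R axis i 1))"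
    and "continuous_on UNIV (\<lambda>x. complex_of_real (t ^ p) * v (x + ((t - 1) * (x $ i - a)) *\<^sub>R axis i 1))"
  by (intro continuous_intros continuous_on_compose2[OF assms] subset_UNIV)+

lemma norm_integral_unit_interval_le:
  fixes f :: "real \<Rightarrow> complex"
  assumes "\<And>t. t \<in> {0..1} \<Longrightarrow> norm (f t) \<le> C" "0 \<le> C"
  shows "norm (LINT t|restrict_space lborel {0..1}. f t) \<le> C"
proof (cases "integrable (restrict_space lborel {0..1::real}) f")
  case True
  have "norm (LINT t|restrict_space lborel {0..1}. f t) \<le> (LINT t|restrict_space lborel {0..1::real}. C)"
    by (rule order_trans[OF integral_norm_bound integral_mono])
      (use True assms integrable_unit_interval_const in \<open>auto simp: space_unit_interval\<close>)
  also have "\<dots> = C" by (simp add: measure_restrict_space space_unit_interval)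
  finally show ?thesis .
qed (use assms in \<open>simp add: not_integrable_integral_eq\<close>)

lemma slice_average_bounded_continuous:
  fixes v :: "real^'n \<Rightarrow> complex"
  assumes v: "continuous_on UNIV v" "bounded_fun v"
  shows "continuous_on UNIV (slice_average i a p v)" "bounded_fun (slice_average i a p v)"
proof -
  obtain C where C: "\<And>x. norm (v x) \<le> C" using v(2) unfolding bounded_fun_def by blast
  have C0: "0 \<le> C" using order_trans[OF norm_ge_zero C] .
  have b: "norm (complex_of_real (t ^ p) * v y) \<le> C" if "t \<in> {0..1}" for t y
  proof -
    have "norm (complex_of_real (t ^ p) * v y) \<le> 1 * C"
      unfolding norm_mult norm_of_real using that C0 by (intro mult_mono C) (auto simp: power_le_one)
    thus ?thesis by simp
  qed
  show "continuous_on UNIV (slice_average i a p v)"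
    unfolding slice_average_def[abs_def]
    by (rule continuous_on_integral_dominated[where g = "\<lambda>t. C"])
      (use b slice_continuous[OF v(1)] in \<open>auto simp: space_unit_interval
        intro!: integrable_unit_interval_const measurable_unit_interval\<close>)
  have "norm (slice_average i a p v x) \<le> C" for x
    unfolding slice_average_def by (rule norm_integral_unit_interval_le[OF b C0])
  thus "bounded_fun (slice_average i a p v)" unfolding bounded_fun_def by blast
qed

text \<open>The chain rule multiplies a derivative in direction i by t and leaves the other
  directions unchanged, so the family is closed under differentiation. The domination uses that h is
  mapped to a vector of norm at most 2 |h|.\<close>

lemma slice_average_deriv:
  fixes v :: "real^'n \<Rightarrow> complex"
  assumes v: "ctrl_smooth bounded_fun v"
  shows "slice_average i a p v differentiable_on UNIV"
    and "partial_deriv k (slice_average i a p v)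
       = slice_average i a (if k = i then Suc p else p) (partial_deriv k v)"
proof -
  let ?M = "restrict_space lborel {0..1::real}"
  let ?P = "\<lambda>t x. x + ((t - 1) * (x $ i - a)) *\<^sub>R (axis i 1 :: real^'n)"
  let ?L = "\<lambda>t h. h + ((t - 1) * h $ i) *\<^sub>R (axis i 1 :: real^'n)"
  have cv: "continuous_on UNIV v" using ctrl_smoothD(4)[OF v] .
  have dv: "v differentiable_on UNIV" using ctrl_smoothD(3)[OF v] .
  have cdv: "continuous_on UNIV (partial_deriv j v)" for j using ctrl_smoothD(4)[OF ctrl_smoothD(5)[OF v]] .
  have "\<exists>C. \<forall>x. norm (partial_deriv j v x) \<le> C" for j
    using ctrl_smoothD(2)[OF ctrl_smoothD(5)[OF v]] unfolding bounded_fun_def by blast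
  then obtain C where C: "\<And>j x. norm (partial_deriv j v x) \<le> C j" by metis
  obtain C' where C': "\<And>x. norm (v x) \<le> C'" using ctrl_smoothD(2)[OF v] unfolding bounded_fun_def by blast
  let ?D = "\<lambda>t x h. complex_of_real (t ^ p) * (\<Sum>j\<in>UNIV. (?L t h $ j) *\<^sub>R partial_deriv j v (?P t x))"
  have der: "((\<lambda>x. LINT t|?M. complex_of_real (t ^ p) * v (?P t x)) has_derivative (\<lambda>h. LINT t|?M. ?D t x h)) (at x)" for x
  proof (rule has_derivative_integral[where S = UNIV and g = "\<lambda>t. \<Sum>j\<in>UNIV. 2 * C j"])
    fix y
    show "integrable ?M (\<lambda>t. complex_of_real (t ^ p) * v (?P t y))"
    proof (rule Bochner_Integration.integrable_bound[OF integrable_unit_interval_const[of C']])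
      show "(\<lambda>t. complex_of_real (t ^ p) * v (?P t y)) \<in> borel_measurable ?M"
        by (intro measurable_unit_interval slice_continuous cv)
      have "norm (complex_of_real (t ^ p) * v (?P t y)) \<le> 1 * C'" if "t \<in> {0..1}" for t
        unfolding norm_mult norm_of_real using that by (intro mult_mono C') (auto simp: power_le_one)
      thus "AE t in ?M. norm (complex_of_real (t ^ p) * v (?P t y)) \<le> norm C'"
        by (intro AE_I2) (auto simp: space_unit_interval intro: order_trans[OF _ abs_ge_self])
    qed
  next
    fix t y
    have 1: "(?P t has_derivative ?L t) (at y)"
      by (auto intro!: derivative_eq_intros bounded_linear.has_derivative[OF bounded_linear_vec_nth])
    have 2: "(v has_derivative (\<lambda>h. \<Sum>j\<in>UNIV. (h $ j) *\<^sub>R partial_deriv j v (?P t y))) (at (?P t y))"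
      by (rule has_derivative_partials[OF differentiable_on_UNIV_at[OF dv]])
    from has_derivative_mult_right[OF has_derivative_compose[OF 1 2]]
    show "((\<lambda>x. complex_of_real (t ^ p) * v (?P t x)) has_derivative ?D t y) (at y)" by simp
  next
    fix t y and h :: "real^'n" assume t: "t \<in> space ?M"
    hence t01: "0 \<le> t" "t \<le> 1" by (auto simp: space_unit_interval)
    have "norm (?L t h) \<le> norm h + \<bar>t - 1\<bar> * \<bar>h $ i\<bar>"
      using norm_triangle_ineq[of h "((t - 1) * h $ i) *\<^sub>R axis i 1"] by (simp add: abs_mult norm_axis_1)
    also have "\<bar>t - 1\<bar> * \<bar>h $ i\<bar> \<le> 1 * norm h"
      using t01 component_le_norm_cart[of h i] by (intro mult_mono) auto
    finally have L: "norm (?L t h) \<le> 2 * norm h" by simp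
    have "norm (?D t y h) \<le> 1 * norm (\<Sum>j\<in>UNIV. (?L t h $ j) *\<^sub>R partial_deriv j v (?P t y))"
      unfolding norm_mult norm_of_real using t01 by (intro mult_right_mono) (auto simp: power_le_one)
    also have "\<dots> \<le> (\<Sum>j\<in>UNIV. (2 * norm h) * C j)"
      unfolding mult_1
    proof (rule sum_norm_le)
      fix j
      have "\<bar>?L t h $ j\<bar> \<le> 2 * norm h" using component_le_norm_cart[of "?L t h" j] L by linarith
      thus "norm ((?L t h $ j) *\<^sub>R partial_deriv j v (?P t y)) \<le> (2 * norm h) * C j"
        unfolding norm_scaleR by (intro mult_mono C) auto
    qed
    also have "\<dots> = (\<Sum>j\<in>UNIV. 2 * C j) * norm h"
      unfolding sum_distrib_right by (intro sum.cong) (auto simp: mult_ac)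
    finally show "norm (?D t y h) \<le> (\<Sum>j\<in>UNIV. 2 * C j) * norm h" .
  next
    fix h
    show "(\<lambda>t. ?D t x h) \<in> borel_measurable ?M"
      by (intro measurable_unit_interval continuous_intros continuous_on_compose2[OF cdv] subset_UNIV)
  qed (auto intro: integrable_unit_interval_const)
  show "slice_average i a p v differentiable_on UNIV"
    unfolding differentiable_on_def differentiable_def slice_average_def[abs_def]
    using has_derivative_at_withinI[OF der] by blast
  have "partial_deriv k (slice_average i a p v) x
       = slice_average i a (if k = i then Suc p else p) (partial_deriv k v) x" for x
  proof -
    have "(\<Sum>j\<in>UNIV. (?L t (axis k 1) $ j) *\<^sub>R partial_deriv j v y)
      = (\<Sum>j\<in>UNIV. if j = k then (if k = i then t else 1) *\<^sub>R partial_deriv j v y else 0)" for t y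
      by (intro sum.cong) (auto simp: axis_def)
    hence "?D t x (axis k 1) = complex_of_real (t ^ (if k = i then Suc p else p)) * partial_deriv k v (?P t x)" for t
      by (simp add: scaleR_conv_of_real)
    thus ?thesis unfolding slice_average_def[abs_def] partial_deriv_has_derivative[OF der] by simp
  qed
  thus "partial_deriv k (slice_average i a p v)
       = slice_average i a (if k = i then Suc p else p) (partial_deriv k v)" by blast
qed

lemma ctrl_smooth_slice_average:
  assumes "ctrl_smooth bounded_fun v"
  shows "ctrl_smooth bounded_fun (slice_average i a p v)"
proof (rule ctrl_smoothI)
  show "ctrl_diff bounded_fun m (slice_average i a p v)" for m
    using assms
  proof (induction m arbitrary: p v)
    case 0
    thus ?case by (simp add: slice_average_bounded_continuous ctrl_smoothD(2,4)[OF 0])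
  next
    case (Suc m)
    show ?case
      by (simp add: slice_average_deriv[OF Suc.prems] slice_average_bounded_continuous(2)
          ctrl_smoothD(2,4,5)[OF Suc.prems] Suc.IH)
  qed
qed

text \<open>The fundamental theorem of calculus on the segment, whose starting point lies on the
  hyperplane where f vanishes. The formula has no division, so it defines the quotient across the
  hyperplane as well.\<close>

lemma slice_average_eq:
  fixes f :: "real^'n \<Rightarrow> complex"
  assumes f: "f differentiable_on UNIV" "continuous_on UNIV (partial_deriv i f)"
    and zero: "\<And>x. x $ i = a \<Longrightarrow> f x = 0"
  shows "f x = complex_of_real (x $ i - a) * slice_average i a 0 (partial_deriv i f) x"
proof -
  let ?D = "partial_deriv i"
  let ?P = "\<lambda>t. x + ((t - 1) * (x $ i - a)) *\<^sub>R (axis i 1 :: real^'n)"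
  have d: "((\<lambda>t. f (?P t)) has_vector_derivative (x $ i - a) *\<^sub>R ?D f (?P t)) (at t)" for t
  proof -
    have 1: "((\<lambda>t. (t - 1) * (x $ i - a)) has_vector_derivative (x $ i - a)) (at t)"
      by (auto intro!: derivative_eq_intros simp: has_real_derivative_iff_has_vector_derivative[symmetric])
    from vector_diff_chain_at[OF 1 has_vector_derivative_along_axis[OF f(1)]]
    show ?thesis by (simp add: comp_def)
  qed
  have c: "continuous_on UNIV (\<lambda>t. (x $ i - a) *\<^sub>R ?D f (?P t))"
    by (intro continuous_intros continuous_on_compose2[OF f(2)] subset_UNIV)
  have "(LINT t|lborel. indicator {0..1} t *\<^sub>R ((x $ i - a) *\<^sub>R ?D f (?P t))) = f (?P 1) - f (?P 0)"
    by (rule integral_FTC_atLeastAtMost)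
      (auto intro: has_vector_derivative_at_within[OF d] continuous_on_subset[OF c])
  moreover have "f (?P 0) = 0" by (rule zero) (simp add: axis_def)
  ultimately have "f x = (LINT t|restrict_space lborel {0..1}. (x $ i - a) *\<^sub>R ?D f (?P t))"
    by (subst integral_restrict_space) simp_all
  thus ?thesis unfolding slice_average_def by (simp add: scaleR_conv_of_real)
qed

text \<open>The quotient is an average of \<open>partial_deriv i f\<close>. At distance at least 1
  from the hyperplane it is dominated by f itself; closer to it, the whole segment stays within
  distance 1 of x and inherits the decay of the derivative. Decay of higher derivatives follows from
  \<open>ctrl_smooth_rapidI\<close>.\<close>

lemma ctrl_smooth_divide:
  fixes f :: "real^'n \<Rightarrow> complex"
  assumes f: "ctrl_smooth (rapid norm) f" and zero: "\<And>x. x $ i = a \<Longrightarrow> f x = 0"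
  obtains g where "ctrl_smooth (rapid norm) g" "\<And>x. f x = complex_of_real (x $ i - a) * g x"
proof -
  let ?D = "partial_deriv i"
  let ?g = "slice_average i a 0 (?D f)"
  let ?P = "\<lambda>x t. x + ((t - 1) * (x $ i - a)) *\<^sub>R (axis i 1 :: real^'n)"
  have df: "ctrl_smooth (rapid norm) (?D f)" using ctrl_smoothD(5)[OF f] .
  have eq: "f x = complex_of_real (x $ i - a) * ?g x" for x
    by (intro slice_average_eq ctrl_smoothD(3)[OF f] ctrl_smoothD(4)[OF df] zero)
  have "ctrl_smooth bounded_fun ?g"
    by (intro ctrl_smooth_slice_average ctrl_smooth_mono[OF df] rapid_imp_bounded)
  moreover have "rapid norm ?g"
    unfolding rapid_def
  proof
    fix k
    obtain C1 where C1: "\<And>x. (1 + norm x) ^ k * norm (f x) \<le> C1"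
      using ctrl_smoothD(2)[OF f] unfolding rapid_def by blast
    obtain C2 where C2: "\<And>x. (1 + norm x) ^ k * norm (?D f x) \<le> C2"
      using ctrl_smoothD(2)[OF df] unfolding rapid_def by blast
    have C10: "0 \<le> C1" using order_trans[OF _ C1[of 0]] by simp
    have C20: "0 \<le> C2" using order_trans[OF _ C2[of 0]] by simp
    have "(1 + norm x) ^ k * norm (?g x) \<le> C1 + 2 ^ k * C2" for x
    proof (cases "1 \<le> \<bar>x $ i - a\<bar>")
      case True
      have "1 * norm (?g x) \<le> \<bar>x $ i - a\<bar> * norm (?g x)" using True by (intro mult_right_mono) auto
      also have "\<dots> = norm (f x)" unfolding eq[of x] by (simp only: norm_mult norm_of_real)
      finally have "(1 + norm x) ^ k * norm (?g x) \<le> (1 + norm x) ^ k * norm (f x)"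
        by (intro mult_left_mono) auto
      thus ?thesis using C1[of x] C20 by (smt (verit) mult_nonneg_nonneg zero_le_power)
    next
      case False
      let ?B = "2 ^ k * C2 / (1 + norm x) ^ k"
      have p: "0 < (1 + norm x) ^ k" by (intro zero_less_power add_pos_nonneg) auto
      have "norm (?g x) \<le> ?B"
        unfolding slice_average_def
      proof (rule norm_integral_unit_interval_le)
        fix t :: real assume t: "t \<in> {0..1}"
        let ?y = "?P x t"
        have "norm x \<le> norm ?y + norm (((t - 1) * (x $ i - a)) *\<^sub>R (axis i 1 :: real^'n))"
          using norm_triangle_ineq4[of ?y "((t - 1) * (x $ i - a)) *\<^sub>R axis i 1"] by simp
        also have "norm (((t - 1) * (x $ i - a)) *\<^sub>R (axis i 1 :: real^'n)) = \<bar>t - 1\<bar> * \<bar>x $ i - a\<bar>"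
          by (simp add: abs_mult norm_axis_1)
        finally have A: "norm x \<le> norm ?y + \<bar>t - 1\<bar> * \<bar>x $ i - a\<bar>" .
        have B: "\<bar>t - 1\<bar> * \<bar>x $ i - a\<bar> \<le> 1 * 1" using t False by (intro mult_mono) auto
        have "1 + n \<le> 2 * (1 + l)" if "n \<le> l + d" "d \<le> 1 * 1" "0 \<le> l" for n l d :: real
          using that by simp
        from this[OF A B norm_ge_zero] have "1 + norm x \<le> 2 * (1 + norm ?y)" .
        hence "(1 + norm x) ^ k * norm (?D f ?y) \<le> 2 ^ k * C2"
          by (rule weight_power_mult_le[OF _ _ norm_ge_zero C2]) simp
        thus "norm (complex_of_real (t ^ 0) * ?D f ?y) \<le> ?B"
          using p by (simp add: pos_le_divide_eq mult.commute)
      qed (use C20 in auto)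
      hence "(1 + norm x) ^ k * norm (?g x) \<le> 2 ^ k * C2"
        using p by (simp add: pos_le_divide_eq mult.commute)
      thus ?thesis using C10 by simp
    qed
    thus "\<exists>C. \<forall>x. (1 + norm x) ^ k * norm (?g x) \<le> C" by blast
  qed
  ultimately show ?thesis using that[OF ctrl_smooth_rapidI eq] by blast
qed

section \<open>Reflections in the coordinate hyperplanes and division of even functions\<close>

definition flip :: "'n \<Rightarrow> real^'n \<Rightarrow> real^'n" where
  "flip i x = (\<chi> k. if k = i then - x $ k else x $ k)"

lemma flip_component: "flip i x $ k = (if k = i then - x $ k else x $ k)"
  by (simp add: flip_def)

lemma flip_eq: "x $ i = 0 \<Longrightarrow> flip i x = x"
  by (simp add: vec_eq_iff flip_component)

lemma even_fun_iff: "even_fun f \<longleftrightarrow> (\<forall>i x. f (flip i x) = f x)"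
  by (simp add: even_fun_def flip_def)

lemma linear_flip: "linear (flip i)"
  by (rule linearI) (simp_all add: vec_eq_iff flip_component)

lemma bounded_linear_flip: "bounded_linear (flip i)"
  using linear_flip by (simp add: linear_conv_bounded_linear)

lemma continuous_flip: "continuous_on UNIV g \<Longrightarrow> continuous_on UNIV (\<lambda>x. g (flip i x))"
  by (rule continuous_on_compose2[OF _ linear_continuous_on[OF bounded_linear_flip]]) auto

text \<open>A line in direction i meets the exceptional set in at most two points, so its complement
  is dense. This carries symmetries and identities through a division, with b = 0 or b =
  a^2.\<close>

lemma continuous_eq_off_hyperplanes:
  fixes g h :: "real^'n \<Rightarrow> complex"
  assumes c: "continuous_on UNIV g" "continuous_on UNIV h" and eq: "\<And>x. (x $ i)\<^sup>2 \<noteq> b \<Longrightarrow> g x = h x"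
  shows "g x = h x"
proof (rule ccontr)
  assume "g x \<noteq> h x"
  have "open {x. g x \<noteq> h x}" using c by (intro open_Collect_neq) auto
  then obtain e where e: "e > 0" "\<And>y. dist y x < e \<Longrightarrow> g y \<noteq> h y"
    using \<open>g x \<noteq> h x\<close> unfolding open_dist by auto
  have "{t. (x $ i + t)\<^sup>2 = b} \<subseteq> {sqrt b - x $ i, - sqrt b - x $ i}"
  proof
    fix t assume "t \<in> {t. (x $ i + t)\<^sup>2 = b}"
    hence "sqrt b = \<bar>x $ i + t\<bar>" by auto
    thus "t \<in> {sqrt b - x $ i, - sqrt b - x $ i}" by auto
  qed
  hence "finite {t. (x $ i + t)\<^sup>2 = b}" by (rule finite_subset) simp
  moreover have "infinite {0<..<e}" using e(1) by simp
  ultimately have "\<not> {0<..<e} \<subseteq> {t. (x $ i + t)\<^sup>2 = b}" using finite_subset by blast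
  then obtain t where t: "t \<in> {0<..<e}" "(x $ i + t)\<^sup>2 \<noteq> b" by blast
  have "g (x + t *\<^sub>R axis i 1) = h (x + t *\<^sub>R axis i 1)" using t(2) by (intro eq) (simp add: axis_def)
  moreover have "dist (x + t *\<^sub>R axis i 1) x < e" using t(1) by (simp add: dist_norm norm_axis_1)
  ultimately show False using e(2) by blast
qed

lemma partial_deriv_flip:
  assumes f: "even_fun f" "f differentiable_on UNIV"
  shows "partial_deriv i f (flip k x) = (if k = i then -1 else 1) * partial_deriv i f x"
proof -
  obtain f' where f': "(f has_derivative f') (at (flip k x))"
    using differentiable_on_UNIV_at[OF f(2)] differentiable_def by blast
  have "(\<lambda>x. f (flip k x)) = f" using f(1) by (simp add: even_fun_iff)
  hence "(f has_derivative (\<lambda>h. f' (flip k h))) (at x)"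
    using has_derivative_compose[OF bounded_linear_imp_has_derivative[OF bounded_linear_flip[of k]] f'] by simp
  hence "partial_deriv i f x = f' (flip k (axis i 1))" by (rule partial_deriv_has_derivative)
  also have "flip k (axis i 1) = (if k = i then - axis i 1 else axis i 1)"
    by (auto simp: vec_eq_iff flip_component axis_def)
  finally show ?thesis using linear_neg[OF has_derivative_linear[OF f']]
    by (auto simp: partial_deriv_has_derivative[OF f'])
qed

text \<open>The derivative is odd in x_i and therefore vanishes on x_i = 0; dividing by x_i restores
  evenness. The quotient g is the nonsingular substitute for the term d_i f / x_i of the Bessel
  operator.\<close>

lemma schwartz_divide_deriv:
  assumes f: "f \<in> schwartz_even"
  obtains g where "g \<in> schwartz_even" "\<And>x. partial_deriv i f x = coord i x * g x"
proof -
  have ev: "even_fun f" and sm: "ctrl_smooth (rapid norm) f" using f by (auto simp: schwartz_even_iff)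
  note fl = partial_deriv_flip[OF ev ctrl_smoothD(3)[OF sm], of i]
  have zero: "partial_deriv i f x = 0" if "x $ i = 0" for x
    using fl[of i x] that by (simp add: flip_eq)
  obtain g where g: "ctrl_smooth (rapid norm) g" "\<And>x. partial_deriv i f x = complex_of_real (x $ i - 0) * g x"
    using ctrl_smooth_divide[OF ctrl_smoothD(5)[OF sm] zero] by blast
  have cg: "continuous_on UNIV g" using ctrl_smoothD(4)[OF g(1)] .
  have "g (flip k x) = g x" for k x
  proof (rule continuous_eq_off_hyperplanes[where i = i and b = 0])
    show "continuous_on UNIV (\<lambda>x. g (flip k x))" using cg by (rule continuous_flip)
    show "g (flip k x) = g x" if "(x $ i)\<^sup>2 \<noteq> 0" for x
      using fl[of k x] that unfolding g(2) by (auto simp: flip_component split: if_splits)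
  qed (rule cg)
  hence "g \<in> schwartz_even" using g(1) by (simp add: schwartz_even_iff even_fun_iff)
  thus ?thesis using that g(2) by simp
qed

text \<open>Division by x_i - a is followed by division by x_i + a. The first quotient vanishes on
  x_i = - a because f does so by evenness if a \<noteq> 0, and because that quotient is odd in x_i
  if a = 0.\<close>

lemma schwartz_divide_square:
  assumes f: "f \<in> schwartz_even" and zero: "\<And>x. x $ i = a \<Longrightarrow> f x = 0"
  obtains g where "g \<in> schwartz_even" "\<And>x. f x = complex_of_real ((x $ i)\<^sup>2 - a\<^sup>2) * g x"
proof -
  have ev: "\<And>k x. f (flip k x) = f x" and sm: "ctrl_smooth (rapid norm) f"
    using f by (auto simp: schwartz_even_iff even_fun_iff)
  obtain g1 where g1: "ctrl_smooth (rapid norm) g1" "\<And>x. f x = complex_of_real (x $ i - a) * g1 x"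
    using ctrl_smooth_divide[OF sm zero] by blast
  have cg1: "continuous_on UNIV g1" using ctrl_smoothD(4)[OF g1(1)] .
  have zero1: "g1 x = 0" if x: "x $ i = - a" for x
  proof (cases "a = 0")
    case False
    have "f x = f (flip i x)" by (simp add: ev)
    also have "\<dots> = 0" using x by (intro zero) (simp add: flip_component)
    finally show ?thesis using g1(2)[of x] x False by simp
  next
    case True
    have "g1 (flip i x) = - g1 x"
    proof (rule continuous_eq_off_hyperplanes[where i = i and b = 0])
      show "continuous_on UNIV (\<lambda>x. g1 (flip i x))" using cg1 by (rule continuous_flip)
      show "continuous_on UNIV (\<lambda>x. - g1 x)" using cg1 by (intro continuous_intros)
      show "g1 (flip i x) = - g1 x" if "(x $ i)\<^sup>2 \<noteq> 0" for x
      proof -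
        have "coord i x * (- g1 (flip i x)) = coord i x * g1 x"
          using ev[of i x] True unfolding g1(2) by (simp add: flip_component)
        hence "- g1 (flip i x) = g1 x" using that by (subst (asm) mult_left_cancel) auto
        thus ?thesis by (metis minus_minus)
      qed
    qed
    thus ?thesis using x True by (simp add: flip_eq)
  qed
  obtain g where g: "ctrl_smooth (rapid norm) g" "\<And>x. g1 x = complex_of_real (x $ i - (- a)) * g x"
    using ctrl_smooth_divide[OF g1(1) zero1] by blast
  have cg: "continuous_on UNIV g" using ctrl_smoothD(4)[OF g(1)] .
  have eq: "f x = complex_of_real ((x $ i)\<^sup>2 - a\<^sup>2) * g x" for x
    unfolding g1(2) g(2) by (simp add: power2_eq_square algebra_simps)
  have "g (flip k x) = g x" for k x
  proof (rule continuous_eq_off_hyperplanes[where i = i and b = "a\<^sup>2"])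
    show "continuous_on UNIV (\<lambda>x. g (flip k x))" using cg by (rule continuous_flip)
    show "g (flip k x) = g x" if "(x $ i)\<^sup>2 \<noteq> a\<^sup>2" for x
    proof -
      have "(flip k x $ i)\<^sup>2 = (x $ i)\<^sup>2" by (simp add: flip_component)
      hence "complex_of_real ((x $ i)\<^sup>2 - a\<^sup>2) * g (flip k x) = complex_of_real ((x $ i)\<^sup>2 - a\<^sup>2) * g x"
        using ev[of k x] unfolding eq by simp
      moreover have "complex_of_real ((x $ i)\<^sup>2 - a\<^sup>2) \<noteq> 0" using that by (simp only: of_real_eq_0_iff)
      ultimately show ?thesis by simp
    qed
  qed (rule cg)
  hence "g \<in> schwartz_even" using g(1) by (simp add: schwartz_even_iff even_fun_iff)
  thus ?thesis using that eq by blast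
qed

subsection \<open>Bessel kernels\<close>

text \<open>The orders \<beta> make the family closed, up to coordinate factors, under
  differentiation in either argument. The index \<gamma> is independent of that of the measure,
  since raised kernels are integrated against the original measure.\<close>

definition bessel_kernel :: "real^'n \<Rightarrow> ('n \<Rightarrow> nat) \<Rightarrow> real^'n \<Rightarrow> real^'n \<Rightarrow> complex" where
  "bessel_kernel \<gamma> \<beta> \<xi> x = complex_of_real (\<Prod>i\<in>UNIV. bessel_jd (\<beta> i) (\<gamma> $ i) (\<xi> $ i * x $ i))"

lemma bessel_kernel_commute: "bessel_kernel \<gamma> \<beta> \<xi> x = bessel_kernel \<gamma> \<beta> x \<xi>"
  by (simp add: bessel_kernel_def mult.commute)

lemma norm_bessel_kernel_le:
  assumes "admissible \<gamma>"
  shows "norm (bessel_kernel \<gamma> \<beta> \<xi> x) \<le> (\<Prod>i\<in>UNIV. 2 ^ \<beta> i)"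
  unfolding bessel_kernel_def norm_of_real abs_prod using assms
  by (intro prod_mono) (auto intro: bessel_jd_bound)

lemma bessel_kernel_has_derivative:
  fixes \<gamma> :: "real^'n"
  assumes \<gamma>: "admissible \<gamma>"
  shows "((\<lambda>\<xi>. bessel_kernel \<gamma> \<beta> \<xi> x) has_derivative
    (\<lambda>h. \<Sum>i\<in>UNIV. (h $ i) *\<^sub>R (coord i x * bessel_kernel \<gamma> (\<beta>(i := Suc (\<beta> i))) \<xi> x))) (at \<xi>)"
proof -
  let ?J = "\<lambda>i \<xi>. bessel_jd (\<beta> i) (\<gamma> $ i) (\<xi> $ i * x $ i)"
  let ?J' = "\<lambda>i h. (h $ i * x $ i) * bessel_jd (Suc (\<beta> i)) (\<gamma> $ i) (\<xi> $ i * x $ i)"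
  have J: "(?J i has_derivative ?J' i) (at \<xi>)" for i
  proof -
    have 1: "((\<lambda>\<xi>. \<xi> $ i * x $ i) has_derivative (\<lambda>h. h $ i * x $ i)) (at \<xi>)"
      by (intro bounded_linear_imp_has_derivative bounded_linear_compose[OF bounded_linear_mult_left]
          bounded_linear_vec_nth)
    have 2: "(bessel_jd (\<beta> i) (\<gamma> $ i) has_derivative (*) (bessel_jd (Suc (\<beta> i)) (\<gamma> $ i) (\<xi> $ i * x $ i)))
      (at (\<xi> $ i * x $ i))"
      using bessel_jd_deriv[of "\<gamma> $ i" "\<beta> i" "\<xi> $ i * x $ i"] \<gamma> by (simp add: has_field_derivative_def)
    from has_derivative_compose[OF 1 2] show ?thesis by (simp add: mult.commute)
  qed
  have "((\<lambda>\<xi>. \<Prod>i\<in>UNIV. ?J i \<xi>) has_derivative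
     (\<lambda>h. \<Sum>i\<in>UNIV. ?J' i h * (\<Prod>j\<in>UNIV - {i}. ?J j \<xi>))) (at \<xi>)"
    by (intro has_derivative_prod J)
  from bounded_linear.has_derivative[OF bounded_linear_of_real this]
  have "((\<lambda>\<xi>. bessel_kernel \<gamma> \<beta> \<xi> x) has_derivative
     (\<lambda>h. complex_of_real (\<Sum>i\<in>UNIV. ?J' i h * (\<Prod>j\<in>UNIV - {i}. ?J j \<xi>)))) (at \<xi>)"
    unfolding bessel_kernel_def .
  moreover have "complex_of_real (\<Sum>i\<in>UNIV. ?J' i h * (\<Prod>j\<in>UNIV - {i}. ?J j \<xi>))
    = (\<Sum>i\<in>UNIV. (h $ i) *\<^sub>R (coord i x * bessel_kernel \<gamma> (\<beta>(i := Suc (\<beta> i))) \<xi> x))" for h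
  proof -
    have "bessel_kernel \<gamma> (\<beta>(i := Suc (\<beta> i))) \<xi> x = complex_of_real
       (bessel_jd (Suc (\<beta> i)) (\<gamma> $ i) (\<xi> $ i * x $ i) * (\<Prod>j\<in>UNIV - {i}. ?J j \<xi>))" for i
      unfolding bessel_kernel_def by (subst prod.remove[of _ i]) auto
    thus ?thesis by (simp add: scaleR_conv_of_real mult.assoc)
  qed
  ultimately show ?thesis by simp
qed

lemma bessel_kernel_differentiable:
  "admissible \<gamma> \<Longrightarrow> bessel_kernel \<gamma> \<beta> \<xi> differentiable_on UNIV"
  unfolding differentiable_on_def differentiable_def
  using bessel_kernel_has_derivative unfolding bessel_kernel_commute[of _ _ \<xi>] by blast

lemma partial_deriv_bessel_kernel:
  assumes \<gamma>: "admissible \<gamma>"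
  shows "partial_deriv i (bessel_kernel \<gamma> \<beta> \<xi>) x
    = coord i \<xi> * bessel_kernel \<gamma> (\<beta>(i := Suc (\<beta> i))) \<xi> x"
proof -
  have eq: "bessel_kernel \<gamma> \<beta> \<xi> = (\<lambda>x. bessel_kernel \<gamma> \<beta> x \<xi>)"
    using bessel_kernel_commute by blast
  have "partial_deriv i (bessel_kernel \<gamma> \<beta> \<xi>) x
    = (\<Sum>j\<in>UNIV. (axis i 1 $ j) *\<^sub>R (coord j \<xi> * bessel_kernel \<gamma> (\<beta>(j := Suc (\<beta> j))) x \<xi>))"
    unfolding eq by (rule partial_deriv_has_derivative[OF bessel_kernel_has_derivative[OF \<gamma>]])
  also have "\<dots> = (\<Sum>j\<in>UNIV. if j = i then coord j \<xi> * bessel_kernel \<gamma> (\<beta>(j := Suc (\<beta> j))) x \<xi> else 0)"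
    by (intro sum.cong) (auto simp: axis_def)
  finally show ?thesis by (simp add: bessel_kernel_commute[of _ _ x])
qed

lemma ctrl_smooth_bessel_kernel:
  assumes \<gamma>: "admissible \<gamma>"
  shows "ctrl_smooth bounded_fun (bessel_kernel \<gamma> \<beta> \<xi>)"
proof (rule ctrl_smoothI)
  have b: "bounded_fun (bessel_kernel \<gamma> \<beta> \<xi>)" for \<beta>
    unfolding bounded_fun_def using norm_bessel_kernel_le[OF \<gamma>] by blast
  show "ctrl_diff bounded_fun m (bessel_kernel \<gamma> \<beta> \<xi>)" for m
  proof (induction m arbitrary: \<beta>)
    case 0
    show ?case using b bessel_kernel_differentiable[OF \<gamma>] by (simp add: differentiable_imp_continuous_on)
  next
    case (Suc m)
    have p: "partial_deriv i (bessel_kernel \<gamma> \<beta> \<xi>)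
      = (\<lambda>x. coord i \<xi> * bessel_kernel \<gamma> (\<beta>(i := Suc (\<beta> i))) \<xi> x)" for i
      using partial_deriv_bessel_kernel[OF \<gamma>] by blast
    have "ctrl_diff bounded_fun m (partial_deriv i (bessel_kernel \<gamma> \<beta> \<xi>))" for i
      unfolding p by (intro ctrl_diff_mult[of bounded_fun bounded_fun bounded_fun] bounded_fun_add
          bounded_fun_mult Suc ctrl_smoothD(1)[OF ctrl_smooth_const])
    thus ?case using b bessel_kernel_differentiable[OF \<gamma>] by simp
  qed
qed

lemma bessel_kernel_measurable:
  "admissible \<gamma> \<Longrightarrow> bessel_kernel \<gamma> \<beta> \<xi> \<in> borel_measurable borel"
  using ctrl_smoothD(4)[OF ctrl_smooth_bessel_kernel] by (rule borel_measurable_continuous_onI)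

text \<open>The measure has index \<alpha> and the kernel index \<gamma>;
  \<open>fourier_bessel\<close> is the case \<gamma> = \<alpha>, \<beta> = 0. Derivatives in \<xi>
  stay within this family.\<close>

definition bessel_integral ::
    "real^'n \<Rightarrow> real^'n \<Rightarrow> ('n \<Rightarrow> nat) \<Rightarrow> (real^'n \<Rightarrow> complex) \<Rightarrow> real^'n \<Rightarrow> complex" where
  "bessel_integral \<alpha> \<gamma> \<beta> \<theta> \<xi> = (LINT x|bessel_measure \<alpha>. \<theta> x * bessel_kernel \<gamma> \<beta> \<xi> x)"

lemma fourier_bessel_eq: "fourier_bessel \<alpha> f = bessel_integral \<alpha> \<alpha> (\<lambda>_. 0) f"
  by (simp add: fun_eq_iff fourier_bessel_def bessel_integral_def bessel_kernel_def)

lemma integrable_mult_bessel_kernel: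
  assumes \<gamma>: "admissible \<gamma>" and \<theta>: "integrable (bessel_measure \<alpha>) \<theta>"
  shows "integrable (bessel_measure \<alpha>) (\<lambda>x. \<theta> x * bessel_kernel \<gamma> \<beta> \<xi> x)"
proof (rule Bochner_Integration.integrable_bound[OF integrable_mult_right[OF integrable_norm[OF \<theta>]]])
  let ?M = "bessel_measure \<alpha>"
  show "(\<lambda>x. \<theta> x * bessel_kernel \<gamma> \<beta> \<xi> x) \<in> borel_measurable ?M"
    using \<theta> measurable_bessel_measure[OF bessel_kernel_measurable[OF \<gamma>]]
    by (intro borel_measurable_times) auto
  have "norm (\<theta> x * bessel_kernel \<gamma> \<beta> \<xi> x) \<le> (\<Prod>i\<in>UNIV. 2 ^ \<beta> i) * norm (\<theta> x)" for x
    unfolding norm_mult using norm_bessel_kernel_le[OF \<gamma>, of \<beta> \<xi> x]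
    by (simp add: mult.commute mult_left_mono)
  thus "AE x in ?M. norm (\<theta> x * bessel_kernel \<gamma> \<beta> \<xi> x)
    \<le> norm ((\<Prod>i\<in>UNIV. 2 ^ \<beta> i) * norm (\<theta> x))"
    by (intro AE_I2) (auto intro: order_trans[OF _ abs_ge_self])
qed

lemma integrable_of_moment:
  fixes \<theta> :: "real^'n \<Rightarrow> complex"
  assumes \<theta>: "\<theta> \<in> borel_measurable (bessel_measure \<alpha>)"
    and int: "integrable (bessel_measure \<alpha>) (\<lambda>x. (1 + norm x) ^ m * norm (\<theta> x))"
  shows "integrable (bessel_measure \<alpha>) \<theta>"
proof (rule Bochner_Integration.integrable_bound[OF int \<theta>], rule AE_I2)
  fix x
  have "1 * norm (\<theta> x) \<le> (1 + norm x) ^ m * norm (\<theta> x)" by (intro mult_right_mono one_le_power) auto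
  thus "norm (\<theta> x) \<le> norm ((1 + norm x) ^ m * norm (\<theta> x))" by simp
qed

lemma bessel_integral_bounded_continuous:
  fixes \<alpha> :: "real^'n"
  assumes \<gamma>: "admissible \<gamma>" and \<theta>: "integrable (bessel_measure \<alpha>) \<theta>"
  shows "continuous_on UNIV (bessel_integral \<alpha> \<gamma> \<beta> \<theta>)" "bounded_fun (bessel_integral \<alpha> \<gamma> \<beta> \<theta>)"
proof -
  let ?M = "bessel_measure \<alpha>"
  let ?B = "\<Prod>i\<in>UNIV. 2 ^ \<beta> i"
  have b: "norm (\<theta> x * bessel_kernel \<gamma> \<beta> \<xi> x) \<le> norm (\<theta> x) * ?B" for x \<xi>
    unfolding norm_mult by (intro mult_left_mono norm_bessel_kernel_le \<gamma>) auto
  have g: "integrable ?M (\<lambda>x. norm (\<theta> x) * ?B)" using \<theta> by (intro integrable_mult_left integrable_norm)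
  show "continuous_on UNIV (bessel_integral \<alpha> \<gamma> \<beta> \<theta>)"
    unfolding bessel_integral_def[abs_def]
  proof (rule continuous_on_integral_dominated[OF _ _ b g])
    show "(\<lambda>x. \<theta> x * bessel_kernel \<gamma> \<beta> \<xi> x) \<in> borel_measurable ?M" for \<xi>
      using integrable_mult_bessel_kernel[OF \<gamma> \<theta>] by auto
    show "continuous_on UNIV (\<lambda>\<xi>. \<theta> x * bessel_kernel \<gamma> \<beta> \<xi> x)" for x
      using ctrl_smoothD(4)[OF ctrl_smooth_bessel_kernel[OF \<gamma>], of \<beta> x]
      unfolding bessel_kernel_commute[of _ _ _ x] by (intro continuous_intros)
  qed
  have "norm (bessel_integral \<alpha> \<gamma> \<beta> \<theta> \<xi>) \<le> (LINT x|?M. norm (\<theta> x) * ?B)" for \<xi>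
    unfolding bessel_integral_def
    by (rule order_trans[OF integral_norm_bound integral_mono])
      (use integrable_mult_bessel_kernel[OF \<gamma> \<theta>] g b in auto)
  thus "bounded_fun (bessel_integral \<alpha> \<gamma> \<beta> \<theta>)" unfolding bounded_fun_def by blast
qed

text \<open>A derivative in direction k costs one moment, since it replaces \<theta> by x_k \<theta>
  and increases \<open>\<beta> k\<close>. The last two conclusions are the hypotheses for the next
  derivative, with m in place of \<open>Suc m\<close>.\<close>

lemma bessel_integral_deriv:
  fixes \<alpha> :: "real^'n"
  assumes \<gamma>: "admissible \<gamma>" and \<theta>: "\<theta> \<in> borel_measurable (bessel_measure \<alpha>)"
    and int: "integrable (bessel_measure \<alpha>) (\<lambda>x. (1 + norm x) ^ Suc m * norm (\<theta> x))"
  shows "bessel_integral \<alpha> \<gamma> \<beta> \<theta> differentiable_on UNIV"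
    and "partial_deriv k (bessel_integral \<alpha> \<gamma> \<beta> \<theta>)
      = bessel_integral \<alpha> \<gamma> (\<beta>(k := Suc (\<beta> k))) (\<lambda>x. coord k x * \<theta> x)"
    and "(\<lambda>x. coord k x * \<theta> x) \<in> borel_measurable (bessel_measure \<alpha>)"
    and "integrable (bessel_measure \<alpha>) (\<lambda>x. (1 + norm x) ^ m * norm (coord k x * \<theta> x))"
proof -
  let ?M = "bessel_measure \<alpha>"
  have x\<theta>: "(\<lambda>x. coord k x * \<theta> x) \<in> borel_measurable ?M" for k
    using \<theta> by (intro borel_measurable_times measurable_bessel_measure[of "\<lambda>x. coord k x"]) auto
  have nm: "(\<lambda>x. (1 + norm x) ^ m) \<in> borel_measurable ?M" for m
    by (intro measurable_bessel_measure) measurable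
  have xk: "norm (coord k x * \<theta> x) \<le> (1 + norm x) * norm (\<theta> x)" for x k
    unfolding norm_mult norm_of_real using component_le_norm_cart[of x k] by (intro mult_right_mono) auto
  have int': "integrable ?M (\<lambda>x. (1 + norm x) ^ m * norm (coord k x * \<theta> x))" for k
  proof (rule Bochner_Integration.integrable_bound[OF int])
    show "(\<lambda>x. (1 + norm x) ^ m * norm (coord k x * \<theta> x)) \<in> borel_measurable ?M"
      by (rule borel_measurable_times[OF nm measurable_compose[OF x\<theta> borel_measurable_norm]])
    have "(1 + norm x) ^ m * norm (coord k x * \<theta> x) \<le> (1 + norm x) ^ Suc m * norm (\<theta> x)" for x
      using mult_left_mono[OF xk[of x k], of "(1 + norm x) ^ m"] by (simp add: mult_ac)
    thus "AE x in ?M. norm ((1 + norm x) ^ m * norm (coord k x * \<theta> x))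
      \<le> norm ((1 + norm x) ^ Suc m * norm (\<theta> x))"
      by (intro AE_I2) (simp add: abs_mult)
  qed
  show "(\<lambda>x. coord k x * \<theta> x) \<in> borel_measurable ?M" by (rule x\<theta>)
  show "integrable ?M (\<lambda>x. (1 + norm x) ^ m * norm (coord k x * \<theta> x))" by (rule int')
  let ?\<beta> = "\<lambda>j. \<beta>(j := Suc (\<beta> j))"
  let ?B = "\<lambda>j. \<Prod>i\<in>UNIV. 2 ^ ?\<beta> j i :: real"
  let ?D = "\<lambda>x \<xi> h. \<theta> x * (\<Sum>j\<in>UNIV. (h $ j) *\<^sub>R (coord j x * bessel_kernel \<gamma> (?\<beta> j) \<xi> x))"
  have D: "?D x \<xi> h = (\<Sum>j\<in>UNIV. (h $ j) *\<^sub>R (coord j x * \<theta> x * bessel_kernel \<gamma> (?\<beta> j) \<xi> x))" for x \<xi> h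
    by (simp add: sum_distrib_left mult_ac)
  have i\<theta>: "integrable ?M \<theta>" using \<theta> int by (rule integrable_of_moment)
  have ix\<theta>: "integrable ?M (\<lambda>x. coord j x * \<theta> x)" for j using x\<theta> int' by (rule integrable_of_moment)
  have der: "(bessel_integral \<alpha> \<gamma> \<beta> \<theta> has_derivative (\<lambda>h. LINT x|?M. ?D x \<xi> h)) (at \<xi>)" for \<xi>
    unfolding bessel_integral_def[abs_def]
  proof (rule has_derivative_integral[where S = UNIV and g = "\<lambda>x. \<Sum>j\<in>UNIV. norm (coord j x * \<theta> x) * ?B j"])
    show "integrable ?M (\<lambda>x. \<theta> x * bessel_kernel \<gamma> \<beta> \<xi> x)" for \<xi>
      by (rule integrable_mult_bessel_kernel[OF \<gamma> i\<theta>])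
    show "((\<lambda>\<xi>. \<theta> x * bessel_kernel \<gamma> \<beta> \<xi> x) has_derivative ?D x \<xi>) (at \<xi>)" for x \<xi>
      by (rule has_derivative_mult_right[OF bessel_kernel_has_derivative[OF \<gamma>]])
    show "norm (?D x \<xi> h) \<le> (\<Sum>j\<in>UNIV. norm (coord j x * \<theta> x) * ?B j) * norm h" for x \<xi> h
    proof -
      have "norm (?D x \<xi> h) \<le> (\<Sum>j\<in>UNIV. norm h * (norm (coord j x * \<theta> x) * ?B j))"
        unfolding D
      proof (rule sum_norm_le)
        fix j
        show "norm ((h $ j) *\<^sub>R (coord j x * \<theta> x * bessel_kernel \<gamma> (?\<beta> j) \<xi> x))
          \<le> norm h * (norm (coord j x * \<theta> x) * ?B j)"
          unfolding norm_scaleR norm_mult[of "coord j x * \<theta> x"]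
          by (intro mult_mono component_le_norm_cart norm_bessel_kernel_le \<gamma>) auto
      qed
      thus ?thesis by (simp only: sum_distrib_left mult.commute[of _ "norm h"])
    qed
    show "integrable ?M (\<lambda>x. \<Sum>j\<in>UNIV. norm (coord j x * \<theta> x) * ?B j)"
      by (intro Bochner_Integration.integrable_sum integrable_mult_left integrable_norm ix\<theta>)
    show "(\<lambda>x. ?D x \<xi> h) \<in> borel_measurable ?M" for h
      unfolding D using integrable_mult_bessel_kernel[OF \<gamma> ix\<theta>]
      by (intro borel_measurable_sum borel_measurable_scaleR borel_measurable_const) auto
  qed auto
  show "bessel_integral \<alpha> \<gamma> \<beta> \<theta> differentiable_on UNIV"
    unfolding differentiable_on_def differentiable_def using der by blast
  show "partial_deriv k (bessel_integral \<alpha> \<gamma> \<beta> \<theta>)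
      = bessel_integral \<alpha> \<gamma> (?\<beta> k) (\<lambda>x. coord k x * \<theta> x)"
  proof
    fix \<xi>
    have "?D x \<xi> (axis k 1) = coord k x * \<theta> x * bessel_kernel \<gamma> (?\<beta> k) \<xi> x" for x
    proof -
      have "?D x \<xi> (axis k 1) = (\<Sum>j\<in>UNIV. if j = k then
          coord j x * \<theta> x * bessel_kernel \<gamma> (?\<beta> j) \<xi> x else 0)"
        unfolding D by (intro sum.cong) (auto simp: axis_def)
      thus ?thesis by simp
    qed
    thus "partial_deriv k (bessel_integral \<alpha> \<gamma> \<beta> \<theta>) \<xi>
      = bessel_integral \<alpha> \<gamma> (?\<beta> k) (\<lambda>x. coord k x * \<theta> x) \<xi>"
      unfolding partial_deriv_has_derivative[OF der] bessel_integral_def by (simp only:)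
  qed
qed

lemma bessel_integral_ctrl_diff:
  fixes \<alpha> :: "real^'n"
  assumes \<gamma>: "admissible \<gamma>" and "\<theta> \<in> borel_measurable (bessel_measure \<alpha>)"
    and "integrable (bessel_measure \<alpha>) (\<lambda>x. (1 + norm x) ^ m * norm (\<theta> x))"
  shows "ctrl_diff bounded_fun m (bessel_integral \<alpha> \<gamma> \<beta> \<theta>)"
  using assms(2,3)
proof (induction m arbitrary: \<theta> \<beta>)
  case 0
  thus ?case using bessel_integral_bounded_continuous[OF \<gamma> integrable_of_moment[OF 0]] by simp
next
  case (Suc m)
  show ?case
    using bessel_integral_bounded_continuous(2)[OF \<gamma> integrable_of_moment[OF Suc.prems]]
      bessel_integral_deriv[OF \<gamma> Suc.prems] by (simp add: Suc.IH)
qed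

text \<open>At order 0 the kernel is a product of even functions; derivatives of odd order would be
  odd.\<close>

lemma even_fun_fourier_bessel_kernel: "even_fun (bessel_integral \<alpha> \<gamma> (\<lambda>_. 0) \<theta>)"
proof -
  have "bessel_kernel \<gamma> (\<lambda>_. 0) (flip i \<xi>) x = bessel_kernel \<gamma> (\<lambda>_. 0) \<xi> x" for i \<xi> x
    unfolding bessel_kernel_def by (auto intro!: prod.cong simp: flip_component bessel_j_even)
  thus ?thesis by (simp add: even_fun_iff bessel_integral_def)
qed

subsection \<open>The Fourier-Bessel transform on the even Schwartz space\<close>

lemma ctrl_smooth_rapid_mult_bounded:
  "ctrl_smooth (rapid norm) f \<Longrightarrow> ctrl_smooth bounded_fun k \<Longrightarrow> ctrl_smooth (rapid norm) (\<lambda>x. f x * k x)"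
  using ctrl_smooth_slow_mult_rapid[of norm k f, OF norm_ge_zero ctrl_smooth_mono[OF _ bounded_fun_imp_slow]]
  by (simp add: mult.commute)

lemma ctrl_smooth_rapid_component_mult:
  "ctrl_smooth (rapid norm) f \<Longrightarrow> ctrl_smooth (rapid norm) (\<lambda>x. coord i x * f x)"
  by (intro ctrl_smooth_slow_mult_rapid ctrl_smooth_component_norm) auto

lemma integrable_bessel_smooth:
  "admissible \<alpha> \<Longrightarrow> ctrl_smooth (rapid norm) f \<Longrightarrow> integrable (bessel_measure \<alpha>) f"
  using integrable_bessel_rapid[OF _ borel_measurable_continuous_onI[OF ctrl_smoothD(4)] ctrl_smoothD(2)] .

text \<open>\<open>integral_bessel_euler\<close> applied to the product f k: with respect to the
  measure, x_i d_i + (2 \<alpha>_i + 2) is the adjoint of - x_i d_i.\<close>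

lemma bessel_parts:
  fixes \<alpha> :: "real^'n"
  assumes \<alpha>: "admissible \<alpha>" and f: "ctrl_smooth (rapid norm) f" and k: "ctrl_smooth bounded_fun k"
  shows "(LINT x|bessel_measure \<alpha>.
      (coord i x * partial_deriv i f x + complex_of_real (2 * \<alpha> $ i + 2) * f x) * k x)
    = - (LINT x|bessel_measure \<alpha>. f x * (coord i x * partial_deriv i k x))"
proof -
  let ?D = "partial_deriv i"
  let ?M = "bessel_measure \<alpha>"
  let ?c = "complex_of_real (2 * \<alpha> $ i + 2)"
  let ?u = "\<lambda>x. f x * k x"
  have u: "ctrl_smooth (rapid norm) ?u" using f k by (rule ctrl_smooth_rapid_mult_bounded)
  have du: "ctrl_smooth (rapid norm) (?D ?u)" using ctrl_smoothD(5)[OF u] .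
  have d: "?D ?u = (\<lambda>x. f x * ?D k x + ?D f x * k x)"
    by (intro partial_deriv_mult ctrl_smoothD(3)[OF f] ctrl_smoothD(3)[OF k])
  have I1: "integrable ?M (\<lambda>x. coord i x * (?D f x * k x))"
    by (intro integrable_bessel_smooth[OF \<alpha>] ctrl_smooth_rapid_component_mult
        ctrl_smooth_rapid_mult_bounded ctrl_smoothD(5)[OF f] k)
  have I2: "integrable ?M (\<lambda>x. f x * (coord i x * ?D k x))"
    unfolding mult.left_commute[of "f _"] by (intro integrable_bessel_smooth[OF \<alpha>] ctrl_smooth_rapid_component_mult
        ctrl_smooth_rapid_mult_bounded ctrl_smoothD(5)[OF k] f)
  have I3: "integrable ?M ?u" using \<alpha> u by (rule integrable_bessel_smooth)
  have 1: "(LINT x|?M. coord i x * ?D ?u x) = - ?c * (LINT x|?M. ?u x)"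
    by (intro integral_bessel_euler \<alpha> ctrl_smoothD(3,2)[OF u] ctrl_smoothD(4,2)[OF du])
  have 2: "(LINT x|?M. coord i x * ?D ?u x)
    = (LINT x|?M. f x * (coord i x * ?D k x))
      + (LINT x|?M. coord i x * (?D f x * k x))"
    unfolding d distrib_left mult.left_commute[of _ "f _"] using I2 I1 by (rule Bochner_Integration.integral_add)
  have 3: "(LINT x|?M. (coord i x * ?D f x + ?c * f x) * k x)
    = (LINT x|?M. coord i x * (?D f x * k x)) + ?c * (LINT x|?M. ?u x)"
    using Bochner_Integration.integral_add[OF I1 integrable_mult_right[OF I3, of ?c]]
    unfolding distrib_right mult.assoc integral_mult_right_zero .
  have "r = - p" if "A = - w * z" "A = p + q" "r = q + w * z" for A w z p q r :: complex
    using that by algebra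
  from this[OF 1 2 3] show ?thesis .
qed

lemma bessel_kernel_split:
  "bessel_kernel \<gamma> \<beta> \<xi> x = complex_of_real (bessel_jd (\<beta> i) (\<gamma> $ i) (\<xi> $ i * x $ i))
    * complex_of_real (\<Prod>j\<in>UNIV - {i}. bessel_jd (\<beta> j) (\<gamma> $ j) (\<xi> $ j * x $ j))"
  unfolding bessel_kernel_def by (subst prod.remove[of UNIV i]) auto

section \<open>Raising one index: integration by parts for the Bessel operator\<close>

context
  fixes \<alpha> :: "real^'n" and i :: 'n and \<alpha>' :: "real^'n" and c :: complex and \<epsilon> :: "'n \<Rightarrow> nat"
  assumes \<alpha>: "admissible \<alpha>"
  defines "\<alpha>' \<equiv> \<alpha> + axis i 1"
    and "c \<equiv> complex_of_real (2 * \<alpha> $ i + 2)"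
    and "\<epsilon> \<equiv> (\<lambda>_. 0)(i := Suc 0)"
begin

lemma raised_gt: "admissible \<alpha>'"
proof
  fix k
  have "-1/2 < \<alpha> $ k" using \<alpha> by blast
  thus "\<alpha>' $ k > -1/2" by (auto simp: \<alpha>'_def axis_def)
qed

lemma c_nonzero: "c \<noteq> 0"
proof -
  have "-1/2 < \<alpha> $ i" using \<alpha> by blast
  hence "2 * \<alpha> $ i + 2 \<noteq> 0" by simp
  thus ?thesis unfolding c_def by (simp only: of_real_eq_0_iff not_False_eq_True)
qed

lemma raised_kernel_split:
  "bessel_kernel \<alpha>' \<beta> \<xi> x = complex_of_real (bessel_jd (\<beta> i) (\<alpha> $ i + 1) (\<xi> $ i * x $ i))
    * complex_of_real (\<Prod>j\<in>UNIV - {i}. bessel_jd (\<beta> j) (\<alpha> $ j) (\<xi> $ j * x $ j))"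
proof -
  have "(\<Prod>j\<in>UNIV - {i}. bessel_jd (\<beta> j) (\<alpha>' $ j) (\<xi> $ j * x $ j))
    = (\<Prod>j\<in>UNIV - {i}. bessel_jd (\<beta> j) (\<alpha> $ j) (\<xi> $ j * x $ j))"
    by (intro prod.cong) (auto simp: \<alpha>'_def axis_def)
  moreover have "\<alpha>' $ i = \<alpha> $ i + 1" by (simp add: \<alpha>'_def)
  ultimately show ?thesis by (simp only: bessel_kernel_split[of \<alpha>' \<beta> \<xi> x i])
qed

text \<open>The first derivative of j in the i-th factor, expressed by the function of index
  \<alpha>_i + 1. Multiplication by c = 2 \<alpha>_i + 2 keeps the identity free of
  fractions.\<close>

lemma bessel_kernel_lower:
  "c * bessel_kernel \<alpha> \<epsilon> \<xi> x = - complex_of_real (\<xi> $ i * x $ i) * bessel_kernel \<alpha>' (\<lambda>_. 0) \<xi> x"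
proof -
  have "-1/2 < \<alpha> $ i" using \<alpha> by blast
  hence nz: "2 * \<alpha> $ i + 2 \<noteq> 0" by simp
  let ?t = "\<xi> $ i * x $ i"
  have "(2 * \<alpha> $ i + 2) * bessel_jd (Suc 0) (\<alpha> $ i) ?t = - ?t * bessel_jd 0 (\<alpha> $ i + 1) ?t"
    using nz by (simp add: field_simps)
  hence "c * complex_of_real (bessel_jd (Suc 0) (\<alpha> $ i) ?t)
    = - complex_of_real ?t * complex_of_real (bessel_jd 0 (\<alpha> $ i + 1) ?t)"
    unfolding c_def of_real_mult[symmetric] of_real_minus[symmetric] by (simp only:)
  moreover have "(\<Prod>j\<in>UNIV - {i}. bessel_jd (\<epsilon> j) (\<alpha> $ j) (\<xi> $ j * x $ j))
     = (\<Prod>j\<in>UNIV - {i}. bessel_jd 0 (\<alpha> $ j) (\<xi> $ j * x $ j))"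
    by (intro prod.cong) (auto simp: \<epsilon>_def)
  moreover have "\<epsilon> i = Suc 0" by (simp add: \<epsilon>_def)
  ultimately show ?thesis unfolding bessel_kernel_split[of \<alpha> \<epsilon> \<xi> x i] raised_kernel_split
    by (simp only: mult.assoc[symmetric])
qed

text \<open>\<open>bessel_j_rec\<close> in the i-th factor, multiplied by the other factors.
  Together with \<open>bessel_kernel_lower\<close> it forms the pair of ladder relations between the
  indices \<alpha> and \<alpha>'.\<close>

lemma bessel_kernel_raise:
  "complex_of_real (\<xi> $ i * x $ i) * bessel_kernel \<alpha>' \<epsilon> \<xi> x + c * bessel_kernel \<alpha>' (\<lambda>_. 0) \<xi> x
    = c * bessel_kernel \<alpha> (\<lambda>_. 0) \<xi> x"
proof -
  have a: "-1/2 < \<alpha> $ i" using \<alpha> by blast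
  let ?t = "\<xi> $ i * x $ i"
  have "?t * bessel_jd (Suc 0) (\<alpha> $ i + 1) ?t + (2 * \<alpha> $ i + 2) * bessel_jd 0 (\<alpha> $ i + 1) ?t
    = (2 * \<alpha> $ i + 2) * bessel_jd 0 (\<alpha> $ i) ?t"
    using bessel_j_rec[OF a, of ?t] by (simp only: bessel_jd.simps add.assoc one_add_one)
  hence eq: "complex_of_real ?t * complex_of_real (bessel_jd (Suc 0) (\<alpha> $ i + 1) ?t)
     + c * complex_of_real (bessel_jd 0 (\<alpha> $ i + 1) ?t) = c * complex_of_real (bessel_jd 0 (\<alpha> $ i) ?t)"
    unfolding c_def of_real_mult[symmetric] of_real_add[symmetric] by (simp only:)
  have p: "(\<Prod>j\<in>UNIV - {i}. bessel_jd (\<epsilon> j) (\<alpha> $ j) (\<xi> $ j * x $ j))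
     = (\<Prod>j\<in>UNIV - {i}. bessel_jd 0 (\<alpha> $ j) (\<xi> $ j * x $ j))"
    by (intro prod.cong) (auto simp: \<epsilon>_def)
  have "\<epsilon> i = Suc 0" by (simp add: \<epsilon>_def)
  thus ?thesis unfolding bessel_kernel_split[of \<alpha> "\<lambda>_. 0" \<xi> x i] raised_kernel_split p
    using arg_cong[OF eq, of "\<lambda>z. z * complex_of_real (\<Prod>j\<in>UNIV - {i}. bessel_jd 0 (\<alpha> $ j) (\<xi> $ j * x $ j))"]
    by (simp only: distrib_right mult.assoc)
qed

text \<open>After integration by parts the raised kernel L appears as x_i d_i L + c L, and
  \<open>bessel_kernel_raise\<close> collapses this to c times the kernel of index \<alpha>.\<close>

lemma raised_parts:
  assumes f: "ctrl_smooth (rapid norm) f"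
  shows "(LINT x|bessel_measure \<alpha>. coord i x * partial_deriv i f x * bessel_kernel \<alpha>' (\<lambda>_. 0) \<xi> x)
    = - c * fourier_bessel \<alpha> f \<xi>"
proof -
  let ?D = "partial_deriv i"
  let ?M = "bessel_measure \<alpha>"
  let ?L = "bessel_kernel \<alpha>' (\<lambda>_. 0) \<xi>"
  have L: "ctrl_smooth bounded_fun ?L" by (rule ctrl_smooth_bessel_kernel[OF raised_gt])
  have I1: "integrable ?M (\<lambda>x. coord i x * ?D f x * ?L x)"
    by (intro integrable_bessel_smooth[OF \<alpha>] ctrl_smooth_rapid_mult_bounded ctrl_smooth_rapid_component_mult
        ctrl_smoothD(5)[OF f] L)
  have I2: "integrable ?M (\<lambda>x. c * f x * ?L x)"
    by (intro integrable_bessel_smooth[OF \<alpha>] ctrl_smooth_rapid_mult_bounded ctrl_smooth_rapid_cmult f L) auto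
  have I3: "integrable ?M (\<lambda>x. f x * (coord i x * ?D ?L x))"
    using integrable_bessel_smooth[OF \<alpha> ctrl_smooth_rapid_component_mult[OF
      ctrl_smooth_rapid_mult_bounded[OF f ctrl_smoothD(5)[OF L]]]] by (simp add: mult_ac)
  have "(LINT x|?M. coord i x * ?D f x * ?L x) + (LINT x|?M. c * f x * ?L x)
    = (LINT x|?M. (coord i x * ?D f x + c * f x) * ?L x)"
    unfolding distrib_right using I1 I2 by (rule Bochner_Integration.integral_add[symmetric])
  also have "\<dots> = - (LINT x|?M. f x * (coord i x * ?D ?L x))"
    unfolding c_def by (rule bessel_parts[OF \<alpha> f L])
  finally have eq: "(LINT x|?M. coord i x * ?D f x * ?L x)
      + (LINT x|?M. c * f x * ?L x)
    = - (LINT x|?M. f x * (coord i x * ?D ?L x))" .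
  have "a = - (d + b)" if "a + b = - d" for a b d :: complex using that by algebra
  from this[OF eq] have "(LINT x|?M. coord i x * ?D f x * ?L x)
    = - ((LINT x|?M. f x * (coord i x * ?D ?L x)) + (LINT x|?M. c * f x * ?L x))" .
  also have "(LINT x|?M. f x * (coord i x * ?D ?L x)) + (LINT x|?M. c * f x * ?L x)
    = (LINT x|?M. f x * (coord i x * ?D ?L x) + c * f x * ?L x)"
    using I3 I2 by (rule Bochner_Integration.integral_add[symmetric])
  also have "\<dots> = (LINT x|?M. c * (f x * bessel_kernel \<alpha> (\<lambda>_. 0) \<xi> x))"
  proof (rule Bochner_Integration.integral_cong[OF refl])
    fix x
    have "?D ?L x = coord i \<xi> * bessel_kernel \<alpha>' \<epsilon> \<xi> x"
      unfolding \<epsilon>_def using partial_deriv_bessel_kernel[OF raised_gt, of i "\<lambda>_. 0" \<xi> x] by simp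
    hence "f x * (coord i x * ?D ?L x) + c * f x * ?L x
      = f x * (complex_of_real (\<xi> $ i * x $ i) * bessel_kernel \<alpha>' \<epsilon> \<xi> x + c * ?L x)"
      by (simp add: algebra_simps)
    thus "f x * (coord i x * ?D ?L x) + c * f x * ?L x
      = c * (f x * bessel_kernel \<alpha> (\<lambda>_. 0) \<xi> x)" unfolding bessel_kernel_raise by (simp add: mult_ac)
  qed
  also have "\<dots> = c * fourier_bessel \<alpha> f \<xi>"
    unfolding fourier_bessel_eq bessel_integral_def by simp
  finally show ?thesis by simp
qed

text \<open>With d_i f = x_i g, the function x_i d_i g + c g is d_i^2 f + ((2 \<alpha>_i + 1) / x_i)
  d_i f, the Bessel operator applied to f. One integration by parts with
  \<open>bessel_kernel_lower\<close> passes to the raised kernel, a second one,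
  \<open>raised_parts\<close>, returns to the original kernel; the common factor c is cancelled at
  the end.\<close>

lemma fourier_bessel_operator:
  assumes f: "ctrl_smooth (rapid norm) f" and g: "ctrl_smooth (rapid norm) g"
    and fg: "\<And>x. partial_deriv i f x = coord i x * g x"
  shows "fourier_bessel \<alpha> (\<lambda>x. coord i x * partial_deriv i g x + c * g x) \<xi>
    = - complex_of_real ((\<xi> $ i)\<^sup>2) * fourier_bessel \<alpha> f \<xi>"
proof -
  let ?D = "partial_deriv i"
  let ?F = "fourier_bessel \<alpha>"
  let ?M = "bessel_measure \<alpha>"
  let ?K = "bessel_kernel \<alpha> (\<lambda>_. 0) \<xi>"
  let ?L = "bessel_kernel \<alpha>' (\<lambda>_. 0) \<xi>"
  have K: "ctrl_smooth bounded_fun ?K" by (rule ctrl_smooth_bessel_kernel[OF \<alpha>])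
  have "c * ?F (\<lambda>x. coord i x * ?D g x + c * g x) \<xi>
    = c * - (LINT x|?M. g x * (coord i x * ?D ?K x))"
    unfolding fourier_bessel_eq bessel_integral_def c_def
    by (rule arg_cong[OF bessel_parts[OF \<alpha> g K]])
  also have "\<dots> = (LINT x|?M. - c * (g x * (coord i x * ?D ?K x)))"
    by simp
  also have "\<dots> = (LINT x|?M. complex_of_real ((\<xi> $ i)\<^sup>2) * (coord i x * ?D f x * ?L x))"
  proof (rule Bochner_Integration.integral_cong[OF refl])
    fix x
    have "?D ?K x = coord i \<xi> * bessel_kernel \<alpha> \<epsilon> \<xi> x"
      unfolding \<epsilon>_def using partial_deriv_bessel_kernel[OF \<alpha>, of i "\<lambda>_. 0" \<xi> x] by simp
    hence "- c * (g x * (coord i x * ?D ?K x))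
      = - (g x * coord i x * coord i \<xi> * (c * bessel_kernel \<alpha> \<epsilon> \<xi> x))"
      by simp
    thus "- c * (g x * (coord i x * ?D ?K x))
      = complex_of_real ((\<xi> $ i)\<^sup>2) * (coord i x * ?D f x * ?L x)"
      unfolding bessel_kernel_lower fg by (simp add: power2_eq_square mult_ac)
  qed
  also have "\<dots> = complex_of_real ((\<xi> $ i)\<^sup>2) * (- c * ?F f \<xi>)"
    using raised_parts[OF f] by simp
  finally have "c * ?F (\<lambda>x. coord i x * ?D g x + c * g x) \<xi>
    = c * (- complex_of_real ((\<xi> $ i)\<^sup>2) * ?F f \<xi>)" by (simp add: mult_ac)
  thus ?thesis by (rule mult_left_cancel[OF c_nonzero, THEN iffD1])
qed

end

lemma integrable_bessel_moment:
  assumes \<alpha>: "admissible \<alpha>" and f: "ctrl_smooth (rapid norm) f"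
  shows "f \<in> borel_measurable (bessel_measure \<alpha>)"
    and "integrable (bessel_measure \<alpha>) (\<lambda>x. (1 + norm x) ^ m * norm (f x))"
proof -
  let ?M = "bessel_measure \<alpha>"
  have cf: "continuous_on UNIV f" using ctrl_smoothD(4)[OF f] .
  show "f \<in> borel_measurable ?M"
    using cf by (intro measurable_bessel_measure borel_measurable_continuous_onI)
  have "integrable ?M (\<lambda>x. complex_of_real ((1 + norm x) ^ m) * f x)"
  proof (rule integrable_bessel_rapid[OF \<alpha>])
    show "(\<lambda>x. complex_of_real ((1 + norm x) ^ m) * f x) \<in> borel_measurable borel"
      using cf by (intro borel_measurable_continuous_onI continuous_intros)
    have "slow norm (\<lambda>x. complex_of_real ((1 + norm x) ^ m))"
      unfolding slow_def by (rule exI[of _ m], rule exI[of _ 1]) (simp del: of_real_power of_real_add)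
    thus "rapid norm (\<lambda>x. complex_of_real ((1 + norm x) ^ m) * f x)"
      using ctrl_smoothD(2)[OF f] by (intro rapid_mult_slow) auto
  qed
  from integrable_norm[OF this]
  show "integrable ?M (\<lambda>x. (1 + norm x) ^ m * norm (f x))"
    by (simp add: norm_mult del: of_real_power of_real_add)
qed

lemma fourier_bessel_ctrl_smooth:
  assumes "admissible \<alpha>" "admissible \<gamma>" "ctrl_smooth (rapid norm) f"
  shows "ctrl_smooth bounded_fun (bessel_integral \<alpha> \<gamma> \<beta> f)"
  by (rule ctrl_smoothI) (rule bessel_integral_ctrl_diff[OF assms(2) integrable_bessel_moment[OF assms(1,3)]])

lemma schwartz_even_mult:
  assumes "even_fun h" "ctrl_smooth (slow norm) h" "f \<in> schwartz_even"
  shows "(\<lambda>x. h x * f x) \<in> schwartz_even"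
  using assms unfolding schwartz_even_iff even_fun_def by (auto intro!: ctrl_smooth_slow_mult_rapid)

lemma schwartz_even_cmult: "f \<in> schwartz_even \<Longrightarrow> (\<lambda>x. c * f x) \<in> schwartz_even"
  by (rule schwartz_even_mult)
    (auto simp: even_fun_def intro: ctrl_smooth_mono[OF ctrl_smooth_const bounded_fun_imp_slow])

lemma schwartz_even_add: "f \<in> schwartz_even \<Longrightarrow> g \<in> schwartz_even \<Longrightarrow> (\<lambda>x. f x + g x) \<in> schwartz_even"
  unfolding schwartz_even_iff even_fun_def by (auto intro!: ctrl_smooth_rapid_add)

lemma schwartz_even_component_square:
  assumes "f \<in> schwartz_even" shows "(\<lambda>x. complex_of_real ((x $ i)\<^sup>2) * f x) \<in> schwartz_even"
proof -
  have "ctrl_smooth (rapid norm) (\<lambda>x. coord i x * (coord i x * f x))"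
    using assms by (intro ctrl_smooth_rapid_component_mult) (simp add: schwartz_even_iff)
  moreover have "(\<lambda>x. coord i x * (coord i x * f x)) = (\<lambda>x. complex_of_real ((x $ i)\<^sup>2) * f x)"
    by (simp add: fun_eq_iff power2_eq_square)
  ultimately show ?thesis using assms by (auto simp: schwartz_even_iff even_fun_iff flip_component)
qed

lemma schwartz_even_component_deriv:
  assumes g: "g \<in> schwartz_even"
  shows "(\<lambda>x. coord i x * partial_deriv i g x) \<in> schwartz_even"
proof -
  have ev: "even_fun g" and sm: "ctrl_smooth (rapid norm) g" using g by (auto simp: schwartz_even_iff)
  have "even_fun (\<lambda>x. coord i x * partial_deriv i g x)"
    unfolding even_fun_iff partial_deriv_flip[OF ev ctrl_smoothD(3)[OF sm]] by (auto simp: flip_component)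
  thus ?thesis using ctrl_smooth_rapid_component_mult[OF ctrl_smoothD(5)[OF sm]] by (simp add: schwartz_even_iff)
qed

text \<open>The function b_i is the Bessel operator in the i-th variable applied to f, again even
  and Schwartz, with transform - \<xi>_i^2 F f. Hence (1 + |\<xi>|^2) |F f| is a sum of moduli of
  transforms to which the induction hypothesis applies.\<close>

lemma fourier_bessel_decay:
  fixes \<alpha> :: "real^'n"
  assumes \<alpha>: "admissible \<alpha>" and "f \<in> schwartz_even"
  shows "\<exists>C. \<forall>\<xi>. (1 + (norm \<xi>)\<^sup>2) ^ k * norm (fourier_bessel \<alpha> f \<xi>) \<le> C"
  using assms(2)
proof (induction k arbitrary: f)
  case 0
  have "ctrl_smooth bounded_fun (fourier_bessel \<alpha> f)"
    unfolding fourier_bessel_eq using 0 by (intro fourier_bessel_ctrl_smooth \<alpha>) (simp add: schwartz_even_iff)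
  thus ?case using ctrl_smoothD(2) by (fastforce simp: bounded_fun_def)
next
  case (Suc k)
  have "\<exists>b. b \<in> schwartz_even \<and> (\<forall>\<xi>. fourier_bessel \<alpha> b \<xi> = - complex_of_real ((\<xi> $ i)\<^sup>2) * fourier_bessel \<alpha> f \<xi>)" for i
  proof -
    obtain g where g: "g \<in> schwartz_even" "\<And>x. partial_deriv i f x = coord i x * g x"
      using schwartz_divide_deriv[OF Suc.prems] by blast
    let ?b = "\<lambda>x. coord i x * partial_deriv i g x + complex_of_real (2 * \<alpha> $ i + 2) * g x"
    have "?b \<in> schwartz_even"
      by (intro schwartz_even_add schwartz_even_component_deriv schwartz_even_cmult g(1))
    moreover have "fourier_bessel \<alpha> ?b \<xi> = - complex_of_real ((\<xi> $ i)\<^sup>2) * fourier_bessel \<alpha> f \<xi>" for \<xi>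
      using Suc.prems g by (intro fourier_bessel_operator[OF \<alpha>]) (auto simp: schwartz_even_iff)
    ultimately show ?thesis by blast
  qed
  then obtain b where b: "\<And>i. b i \<in> schwartz_even"
    "\<And>i \<xi>. fourier_bessel \<alpha> (b i) \<xi> = - complex_of_real ((\<xi> $ i)\<^sup>2) * fourier_bessel \<alpha> f \<xi>" by metis
  obtain C where C: "\<And>i \<xi>. (1 + (norm \<xi>)\<^sup>2) ^ k * norm (fourier_bessel \<alpha> (b i) \<xi>) \<le> C i"
    using Suc.IH[OF b(1)] by metis
  obtain D where D: "\<And>\<xi>. (1 + (norm \<xi>)\<^sup>2) ^ k * norm (fourier_bessel \<alpha> f \<xi>) \<le> D"
    using Suc.IH[OF Suc.prems] by blast
  have "(1 + (norm \<xi>)\<^sup>2) ^ Suc k * norm (fourier_bessel \<alpha> f \<xi>) \<le> D + (\<Sum>i\<in>UNIV. C i)" for \<xi>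
  proof -
    let ?w = "(1 + (norm \<xi>)\<^sup>2) ^ k" and ?F = "norm (fourier_bessel \<alpha> f \<xi>)"
    have "(norm \<xi>)\<^sup>2 = (\<Sum>i\<in>UNIV. (\<xi> $ i)\<^sup>2)" using norm_proj_squared[of UNIV \<xi>] by simp
    hence "(1 + (norm \<xi>)\<^sup>2) ^ Suc k * ?F = ?w * ?F + (\<Sum>i\<in>UNIV. (\<xi> $ i)\<^sup>2) * (?w * ?F)"
      by (simp add: algebra_simps)
    also have "(\<Sum>i\<in>UNIV. (\<xi> $ i)\<^sup>2) * (?w * ?F) = (\<Sum>i\<in>UNIV. ?w * norm (fourier_bessel \<alpha> (b i) \<xi>))"
      unfolding b(2) sum_distrib_right by (intro sum.cong) (auto simp: norm_mult norm_power mult_ac)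
    also have "?w * ?F + \<dots> \<le> D + (\<Sum>i\<in>UNIV. C i)" by (intro add_mono sum_mono D C)
    finally show ?thesis .
  qed
  thus ?case by blast
qed

text \<open>Differentiation under the integral gives bounded derivatives of all orders, the Bessel
  operator gives decay of the transform itself, and \<open>ctrl_smooth_rapidI\<close> combines the
  two.\<close>

theorem fourier_bessel_schwartz:
  fixes \<alpha> :: "real^'n"
  assumes \<alpha>: "admissible \<alpha>" and f: "f \<in> schwartz_even"
  shows "fourier_bessel \<alpha> f \<in> schwartz_even"
proof -
  let ?F = "fourier_bessel \<alpha>"
  have "ctrl_smooth bounded_fun (?F f)"
    unfolding fourier_bessel_eq using f by (intro fourier_bessel_ctrl_smooth \<alpha>) (simp add: schwartz_even_iff)
  moreover have "rapid norm (?F f)"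
    unfolding rapid_def
  proof
    fix k
    obtain C where C: "\<And>\<xi>. (1 + (norm \<xi>)\<^sup>2) ^ k * norm (?F f \<xi>) \<le> C"
      using fourier_bessel_decay[OF \<alpha> f] by blast
    have "(1 + norm \<xi>) ^ k * norm (?F f \<xi>) \<le> 2 ^ k * C" for \<xi>
    proof -
      have "1 + norm \<xi> \<le> 2 * (1 + (norm \<xi>)\<^sup>2)"
      proof -
        have A: "2 * norm \<xi> \<le> (norm \<xi>)\<^sup>2 + 1"
          using zero_le_power2[of "norm \<xi> - 1"] by (simp add: power2_diff)
        have "1 + r \<le> 2 * (1 + q)" if "2 * r \<le> q + 1" "0 \<le> q" for r q :: real
          using that by simp
        from this[OF A zero_le_power2] show ?thesis .
      qed
      thus ?thesis by (rule weight_power_mult_le[OF _ _ norm_ge_zero C]) simp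
    qed
    thus "\<exists>C. \<forall>\<xi>. (1 + norm \<xi>) ^ k * norm (?F f \<xi>) \<le> C" by blast
  qed
  ultimately have "ctrl_smooth (rapid norm) (?F f)" by (rule ctrl_smooth_rapidI)
  thus ?thesis unfolding schwartz_even_iff fourier_bessel_eq using even_fun_fourier_bessel_kernel by blast
qed

lemma fourier_bessel_cmult: "fourier_bessel \<alpha> (\<lambda>x. c * f x) = (\<lambda>\<xi>. c * fourier_bessel \<alpha> f \<xi>)"
  unfolding fourier_bessel_def by (simp add: mult.assoc)

lemma fourier_bessel_add:
  assumes \<alpha>: "admissible \<alpha>" and f: "f \<in> schwartz_even" and g: "g \<in> schwartz_even"
  shows "fourier_bessel \<alpha> (\<lambda>x. f x + g x) = (\<lambda>\<xi>. fourier_bessel \<alpha> f \<xi> + fourier_bessel \<alpha> g \<xi>)"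
proof
  let ?F = "fourier_bessel \<alpha>"
  fix \<xi>
  have "integrable (bessel_measure \<alpha>) (\<lambda>x. h x * bessel_kernel \<alpha> (\<lambda>_. 0) \<xi> x)" if "h \<in> schwartz_even" for h
    using that \<alpha> by (intro integrable_mult_bessel_kernel integrable_bessel_smooth) (auto simp: schwartz_even_iff)
  thus "?F (\<lambda>x. f x + g x) \<xi> = ?F f \<xi> + ?F g \<xi>"
    unfolding fourier_bessel_eq bessel_integral_def distrib_right using f g by simp
qed

section \<open>The transform applied twice, and the transform of the Gaussian\<close>

context
  fixes \<alpha> :: "real^'n" and i :: 'n and \<alpha>' :: "real^'n" and c :: complex and \<epsilon> :: "'n \<Rightarrow> nat"
  assumes \<alpha>: "admissible \<alpha>"
  defines "\<alpha>' \<equiv> \<alpha> + axis i 1"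
    and "c \<equiv> complex_of_real (2 * \<alpha> $ i + 2)"
    and "\<epsilon> \<equiv> (\<lambda>_. 0)(i := Suc 0)"
begin

text \<open>\<open>bessel_kernel_lower\<close> under the integral sign extracts the factor \<xi>_i
  explicitly, so the derivative divided by \<xi>_i is visible as an integral against the raised
  kernel.\<close>

lemma partial_deriv_fourier_bessel:
  assumes f: "ctrl_smooth (rapid norm) f"
  shows "c * partial_deriv i (fourier_bessel \<alpha> f) \<xi>
    = - coord i \<xi> * bessel_integral \<alpha> \<alpha>' (\<lambda>_. 0) (\<lambda>x. complex_of_real ((x $ i)\<^sup>2) * f x) \<xi>"
proof -
  let ?M = "bessel_measure \<alpha>"
  let ?F = "fourier_bessel \<alpha>"
  have "partial_deriv i (?F f) = bessel_integral \<alpha> \<alpha> \<epsilon> (\<lambda>x. coord i x * f x)"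
    unfolding fourier_bessel_eq \<epsilon>_def
    using bessel_integral_deriv(2)[OF \<alpha> integrable_bessel_moment[OF \<alpha> f]] by simp
  hence "c * partial_deriv i (?F f) \<xi>
    = (LINT x|?M. (coord i x * f x) * (c * bessel_kernel \<alpha> \<epsilon> \<xi> x))"
    unfolding bessel_integral_def mult.left_commute[of "complex_of_real (_ $ i) * f _" c] by simp
  also have "\<dots> = (LINT x|?M. - coord i \<xi>
      * (complex_of_real ((x $ i)\<^sup>2) * f x * bessel_kernel \<alpha>' (\<lambda>_. 0) \<xi> x))"
    unfolding bessel_kernel_lower[OF \<alpha>, where i = i, folded \<alpha>'_def c_def \<epsilon>_def]
    by (rule Bochner_Integration.integral_cong) (auto simp: power2_eq_square mult_ac)
  also have "\<dots> = - coord i \<xi> * bessel_integral \<alpha> \<alpha>' (\<lambda>_. 0) (\<lambda>x. complex_of_real ((x $ i)\<^sup>2) * f x) \<xi>"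
    unfolding bessel_integral_def by (rule integral_mult_right_zero)
  finally show ?thesis .
qed

text \<open>Two dual rules are composed: the Bessel operator applied to F f is - F (x_i^2 f), and
  the transform of that operator applied to F f is - \<xi>_i^2 F (F f).\<close>

lemma fourier_bessel_twice_square:
  assumes f: "f \<in> schwartz_even"
  shows "fourier_bessel \<alpha> (fourier_bessel \<alpha> (\<lambda>x. complex_of_real ((x $ i)\<^sup>2) * f x)) \<xi>
    = complex_of_real ((\<xi> $ i)\<^sup>2) * fourier_bessel \<alpha> (fourier_bessel \<alpha> f) \<xi>"
proof -
  let ?D = "partial_deriv i"
  let ?F = "fourier_bessel \<alpha>"
  let ?M = "bessel_measure \<alpha>"
  let ?q = "\<lambda>x. complex_of_real ((x $ i)\<^sup>2) * f x"
  let ?G = "?F f"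
  let ?Q = "bessel_integral \<alpha> \<alpha>' (\<lambda>_. 0) ?q"
  note rgt = raised_gt[OF \<alpha>, where i = i, folded \<alpha>'_def]
  note c0 = c_nonzero[OF \<alpha>, where i = i, folded c_def]
  have sf: "ctrl_smooth (rapid norm) f" using f by (simp add: schwartz_even_iff)
  have q: "?q \<in> schwartz_even" using f by (rule schwartz_even_component_square)
  hence sq: "ctrl_smooth (rapid norm) ?q" by (simp add: schwartz_even_iff)
  have Gs: "?G \<in> schwartz_even" using \<alpha> f by (rule fourier_bessel_schwartz)
  have Qs: "ctrl_smooth bounded_fun ?Q" by (rule fourier_bessel_ctrl_smooth[OF \<alpha> rgt sq])
  obtain g where g: "g \<in> schwartz_even" "\<And>\<xi>. ?D ?G \<xi> = coord i \<xi> * g \<xi>"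
    using schwartz_divide_deriv[OF Gs] by blast
  have sg: "ctrl_smooth (rapid norm) g" using g(1) by (simp add: schwartz_even_iff)
  \<comment> \<open>The abstract quotient is identified, off the hyperplane and then by continuity,
    with an integral that can itself be differentiated.\<close>
  have geq: "g = (\<lambda>\<xi>. - (1 / c) * ?Q \<xi>)"
  proof
    fix \<xi>
    show "g \<xi> = - (1 / c) * ?Q \<xi>"
    proof (rule continuous_eq_off_hyperplanes[where i = i and b = 0])
      show "continuous_on UNIV (\<lambda>\<xi>. - (1 / c) * ?Q \<xi>)"
        using ctrl_smoothD(4)[OF Qs] by (intro continuous_intros)
      show "g \<xi> = - (1 / c) * ?Q \<xi>" if "(\<xi> $ i)\<^sup>2 \<noteq> 0" for \<xi>
      proof -
        have "coord i \<xi> * (c * g \<xi>) = coord i \<xi> * (- ?Q \<xi>)"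
          using partial_deriv_fourier_bessel[OF sf, of \<xi>] unfolding g(2) by (simp add: mult_ac)
        hence "c * g \<xi> = - ?Q \<xi>" using that by (subst (asm) mult_left_cancel) auto
        thus ?thesis using c0 by (simp add: field_simps)
      qed
    qed (rule ctrl_smoothD(4)[OF sg])
  qed
  have dg: "?D g \<xi> = - (1 / c) * ?D ?Q \<xi>" for \<xi>
    unfolding geq using partial_deriv_mult[of "\<lambda>_. - (1 / c)" ?Q i] ctrl_smoothD(3)[OF Qs]
    by simp
  have dQ: "?D ?Q = bessel_integral \<alpha> \<alpha>' \<epsilon> (\<lambda>x. coord i x * ?q x)"
    unfolding \<epsilon>_def using bessel_integral_deriv(2)[OF rgt integrable_bessel_moment[OF \<alpha> sq]] by simp
  \<comment> \<open>The left side is the Bessel operator applied to F f;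
    \<open>bessel_kernel_raise\<close> brings the kernel back from \<alpha>' to \<alpha>.\<close>
  have B: "coord i \<xi> * ?D g \<xi> + c * g \<xi> = - 1 * ?F ?q \<xi>" for \<xi>
  proof -
    have I1: "integrable ?M (\<lambda>x. coord i x * ?q x * bessel_kernel \<alpha>' \<epsilon> \<xi> x)"
      by (intro integrable_mult_bessel_kernel rgt integrable_bessel_smooth \<alpha> ctrl_smooth_rapid_component_mult sq)
    have I2: "integrable ?M (\<lambda>x. ?q x * bessel_kernel \<alpha>' (\<lambda>_. 0) \<xi> x)"
      by (intro integrable_mult_bessel_kernel rgt integrable_bessel_smooth \<alpha> sq)
    have "coord i \<xi> * ?D ?Q \<xi> + c * ?Q \<xi>
      = (LINT x|?M. coord i \<xi> * (coord i x * ?q x * bessel_kernel \<alpha>' \<epsilon> \<xi> x)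
          + c * (?q x * bessel_kernel \<alpha>' (\<lambda>_. 0) \<xi> x))"
      unfolding dQ bessel_integral_def integral_mult_right_zero[symmetric]
      by (rule Bochner_Integration.integral_add[symmetric]) (intro integrable_mult_right I1 I2)+
    also have "\<dots> = (LINT x|?M. ?q x * (complex_of_real (\<xi> $ i * x $ i) * bessel_kernel \<alpha>' \<epsilon> \<xi> x
          + c * bessel_kernel \<alpha>' (\<lambda>_. 0) \<xi> x))"
      by (rule Bochner_Integration.integral_cong) (auto simp: algebra_simps)
    also have "\<dots> = (LINT x|?M. c * (?q x * bessel_kernel \<alpha> (\<lambda>_. 0) \<xi> x))"
      unfolding bessel_kernel_raise[OF \<alpha>, where i = i, folded \<alpha>'_def c_def \<epsilon>_def]
      by (rule Bochner_Integration.integral_cong) (auto simp: mult_ac)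
    also have "\<dots> = c * ?F ?q \<xi>"
      unfolding fourier_bessel_eq bessel_integral_def by (rule integral_mult_right_zero)
    finally have eq: "coord i \<xi> * ?D ?Q \<xi> + c * ?Q \<xi> = c * ?F ?q \<xi>" .
    have "coord i \<xi> * ?D g \<xi> + c * g \<xi>
      = - (1 / c) * (coord i \<xi> * ?D ?Q \<xi> + c * ?Q \<xi>)"
      unfolding dg unfolding geq by (simp only: distrib_left mult.left_commute)
    thus ?thesis unfolding eq using c0 by simp
  qed
  have "?F (\<lambda>\<xi>. - 1 * ?F ?q \<xi>) \<xi>
    = - complex_of_real ((\<xi> $ i)\<^sup>2) * ?F ?G \<xi>"
    unfolding B[symmetric] c_def using Gs g(2) sg
    by (intro fourier_bessel_operator[OF \<alpha>]) (auto simp: schwartz_even_iff)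
  thus ?thesis unfolding fourier_bessel_cmult by simp
qed

text \<open>For the Gaussian, x_i^2 times the function equals - x_i times its i-th derivative, which
  is the integrand treated by \<open>raised_parts\<close>.\<close>

lemma partial_deriv_fourier_bessel_gauss:
  "partial_deriv i (fourier_bessel \<alpha> (gauss UNIV)) \<xi>
    = - coord i \<xi> * fourier_bessel \<alpha> (gauss UNIV) \<xi>"
proof -
  let ?D = "partial_deriv i"
  let ?F = "fourier_bessel \<alpha>"
  note c0 = c_nonzero[OF \<alpha>, where i = i, folded c_def]
  have sG: "ctrl_smooth (rapid norm) (gauss UNIV :: real^'n \<Rightarrow> complex)"
    by (rule gauss_ctrl_smooth)
  have "bessel_integral \<alpha> \<alpha>' (\<lambda>_. 0) (\<lambda>x. complex_of_real ((x $ i)\<^sup>2) * gauss UNIV x) \<xi>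
    = (LINT x|bessel_measure \<alpha>. - 1 * (coord i x * ?D (gauss UNIV) x
        * bessel_kernel \<alpha>' (\<lambda>_. 0) \<xi> x))"
    unfolding bessel_integral_def partial_deriv_gauss
    by (rule Bochner_Integration.integral_cong) (auto simp: power2_eq_square)
  also have "\<dots> = - 1 * (- c * ?F (gauss UNIV) \<xi>)"
    unfolding integral_mult_right_zero raised_parts[OF \<alpha> sG, where i = i, folded \<alpha>'_def c_def] ..
  finally have "c * ?D (?F (gauss UNIV)) \<xi>
    = - coord i \<xi> * (- 1 * (- c * ?F (gauss UNIV) \<xi>))"
    unfolding partial_deriv_fourier_bessel[OF sG] by simp
  hence "c * ?D (?F (gauss UNIV)) \<xi>
    = c * (- coord i \<xi> * ?F (gauss UNIV) \<xi>)" by (simp add: mult_ac)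
  thus ?thesis by (rule mult_left_cancel[OF c0, THEN iffD1])
qed

end

text \<open>The transform satisfies the same first-order system as the Gaussian, so its quotient by
  the Gaussian has zero derivative and is constant.\<close>

lemma fourier_bessel_gauss:
  fixes \<alpha> :: "real^'n"
  assumes \<alpha>: "admissible \<alpha>"
  shows "fourier_bessel \<alpha> (gauss UNIV) \<xi> = fourier_bessel \<alpha> (gauss UNIV) 0 * gauss UNIV \<xi>"
proof -
  let ?H = "fourier_bessel \<alpha> (gauss UNIV)"
  define E where "E \<xi> = inverse (gauss UNIV \<xi>)" for \<xi> :: "real^'n"
  have nz: "gauss UNIV \<xi> \<noteq> 0" for \<xi> :: "real^'n" by (simp add: gauss_def)
  have Hs: "ctrl_smooth (rapid norm) ?H"
    using fourier_bessel_schwartz[OF \<alpha> gauss_schwartz] by (simp add: schwartz_even_iff)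
  have dH: "(?H has_derivative (\<lambda>h. - complex_of_real (\<Sum>i\<in>UNIV. \<xi> $ i * h $ i) * ?H \<xi>)) (at \<xi>)" for \<xi>
  proof -
    have "(\<Sum>i\<in>UNIV. (h $ i) *\<^sub>R partial_deriv i ?H \<xi>) = - complex_of_real (\<Sum>i\<in>UNIV. \<xi> $ i * h $ i) * ?H \<xi>" for h
      unfolding partial_deriv_fourier_bessel_gauss[OF \<alpha>]
      by (simp add: scaleR_conv_of_real sum_distrib_left sum_distrib_right sum_negf mult_ac)
    thus ?thesis using has_derivative_partials[OF differentiable_on_UNIV_at[OF ctrl_smoothD(3)[OF Hs]], of \<xi>] by simp
  qed
  have dE: "(E has_derivative (\<lambda>h. E \<xi> * complex_of_real (\<Sum>i\<in>UNIV. \<xi> $ i * h $ i))) (at \<xi>)" for \<xi>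
  proof -
    have "((\<lambda>\<xi>. inverse (gauss UNIV \<xi>)) has_derivative (\<lambda>h. - (inverse (gauss UNIV \<xi>)
       * (gauss UNIV \<xi> * complex_of_real (- (\<Sum>i\<in>UNIV. \<xi> $ i * h $ i))) * inverse (gauss UNIV \<xi>)))) (at \<xi>)"
      by (rule Deriv.has_derivative_inverse[OF nz gauss_has_derivative])
    moreover have "- (inverse (gauss UNIV \<xi>) * (gauss UNIV \<xi> * complex_of_real (- (\<Sum>i\<in>UNIV. \<xi> $ i * h $ i)))
       * inverse (gauss UNIV \<xi>)) = E \<xi> * complex_of_real (\<Sum>i\<in>UNIV. \<xi> $ i * h $ i)" for h
      unfolding E_def using nz[of \<xi>] by simp
    ultimately show ?thesis unfolding E_def by (simp only:)
  qed
  have "((\<lambda>\<xi>. ?H \<xi> * E \<xi>) has_derivative (\<lambda>h. 0)) (at \<xi> within UNIV)" for \<xi>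
    using has_derivative_mult[OF dH dE, of \<xi>] by (simp add: mult_ac)
  then obtain d where d: "\<And>\<xi>. ?H \<xi> * E \<xi> = d"
    using has_derivative_zero_constant[OF convex_UNIV, of "\<lambda>\<xi>. ?H \<xi> * E \<xi>"] by blast
  have "E 0 = 1" by (simp add: E_def gauss_def)
  hence "?H \<xi> * E \<xi> = ?H 0" using d[of \<xi>] d[of 0] by simp
  thus ?thesis using nz[of \<xi>] by (simp add: E_def field_simps)
qed

text \<open>At the origin the kernel is 1, so the value is the integral of a positive function. If
  it were 0, the orthant would be a null set, although it contains a box of volume 1.\<close>

lemma fourier_bessel_gauss_nonzero:
  fixes \<alpha> :: "real^'n"
  assumes \<alpha>: "admissible \<alpha>"
  shows "fourier_bessel \<alpha> (gauss UNIV) 0 \<noteq> 0"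
proof
  let ?M = "bessel_measure \<alpha>"
  let ?e = "\<lambda>x::real^'n. exp (- (\<Sum>i\<in>UNIV. (x $ i)\<^sup>2) / 2)"
  assume "fourier_bessel \<alpha> (gauss UNIV) 0 = 0"
  moreover have "bessel_j (\<alpha> $ i) 0 = 1" for i
  proof -
    have a: "-1/2 < \<alpha> $ i" using \<alpha> by blast
    show ?thesis using bessel_j_zero[OF a] .
  qed
  ultimately have "complex_of_real (LINT x|?M. ?e x) = 0"
    unfolding fourier_bessel_def gauss_def by simp
  hence I0: "(LINT x|?M. ?e x) = 0" by simp
  have int: "integrable ?M ?e"
  proof -
    have "integrable ?M (gauss UNIV)"
      by (intro integrable_bessel_smooth[OF \<alpha>] gauss_ctrl_smooth)
    from integrable_norm[OF this] show ?thesis by (simp add: gauss_def)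
  qed
  have "AE x in ?M. ?e x = 0"
    using integral_nonneg_eq_0_iff_AE[OF int] I0 by simp
  hence "AE x in ?M. False" by simp
  hence "AE x in restrict_space lborel pos_orthant. 0 < ennreal (bessel_weight \<alpha> x) \<longrightarrow> False"
    unfolding bessel_measure_def by (subst (asm) AE_density) (auto intro!: measurable_restrict_space1)
  hence "AE x in lborel. x \<in> pos_orthant \<longrightarrow> \<not> 0 < ennreal (bessel_weight \<alpha> x)"
    by (subst (asm) AE_restrict_space_iff) auto
  hence "AE x in lborel. x \<notin> (pos_orthant :: (real^'n) set)"
  proof eventually_elim
    fix x :: "real^'n" assume *: "x \<in> pos_orthant \<longrightarrow> \<not> 0 < ennreal (bessel_weight \<alpha> x)"
    show "x \<notin> pos_orthant"
    proof
      assume x: "x \<in> pos_orthant"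
      have "0 < bessel_weight \<alpha> x"
      proof (rule prod_pos)
        fix i
        have "0 < x $ i" using x by (simp add: pos_orthant_def)
        thus "0 < x $ i powr (2 * \<alpha> $ i + 1)" by simp
      qed
      thus False using * x by simp
    qed
  qed
  hence "emeasure lborel (pos_orthant :: (real^'n) set) = 0"
    by (subst (asm) AE_iff_measurable[of pos_orthant]) auto
  moreover have "box 0 (\<chi> i. 1) \<subseteq> (pos_orthant :: (real^'n) set)"
    by (auto simp: mem_box_cart pos_orthant_def)
  ultimately have "emeasure lborel (box 0 (\<chi> i. 1) :: (real^'n) set) = 0"
    using emeasure_mono[of "box 0 (\<chi> i. 1)" "pos_orthant :: (real^'n) set" lborel] by simp
  moreover have "(\<chi> i. 1) \<bullet> b = 1" if "b \<in> Basis" for b :: "real^'n"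
    using that by (auto simp: Basis_vec_def inner_axis)
  ultimately show False by (simp add: emeasure_lborel_box_eq)
qed

subsection \<open>Inversion\<close>

definition freeze :: "'n set \<Rightarrow> real^'n \<Rightarrow> real^'n \<Rightarrow> real^'n" where
  "freeze S a x = (\<chi> k. if k \<in> S then a $ k else x $ k)"

lemma freeze_component: "freeze S a x $ k = (if k \<in> S then a $ k else x $ k)"
  by (simp add: freeze_def)

lemma freeze_has_derivative: "(freeze S a has_derivative proj (- S)) (at x)"
proof -
  have eq: "freeze S a = (\<lambda>x. freeze S a 0 + proj (- S) x)"
    by (simp add: fun_eq_iff vec_eq_iff freeze_component proj_def)
  have bl: "bounded_linear (proj (- S))"
    unfolding linear_conv_bounded_linear[symmetric]
    by (rule linearI) (auto simp: vec_eq_iff proj_def)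
  have "((\<lambda>x. freeze S a 0 + proj (- S) x) has_derivative (\<lambda>h. 0 + proj (- S) h)) (at x)"
    by (intro has_derivative_add has_derivative_const bounded_linear_imp_has_derivative bl)
  thus ?thesis unfolding eq[symmetric] by simp
qed

lemma freeze_differentiable: "f differentiable_on UNIV \<Longrightarrow> (\<lambda>x. f (freeze S a x)) differentiable_on UNIV"
  unfolding differentiable_on_def differentiable_def
  using has_derivative_compose[OF freeze_has_derivative] by blast

lemma partial_deriv_freeze:
  fixes f :: "real^'n \<Rightarrow> complex"
  assumes "f differentiable_on UNIV"
  shows "partial_deriv k (\<lambda>x. f (freeze S a x)) = (\<lambda>x. if k \<in> S then 0 else partial_deriv k f (freeze S a x))"
proof
  fix x
  obtain f' where f': "(f has_derivative f') (at (freeze S a x))"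
    using differentiable_on_UNIV_at[OF assms] differentiable_def by blast
  have "proj (- S) (axis k 1) = (if k \<in> S then 0 else axis k 1)"
    by (auto simp: vec_eq_iff proj_def axis_def)
  thus "partial_deriv k (\<lambda>x. f (freeze S a x)) x = (if k \<in> S then 0 else partial_deriv k f (freeze S a x))"
    using partial_deriv_has_derivative[OF has_derivative_compose[OF freeze_has_derivative f']]
      partial_deriv_has_derivative[OF f'] linear_0[OF has_derivative_linear[OF f']] by simp
qed

text \<open>Freezing destroys decay in the variables of S, so the gauge sees only the remaining
  ones. Derivatives in frozen directions vanish, and the others commute with freezing.\<close>

lemma ctrl_smooth_freeze:
  fixes f :: "real^'n \<Rightarrow> complex"
  assumes "ctrl_smooth (rapid norm) f"
  shows "ctrl_smooth (rapid (\<lambda>x. norm (proj (- S) x))) (\<lambda>x. f (freeze S a x))"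
proof (rule ctrl_smoothI)
  let ?q = "\<lambda>x. norm (proj (- S) x)"
  have r: "rapid ?q (\<lambda>x. f (freeze S a x))" if rf: "rapid norm f" for f
    unfolding rapid_def
  proof
    fix k
    obtain C where C: "\<And>x. (1 + norm x) ^ k * norm (f x) \<le> C" using rf unfolding rapid_def by blast
    have "(1 + ?q x) ^ k * norm (f (freeze S a x)) \<le> C" for x
    proof -
      have "?q x \<le> norm (freeze S a x)"
        by (rule norm_le_componentwise_cart) (auto simp: proj_def freeze_component)
      hence "(1 + ?q x) ^ k * norm (f (freeze S a x)) \<le> (1 + norm (freeze S a x)) ^ k * norm (f (freeze S a x))"
        by (intro mult_right_mono power_mono) auto
      thus ?thesis using C[of "freeze S a x"] by simp
    qed
    thus "\<exists>C. \<forall>x. (1 + ?q x) ^ k * norm (f (freeze S a x)) \<le> C" by blast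
  qed
  show "ctrl_diff (rapid ?q) m (\<lambda>x. f (freeze S a x))" for m
    using assms
  proof (induction m arbitrary: f)
    case 0
    show ?case using r[OF ctrl_smoothD(2)[OF 0]]
      differentiable_imp_continuous_on[OF freeze_differentiable[OF ctrl_smoothD(3)[OF 0]]] by simp
  next
    case (Suc m)
    have "ctrl_diff (rapid ?q) m (\<lambda>x. 0)"
      by (intro ctrl_diff_const) (auto simp: rapid_def)
    hence "ctrl_diff (rapid ?q) m (partial_deriv k (\<lambda>x. f (freeze S a x)))" for k
      unfolding partial_deriv_freeze[OF ctrl_smoothD(3)[OF Suc.prems]]
      using Suc.IH[OF ctrl_smoothD(5)[OF Suc.prems]] by (cases "k \<in> S") simp_all
    thus ?case using r[OF ctrl_smoothD(2)[OF Suc.prems]] freeze_differentiable[OF ctrl_smoothD(3)[OF Suc.prems]]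
      by simp
  qed
qed

lemma rapid_mult_complementary:
  assumes f: "rapid (\<lambda>x. norm (proj (- S) x)) f" and g: "rapid (\<lambda>x. norm (proj S x)) g"
  shows "rapid norm (\<lambda>x. f x * g x)"
  unfolding rapid_def
proof
  fix k
  obtain C where C: "\<And>x. (1 + norm (proj (- S) x)) ^ k * norm (f x) \<le> C" using f unfolding rapid_def by blast
  obtain D where D: "\<And>x. (1 + norm (proj S x)) ^ k * norm (g x) \<le> D" using g unfolding rapid_def by blast
  have "(1 + norm x) ^ k * norm (f x * g x) \<le> C * D" for x
  proof -
    let ?p = "norm (proj (- S) x)" and ?q = "norm (proj S x)"
    have "x = proj (- S) x + proj S x" by (simp add: vec_eq_iff proj_def)
    hence "norm x \<le> ?p + ?q" by (metis norm_triangle_ineq)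
    moreover have "0 \<le> ?p * ?q" by simp
    ultimately have "1 + norm x \<le> (1 + ?p) * (1 + ?q)" unfolding distrib_left distrib_right by linarith
    hence "(1 + norm x) ^ k \<le> ((1 + ?p) * (1 + ?q)) ^ k" by (intro power_mono) auto
    hence "(1 + norm x) ^ k * norm (f x * g x) \<le> ((1 + ?p) * (1 + ?q)) ^ k * (norm (f x) * norm (g x))"
      unfolding norm_mult by (intro mult_right_mono) auto
    also have "\<dots> = ((1 + ?p) ^ k * norm (f x)) * ((1 + ?q) ^ k * norm (g x))"
      by (simp add: power_mult_distrib mult_ac)
    also have "\<dots> \<le> C * D"
      using order_trans[OF _ C[of x]] by (intro mult_mono C D) auto
    finally show ?thesis .
  qed
  thus "\<exists>C. \<forall>x. (1 + norm x) ^ k * norm (f x * g x) \<le> C" by blast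
qed

text \<open>Replacing the \<open>i\<close>-th variable by \<open>a\<^sub>i\<close> up to a Gaussian does not
  change the function at \<open>x\<^sub>i = a\<^sub>i\<close>, so the difference is divisible by
  \<open>x\<^sub>i\<^sup>2 - a\<^sub>i\<^sup>2\<close>.\<close>

definition gauss_freeze :: "'n \<Rightarrow> real^'n \<Rightarrow> (real^'n \<Rightarrow> complex) \<Rightarrow> real^'n \<Rightarrow> complex" where
  "gauss_freeze i a f x = complex_of_real (exp ((a $ i)\<^sup>2 / 2)) * (f (freeze {i} a x) * gauss {i} x)"

lemma gauss_freeze_schwartz:
  assumes f: "f \<in> schwartz_even"
  shows "gauss_freeze i a f \<in> schwartz_even"
proof -
  have sf: "ctrl_smooth (rapid norm) f" and ev: "\<And>k x. f (flip k x) = f x"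
    using f by (auto simp: schwartz_even_iff even_fun_iff)
  have "ctrl_smooth (rapid norm) (\<lambda>x. f (freeze {i} a x) * gauss {i} x)"
    by (rule ctrl_smoothI, rule ctrl_diff_mult[OF _ _ ctrl_smoothD(1)[OF ctrl_smooth_freeze[OF sf]]
          ctrl_smoothD(1)[OF ctrl_smooth_gauss]])
      (auto intro: rapid_add rapid_mult_complementary)
  moreover have "even_fun (\<lambda>x. f (freeze {i} a x) * gauss {i} x)"
  proof -
    have "f (freeze {i} a (flip k x)) = f (freeze {i} a x)" for k x
    proof (cases "k = i")
      case True
      hence "freeze {i} a (flip k x) = freeze {i} a x" by (simp add: vec_eq_iff freeze_component flip_component)
      thus ?thesis by simp
    next
      case False
      hence "freeze {i} a (flip k x) = flip k (freeze {i} a x)" by (auto simp: vec_eq_iff freeze_component flip_component)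
      thus ?thesis by (simp add: ev)
    qed
    thus ?thesis by (simp add: even_fun_iff gauss_def flip_component)
  qed
  ultimately have "(\<lambda>x. f (freeze {i} a x) * gauss {i} x) \<in> schwartz_even" by (simp add: schwartz_even_iff)
  thus ?thesis unfolding gauss_freeze_def[abs_def] by (rule schwartz_even_cmult)
qed

lemma fourier_bessel_twice_eq_0:
  fixes \<alpha> :: "real^'n"
  assumes \<alpha>: "admissible \<alpha>" and f: "f \<in> schwartz_even" and zero: "\<And>x. x $ i = a $ i \<Longrightarrow> f x = 0"
  shows "fourier_bessel \<alpha> (fourier_bessel \<alpha> f) a = 0"
proof -
  let ?F = "fourier_bessel \<alpha>"
  obtain g where g: "g \<in> schwartz_even" "\<And>x. f x = complex_of_real ((x $ i)\<^sup>2 - (a $ i)\<^sup>2) * g x"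
    using schwartz_divide_square[OF f zero] by blast
  let ?q = "\<lambda>x. complex_of_real ((x $ i)\<^sup>2) * g x"
  let ?d = "- complex_of_real ((a $ i)\<^sup>2)"
  have q: "?q \<in> schwartz_even" using g(1) by (rule schwartz_even_component_square)
  have "f = (\<lambda>x. ?q x + ?d * g x)" unfolding g(2) by (simp add: fun_eq_iff algebra_simps)
  hence "?F f = (\<lambda>\<xi>. ?F ?q \<xi> + ?d * ?F g \<xi>)"
    using fourier_bessel_add[OF \<alpha> q schwartz_even_cmult[OF g(1), of ?d]] unfolding fourier_bessel_cmult by simp
  hence "?F (?F f) a
    = ?F (?F ?q) a + ?d * ?F (?F g) a"
    using fourier_bessel_add[OF \<alpha> fourier_bessel_schwartz[OF \<alpha> q]
        schwartz_even_cmult[OF fourier_bessel_schwartz[OF \<alpha> g(1)], of ?d]]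
    unfolding fourier_bessel_cmult by simp
  thus ?thesis unfolding fourier_bessel_twice_square[OF \<alpha> g(1)] by simp
qed

lemma fourier_bessel_twice_gauss_freeze:
  fixes \<alpha> :: "real^'n"
  assumes \<alpha>: "admissible \<alpha>" and f: "f \<in> schwartz_even"
  shows "fourier_bessel \<alpha> (fourier_bessel \<alpha> f) a = fourier_bessel \<alpha> (fourier_bessel \<alpha> (gauss_freeze i a f)) a"
proof -
  let ?F = "fourier_bessel \<alpha>"
  let ?g = "gauss_freeze i a f"
  let ?h = "\<lambda>x. f x + (- 1) * ?g x"
  have g: "?g \<in> schwartz_even" using f by (rule gauss_freeze_schwartz)
  have h: "?h \<in> schwartz_even" by (intro schwartz_even_add f schwartz_even_cmult g)
  have "?F (?F ?h) a = 0"
  proof (rule fourier_bessel_twice_eq_0[OF \<alpha> h])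
    fix x assume x: "x $ i = a $ i"
    hence "freeze {i} a x = x" by (auto simp: vec_eq_iff freeze_component)
    \<comment> \<open>The exponential prefactor normalizes the Gaussian to 1 on the hyperplane,
      which is what makes the difference vanish there.\<close>
    moreover have "complex_of_real (exp ((a $ i)\<^sup>2 / 2)) * gauss {i} x = 1"
      unfolding gauss_def of_real_mult[symmetric] exp_add[symmetric] using x by simp
    ultimately have "?g x = f x" unfolding gauss_freeze_def by (simp add: mult.left_commute)
    thus "?h x = 0" by simp
  qed
  moreover have "?F (?F ?h) a
    = ?F (?F f) a + (- 1) * ?F (?F ?g) a"
    unfolding fourier_bessel_add[OF \<alpha> f schwartz_even_cmult[OF g]] fourier_bessel_cmult
    unfolding fourier_bessel_add[OF \<alpha> fourier_bessel_schwartz[OF \<alpha> f]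
        schwartz_even_cmult[OF fourier_bessel_schwartz[OF \<alpha> g]]] fourier_bessel_cmult ..
  ultimately show ?thesis by simp
qed

text \<open>The induction over the set of frozen variables carries an explicit formula for the
  replaced function. When all variables are frozen it is f(a) exp (|a|^2 / 2) times the full
  Gaussian, on which each of the two transforms acts by the same scalar; at a the exponential
  cancels the Gaussian.\<close>

lemma fourier_bessel_inversion:
  fixes \<alpha> :: "real^'n"
  assumes \<alpha>: "admissible \<alpha>" and f: "f \<in> schwartz_even"
  shows "fourier_bessel \<alpha> (fourier_bessel \<alpha> f) a = (fourier_bessel \<alpha> (gauss UNIV) 0)\<^sup>2 * f a"
proof -
  let ?F = "fourier_bessel \<alpha>"
  let ?C = "?F (gauss UNIV) 0"
  let ?e = "\<lambda>S. complex_of_real (exp ((\<Sum>i\<in>S. (a $ i)\<^sup>2) / 2))"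
  have "\<exists>g\<in>schwartz_even. ?F (?F f) a = ?F (?F g) a
      \<and> (\<forall>x. g x = ?e S * (f (freeze S a x) * gauss S x))" if "finite S" for S
    using that
  proof (induction S)
    case empty
    have "freeze {} a x = x" for x by (simp add: vec_eq_iff freeze_component)
    thus ?case using f by (intro bexI[of _ f]) (auto simp: gauss_def)
  next
    case (insert i S)
    then obtain g where g: "g \<in> schwartz_even"
      "?F (?F f) a = ?F (?F g) a"
      "\<And>x. g x = ?e S * (f (freeze S a x) * gauss S x)" by blast
    have eq: "gauss_freeze i a g x = ?e (insert i S) * (f (freeze (insert i S) a x) * gauss (insert i S) x)" for x
    proof -
      have "freeze S a (freeze {i} a x) = freeze (insert i S) a x"
        by (auto simp: vec_eq_iff freeze_component)
      moreover have "gauss S (freeze {i} a x) = gauss S x"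
      proof -
        have "(\<Sum>k\<in>S. (freeze {i} a x $ k)\<^sup>2) = (\<Sum>k\<in>S. (x $ k)\<^sup>2)"
          using insert.hyps by (intro sum.cong) (auto simp: freeze_component)
        thus ?thesis by (simp add: gauss_def)
      qed
      moreover have "gauss (insert i S) x = gauss {i} x * gauss S x"
        unfolding gauss_def of_real_mult[symmetric] exp_add[symmetric] using insert.hyps
        by (simp add: add_divide_distrib diff_divide_distrib)
      moreover have "?e (insert i S) = complex_of_real (exp ((a $ i)\<^sup>2 / 2)) * ?e S"
        unfolding of_real_mult[symmetric] exp_add[symmetric] using insert.hyps
        by (simp add: add_divide_distrib)
      ultimately show ?thesis unfolding gauss_freeze_def g(3) by (simp add: mult_ac)
    qed
    show ?case
    proof (rule bexI[of _ "gauss_freeze i a g"], intro conjI allI)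
      show "?F (?F f) a
        = ?F (?F (gauss_freeze i a g)) a"
        by (rule trans[OF g(2) fourier_bessel_twice_gauss_freeze[OF \<alpha> g(1)]])
      show "gauss_freeze i a g \<in> schwartz_even" using g(1) by (rule gauss_freeze_schwartz)
    qed (rule eq)
  qed
  from this[OF finite_class.finite_UNIV] obtain g where
    g: "?F (?F f) a = ?F (?F g) a"
    "\<And>x. g x = ?e UNIV * (f (freeze UNIV a x) * gauss UNIV x)" by blast
  have "freeze UNIV a x = a" for x by (simp add: vec_eq_iff freeze_component)
  hence "g = (\<lambda>x. (?e UNIV * f a) * gauss UNIV x)" using g(2) by (simp add: fun_eq_iff)
  hence "?F (?F g) a
    = (?e UNIV * f a) * ?F (?F (gauss UNIV)) a"
    by (simp only: fourier_bessel_cmult)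
  also have "?F (?F (gauss UNIV)) a = ?C * (?C * gauss UNIV a)"
  proof -
    have "?F (gauss UNIV) = (\<lambda>\<xi>. ?C * gauss UNIV \<xi>)"
      using fourier_bessel_gauss[OF \<alpha>] by blast
    hence "?F (?F (gauss UNIV)) = ?F (\<lambda>\<xi>. ?C * gauss UNIV \<xi>)"
      by (rule arg_cong)
    thus ?thesis using fourier_bessel_gauss[OF \<alpha>, of a] by (simp only: fourier_bessel_cmult)
  qed
  finally have "?F (?F g) a = (?e UNIV * f a) * (?C * (?C * gauss UNIV a))" .
  moreover have "?e UNIV * gauss UNIV a = 1"
    unfolding gauss_def of_real_mult[symmetric] exp_add[symmetric] by simp
  hence "(?e UNIV * f a) * (?C * (?C * gauss UNIV a)) = ?C\<^sup>2 * f a"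
    unfolding power2_eq_square by algebra
  ultimately show ?thesis using g(1) by simp
qed

subsection \<open>The Sobolev embedding\<close>

lemma bessel_kernel_measurable_pair:
  assumes \<gamma>: "admissible \<gamma>"
  shows "(\<lambda>p. bessel_kernel \<gamma> \<beta> (fst p) (snd p)) \<in> borel_measurable (bessel_measure \<alpha> \<Otimes>\<^sub>M bessel_measure \<alpha>)"
proof -
  let ?M = "bessel_measure \<alpha>"
  have c: "(\<lambda>x. x $ i) \<in> borel_measurable ?M" for i
    by (intro measurable_bessel_measure) measurable
  have j: "bessel_jd (\<beta> i) (\<gamma> $ i) \<in> borel_measurable borel" for i
  proof (intro borel_measurable_continuous_onI continuous_at_imp_continuous_on ballI)
    fix t
    show "isCont (bessel_jd (\<beta> i) (\<gamma> $ i)) t"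
      using \<gamma> by (intro DERIV_isCont[OF bessel_jd_deriv]) blast
  qed
  have "(\<lambda>p. \<Prod>i\<in>UNIV. bessel_jd (\<beta> i) (\<gamma> $ i) (fst p $ i * snd p $ i))
    \<in> borel_measurable (?M \<Otimes>\<^sub>M ?M)"
    by (intro borel_measurable_prod measurable_compose[OF _ j] borel_measurable_times
        measurable_compose[OF measurable_fst c] measurable_compose[OF measurable_snd c])
  thus ?thesis unfolding bessel_kernel_def
    by (rule measurable_compose) (intro borel_measurable_continuous_onI continuous_intros)
qed

text \<open>Fubini with a kernel that is symmetric and bounded by 1, so |\<theta>(\<xi>)| |f(x)| is
  an integrable majorant. Integrability of \<theta> suffices, as required for a function obtained
  from L^2 data.\<close>

lemma fourier_bessel_pairing:
  fixes \<alpha> :: "real^'n"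
  assumes \<alpha>: "admissible \<alpha>"
    and \<theta>: "integrable (bessel_measure \<alpha>) \<theta>" and f: "integrable (bessel_measure \<alpha>) f"
  shows "(LINT \<xi>|bessel_measure \<alpha>. \<theta> \<xi> * fourier_bessel \<alpha> f \<xi>)
    = (LINT x|bessel_measure \<alpha>. fourier_bessel \<alpha> \<theta> x * f x)"
proof -
  let ?F = "fourier_bessel \<alpha>"
  let ?M = "bessel_measure \<alpha>"
  let ?K = "bessel_kernel \<alpha> (\<lambda>_. 0)"
  interpret S: sigma_finite_measure ?M by (rule sigma_finite_bessel_measure)
  interpret pair_sigma_finite ?M ?M ..
  have K1: "norm (?K \<xi> x) \<le> 1" for \<xi> x using norm_bessel_kernel_le[OF \<alpha>, of "\<lambda>_. 0"] by simp
  have meas: "(\<lambda>p. \<theta> (fst p) * (f (snd p) * ?K (fst p) (snd p))) \<in> borel_measurable (?M \<Otimes>\<^sub>M ?M)"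
    using \<theta> f by (intro borel_measurable_times bessel_kernel_measurable_pair[OF \<alpha>]
        measurable_compose[OF measurable_fst] measurable_compose[OF measurable_snd]) auto
  have i2: "integrable ?M (\<lambda>x. \<theta> \<xi> * (f x * ?K \<xi> x))" for \<xi>
    by (intro integrable_mult_right integrable_mult_bessel_kernel \<alpha> f)
  have "integrable (?M \<Otimes>\<^sub>M ?M) (case_prod (\<lambda>\<xi> x. \<theta> \<xi> * (f x * ?K \<xi> x)))"
  proof (rule Fubini_integrable)
    show m: "case_prod (\<lambda>\<xi> x. \<theta> \<xi> * (f x * ?K \<xi> x)) \<in> borel_measurable (?M \<Otimes>\<^sub>M ?M)"
      using meas by (simp add: case_prod_beta)
    have mn: "(\<lambda>(\<xi>, x). norm (\<theta> \<xi> * (f x * ?K \<xi> x))) \<in> borel_measurable (?M \<Otimes>\<^sub>M ?M)"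
      using measurable_compose[OF meas borel_measurable_norm] by (simp add: case_prod_beta)
    show "integrable ?M (\<lambda>\<xi>. LINT x|?M. norm (case (\<xi>, x) of (\<xi>, x) \<Rightarrow> \<theta> \<xi> * (f x * ?K \<xi> x)))"
      unfolding prod.case
    proof (rule Bochner_Integration.integrable_bound)
      show "integrable ?M (\<lambda>\<xi>. norm (\<theta> \<xi>) * (LINT x|?M. norm (f x)))"
        using \<theta> by (intro integrable_mult_left integrable_norm)
      show "(\<lambda>\<xi>. LINT x|?M. norm (\<theta> \<xi> * (f x * ?K \<xi> x))) \<in> borel_measurable ?M"
        using S.borel_measurable_lebesgue_integral[OF mn] .
      have "norm (LINT x|?M. norm (\<theta> \<xi> * (f x * ?K \<xi> x))) \<le> norm (norm (\<theta> \<xi>) * (LINT x|?M. norm (f x)))" for \<xi>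
      proof -
        have "(LINT x|?M. norm (\<theta> \<xi> * (f x * ?K \<xi> x))) \<le> (LINT x|?M. norm (\<theta> \<xi>) * norm (f x))"
        proof (rule integral_mono)
          show "integrable ?M (\<lambda>x. norm (\<theta> \<xi> * (f x * ?K \<xi> x)))" by (rule integrable_norm[OF i2])
          show "integrable ?M (\<lambda>x. norm (\<theta> \<xi>) * norm (f x))" using f by (intro integrable_mult_right integrable_norm)
          have "norm (f x) * norm (?K \<xi> x) \<le> norm (f x) * 1" for x by (intro mult_left_mono K1) auto
          thus "norm (\<theta> \<xi> * (f x * ?K \<xi> x)) \<le> norm (\<theta> \<xi>) * norm (f x)" for x
            unfolding norm_mult by (intro mult_left_mono) auto
        qed
        moreover have "0 \<le> (LINT x|?M. norm (\<theta> \<xi> * (f x * ?K \<xi> x)))" by (intro Bochner_Integration.integral_nonneg) auto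
        moreover have "0 \<le> (LINT x|?M. norm (f x))" by (intro Bochner_Integration.integral_nonneg) auto
        ultimately show ?thesis by simp
      qed
      thus "AE \<xi> in ?M. norm (LINT x|?M. norm (\<theta> \<xi> * (f x * ?K \<xi> x))) \<le> norm (norm (\<theta> \<xi>) * (LINT x|?M. norm (f x)))"
        by blast
    qed
    show "AE \<xi> in ?M. integrable ?M (\<lambda>x. case (\<xi>, x) of (\<xi>, x) \<Rightarrow> \<theta> \<xi> * (f x * ?K \<xi> x))"
      using i2 by simp
  qed
  from Fubini_integral[OF this]
  have "(LINT x|?M. LINT \<xi>|?M. \<theta> \<xi> * (f x * ?K \<xi> x)) = (LINT \<xi>|?M. LINT x|?M. \<theta> \<xi> * (f x * ?K \<xi> x))" .
  moreover have "(LINT x|?M. \<theta> \<xi> * (f x * ?K \<xi> x)) = \<theta> \<xi> * ?F f \<xi>" for \<xi>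
    unfolding fourier_bessel_eq bessel_integral_def by (rule integral_mult_right_zero)
  moreover have "(LINT \<xi>|?M. \<theta> \<xi> * (f x * ?K \<xi> x)) = ?F \<theta> x * f x" for x
  proof -
    have "\<theta> \<xi> * (f x * ?K \<xi> x) = (\<theta> \<xi> * ?K x \<xi>) * f x" for \<xi>
      by (simp add: bessel_kernel_commute[of _ _ x] mult_ac)
    thus ?thesis unfolding fourier_bessel_eq bessel_integral_def by (simp only: integral_mult_left_zero)
  qed
  ultimately show ?thesis by (simp only:)
qed

text \<open>The product of the L^2 function with the weight is integrable because the square of (1 +
  |\<xi>|)^m (1 + |\<xi>|^2)^(-s) is; the moment of order m pays for m derivatives of the
  transform.\<close>

lemma integrable_L2_bessel_mult_powr:
  fixes \<alpha> :: "real^'n"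
  assumes \<alpha>: "\<forall>i. \<alpha> $ i > - 1 / 2"
    and s: "s > 1 / 2 * ((\<Sum>i\<in>UNIV. \<alpha> $ i) + real CARD('n)) + real m"
    and \<psi>: "\<psi> \<in> L2_bessel \<alpha>"
  shows "(\<lambda>\<xi>. \<psi> \<xi> * complex_of_real ((1 + (norm \<xi>)\<^sup>2) powr (- s))) \<in> borel_measurable (bessel_measure \<alpha>)"
    and "integrable (bessel_measure \<alpha>)
      (\<lambda>\<xi>. (1 + norm \<xi>) ^ m * norm (\<psi> \<xi> * complex_of_real ((1 + (norm \<xi>)\<^sup>2) powr (- s))))"
proof -
  let ?M = "bessel_measure \<alpha>"
  let ?h = "\<lambda>\<xi>::real^'n. (1 + (norm \<xi>)\<^sup>2) powr (- s)"
  \<comment> \<open>Since (1 + |\<xi>|)^2 \<le> 2 (1 + |\<xi>|^2), the squared weight is at most 2^m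
    (1 + |\<xi>|^2)^(m - 2 s).\<close>
  let ?a = "2 * s - real m"
  have \<psi>m: "\<psi> \<in> borel_measurable ?M" and \<psi>2: "integrable ?M (\<lambda>x. (norm (\<psi> x))\<^sup>2)"
    using \<psi> by (auto simp: L2_bessel_def)
  have "(\<lambda>\<xi>. complex_of_real (?h \<xi>)) \<in> borel_measurable ?M"
    by (intro measurable_bessel_measure) measurable
  thus m1: "(\<lambda>\<xi>. \<psi> \<xi> * complex_of_real (?h \<xi>)) \<in> borel_measurable ?M"
    by (rule borel_measurable_times[OF \<psi>m])
  have "x < 2 * s - real m" if "1 / 2 * x + real m < s" for x
  proof -
    have "x + 2 * real m < 2 * s" using that by simp
    thus ?thesis by simp
  qed
  from this[OF s] have "?a > (\<Sum>i\<in>UNIV. \<alpha> $ i) + real CARD('n)" .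
  hence h2: "integrable ?M (\<lambda>\<xi>. (1 + (norm \<xi>)\<^sup>2) powr (- ?a))"
    using \<alpha> by (intro integrable_bessel_power) auto
  show "integrable ?M (\<lambda>\<xi>. (1 + norm \<xi>) ^ m * norm (\<psi> \<xi> * complex_of_real (?h \<xi>)))"
  proof (rule Bochner_Integration.integrable_bound)
    show "integrable ?M (\<lambda>\<xi>. (norm (\<psi> \<xi>))\<^sup>2 + 2 ^ m * (1 + (norm \<xi>)\<^sup>2) powr (- ?a))"
      by (intro Bochner_Integration.integrable_add \<psi>2 integrable_mult_right h2)
    have "(\<lambda>\<xi>. (1 + norm \<xi>) ^ m) \<in> borel_measurable ?M" by (intro measurable_bessel_measure) measurable
    thus "(\<lambda>\<xi>. (1 + norm \<xi>) ^ m * norm (\<psi> \<xi> * complex_of_real (?h \<xi>))) \<in> borel_measurable ?M"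
      by (rule borel_measurable_times[OF _ measurable_compose[OF m1 borel_measurable_norm]])
    have "norm ((1 + norm \<xi>) ^ m * norm (\<psi> \<xi> * complex_of_real (?h \<xi>)))
      \<le> norm ((norm (\<psi> \<xi>))\<^sup>2 + 2 ^ m * (1 + (norm \<xi>)\<^sup>2) powr (- ?a))" for \<xi>
    proof -
      let ?n = "norm \<xi>" and ?p = "norm (\<psi> \<xi>)"
      let ?r = "(1 + ?n) ^ m * ?h \<xi>"
      have pos: "0 < 1 + ?n\<^sup>2" by (simp add: add_pos_nonneg)
      have r0: "0 \<le> ?r" by simp
      \<comment> \<open>The pointwise counterpart of Cauchy-Schwarz; it leaves a sum of two
        integrable functions as majorant.\<close>
      have "p * r \<le> p\<^sup>2 + r\<^sup>2" if "0 \<le> p" "0 \<le> r" for p r :: real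
        using sum_squares_bound[of p r] mult_nonneg_nonneg[OF that] by linarith
      from this[OF norm_ge_zero r0] have "?p * ?r \<le> ?p\<^sup>2 + ?r\<^sup>2" .
      also have "?r\<^sup>2 = ((1 + ?n)\<^sup>2) ^ m * (1 + ?n\<^sup>2) powr (- (2 * s))"
      proof -
        have "(?h \<xi>)\<^sup>2 = (1 + ?n\<^sup>2) powr (- (2 * s))"
          unfolding power2_eq_square[of "?h \<xi>"] powr_add[symmetric] by simp
        moreover have "((1 + ?n) ^ m)\<^sup>2 = ((1 + ?n)\<^sup>2) ^ m"
          by (simp only: power_mult[symmetric] mult.commute)
        ultimately show ?thesis by (simp only: power_mult_distrib)
      qed
      also have "\<dots> \<le> (2 * (1 + ?n\<^sup>2)) ^ m * (1 + ?n\<^sup>2) powr (- (2 * s))"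
      proof (intro mult_right_mono power_mono)
        show "(1 + ?n)\<^sup>2 \<le> 2 * (1 + ?n\<^sup>2)"
          using zero_le_power2[of "?n - 1"] by (simp add: power2_diff power2_sum)
      qed auto
      also have "\<dots> = 2 ^ m * ((1 + ?n\<^sup>2) powr real m * (1 + ?n\<^sup>2) powr (- (2 * s)))"
        unfolding power_mult_distrib powr_realpow[OF pos] by (simp only: mult.assoc)
      also have "\<dots> = 2 ^ m * (1 + ?n\<^sup>2) powr (- ?a)"
        unfolding powr_add[symmetric] by simp
      finally have le: "?p * ?r \<le> ?p\<^sup>2 + 2 ^ m * (1 + ?n\<^sup>2) powr (- ?a)" by simp
      have eq: "norm ((1 + ?n) ^ m * norm (\<psi> \<xi> * complex_of_real (?h \<xi>))) = ?p * ?r"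
        by (simp add: norm_mult abs_mult mult_ac)
      show ?thesis
        unfolding eq unfolding real_norm_def by (rule order_trans[OF le abs_ge_self])
    qed
    thus "AE \<xi> in ?M. norm ((1 + norm \<xi>) ^ m * norm (\<psi> \<xi> * complex_of_real (?h \<xi>)))
      \<le> norm ((norm (\<psi> \<xi>))\<^sup>2 + 2 ^ m * (1 + (norm \<xi>)\<^sup>2) powr (- ?a))" by blast
  qed
qed

lemma even_fun_norm_powr: "even_fun (\<lambda>x :: real^'n. complex_of_real ((1 + (norm x)\<^sup>2) powr s))"
proof -
  have "norm (flip i x) = norm x" for i and x :: "real^'n"
    by (intro antisym norm_le_componentwise_cart) (auto simp: flip_component)
  thus ?thesis by (simp add: even_fun_iff)
qed

theorem proposition17:
  fixes \<alpha> :: "real^'n" and m :: nat and s :: real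
  assumes "\<forall>i. \<alpha> $ i > - 1 / 2"
    and "s > 1 / 2 * ((\<Sum>i\<in>UNIV. \<alpha> $ i) + real CARD('n)) + real m"
  shows "sobolev_bessel \<alpha> s \<subseteq> distributions_of \<alpha> (C_even m)"
proof
  fix T assume T: "T \<in> sobolev_bessel \<alpha> s"
  let ?M = "bessel_measure \<alpha>"
  let ?F = "fourier_bessel \<alpha>"
  let ?h = "\<lambda>s (\<xi>::real^'n). complex_of_real ((1 + (norm \<xi>)\<^sup>2) powr s)"
  let ?C = "(?F (gauss UNIV) 0)\<^sup>2"
  have \<alpha>: "admissible \<alpha>" using assms(1) .
  have C0: "?C \<noteq> 0" using fourier_bessel_gauss_nonzero[OF \<alpha>] by simp
  have Tt: "T \<in> tempered_even" using T by (simp add: sobolev_bessel_def)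
  obtain \<psi> where \<psi>: "\<psi> \<in> L2_bessel \<alpha>"
    "\<And>\<phi>. \<phi> \<in> schwartz_even \<Longrightarrow> mult_distr (?h s) (fourier_bessel_distr \<alpha> T) \<phi> = (LINT x|?M. \<psi> x * \<phi> x)"
    using T unfolding sobolev_bessel_def distributions_of_def by blast
  \<comment> \<open>The function that represents the transform of T once the Sobolev weight is
    removed.\<close>
  define \<theta> where "\<theta> \<xi> = \<psi> \<xi> * ?h (- s) \<xi>" for \<xi>
  note \<theta>m = integrable_L2_bessel_mult_powr[OF assms \<psi>(1), folded \<theta>_def]
  have \<theta>: "integrable ?M \<theta>" using \<theta>m by (rule integrable_of_moment)
  \<comment> \<open>The candidate for T: since F F = C on test functions, dividing F \<theta> by C
    inverts the transform.\<close>
  define \<Psi> where "\<Psi> x = (1 / ?C) * ?F \<theta> x" for x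
  have c\<theta>: "ctrl_diff bounded_fun m (?F \<theta>)"
    unfolding fourier_bessel_eq using \<alpha> \<theta>m by (rule bessel_integral_ctrl_diff)
  have c\<Psi>: "ctrl_diff bounded_fun m \<Psi>"
    unfolding \<Psi>_def by (rule ctrl_diff_mult[OF _ _ ctrl_smoothD(1)[OF ctrl_smooth_const] c\<theta>])
      (auto intro: bounded_fun_add bounded_fun_mult)
  have "even_fun \<Psi>"
    using even_fun_fourier_bessel_kernel[of \<alpha> \<alpha> \<theta>] unfolding \<Psi>_def even_fun_def fourier_bessel_eq by simp
  hence "\<Psi> \<in> C_even m" using ctrl_diff_cont_diff[OF c\<Psi>] by (simp add: C_even_def)
  moreover have "integrable ?M (\<lambda>x. \<Psi> x * f x) \<and> T f = (LINT x|?M. \<Psi> x * f x)"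
    if f: "f \<in> schwartz_even" for f
  proof
    have fi: "integrable ?M f" using f by (intro integrable_bessel_smooth \<alpha>) (simp add: schwartz_even_iff)
    have Fs: "(\<lambda>\<xi>. (1 / ?C) * ?F f \<xi>) \<in> schwartz_even"
      by (intro schwartz_even_cmult fourier_bessel_schwartz \<alpha> f)
    show "integrable ?M (\<lambda>x. \<Psi> x * f x)"
    proof -
      obtain B where B: "\<And>x. norm (\<Psi> x) \<le> B"
        using ctrl_diff_imp[OF c\<Psi>] unfolding bounded_fun_def by blast
      have c: "continuous_on UNIV \<Psi>"
        unfolding \<Psi>_def fourier_bessel_eq
        by (intro continuous_intros bessel_integral_bounded_continuous(1) \<alpha> \<theta>)
      show ?thesis
      proof (rule Bochner_Integration.integrable_bound[OF integrable_mult_right[OF integrable_norm[OF fi], of B]])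
        show "(\<lambda>x. \<Psi> x * f x) \<in> borel_measurable ?M"
          using fi by (intro borel_measurable_times measurable_bessel_measure[OF borel_measurable_continuous_onI[OF c]]) auto
        have "norm (\<Psi> x * f x) \<le> B * norm (f x)" for x unfolding norm_mult by (intro mult_right_mono B) auto
        thus "AE x in ?M. norm (\<Psi> x * f x) \<le> norm (B * norm (f x))"
          by (intro AE_I2) (auto intro: order_trans[OF _ abs_ge_self])
      qed
    qed
    \<comment> \<open>The test function is chosen so that its product with the Sobolev weight is F f
      / C, whose transform is f by inversion.\<close>
    define \<phi> where "\<phi> \<xi> = ?h (- s) \<xi> * ((1 / ?C) * ?F f \<xi>)" for \<xi>
    have \<phi>: "\<phi> \<in> schwartz_even"
      unfolding \<phi>_def by (rule schwartz_even_mult[OF even_fun_norm_powr ctrl_smooth_norm_powr Fs])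
    have h\<phi>: "(\<lambda>\<xi>. ?h s \<xi> * \<phi> \<xi>) = (\<lambda>\<xi>. (1 / ?C) * ?F f \<xi>)"
    proof
      fix \<xi> :: "real^'n"
      have "(1 + (norm \<xi>)\<^sup>2) powr s * (1 + (norm \<xi>)\<^sup>2) powr (- s) = 1"
        unfolding powr_add[symmetric] by (simp add: add_nonneg_eq_0_iff)
      hence "?h s \<xi> * ?h (- s) \<xi> = 1" unfolding of_real_mult[symmetric] by simp
      thus "?h s \<xi> * \<phi> \<xi> = (1 / ?C) * ?F f \<xi>" unfolding \<phi>_def mult.assoc[symmetric] by simp
    qed
    have "?F (\<lambda>\<xi>. (1 / ?C) * ?F f \<xi>) = f"
      unfolding fourier_bessel_cmult using fourier_bessel_inversion[OF \<alpha> f] C0 by (simp add: fun_eq_iff)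
    \<comment> \<open>Both operations on distributions are restricted to
      \<open>schwartz_even\<close>; membership of \<phi> and of F f / C removes the restrictions,
      and the right side becomes T (F (F f / C)).\<close>
    hence "T f = mult_distr (?h s) (fourier_bessel_distr \<alpha> T) \<phi>"
      unfolding mult_distr_def fourier_bessel_distr_def using \<phi> Fs by (simp add: h\<phi>)
    also have "\<dots> = (LINT x|?M. \<psi> x * \<phi> x)" by (rule \<psi>(2)[OF \<phi>])
    also have "\<dots> = (LINT \<xi>|?M. (1 / ?C) * (\<theta> \<xi> * ?F f \<xi>))"
      unfolding \<phi>_def \<theta>_def by (simp only: mult_ac)
    also have "\<dots> = (1 / ?C) * (LINT x|?M. ?F \<theta> x * f x)"
      unfolding integral_mult_right_zero fourier_bessel_pairing[OF \<alpha> \<theta> fi] ..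
    also have "\<dots> = (LINT x|?M. \<Psi> x * f x)"
      unfolding \<Psi>_def mult.assoc integral_mult_right_zero ..
    finally show "T f = (LINT x|?M. \<Psi> x * f x)" .
  qed
  ultimately show "T \<in> distributions_of \<alpha> (C_even m)"
    unfolding distributions_of_def using Tt by blast
qed

end
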